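(* Suppose that the cumulative distribution function of $\log\Lambda_1$ is log-concave both pre-change (under $\mathsf{P}_\infty$) and post-change (under $\mathsf{P}_0$). Let $1<\gamma<\infty$ be fixed, and let $A_\gamma^r$ be such that the average run length to false alarm of the SR--$r$ procedure $T_{A_\gamma^r}^r=\inf\{n\ge 1: R_n^r\ge A_\gamma^r\}$ is $\gamma$, i.e. $\mathsf{E}_\infty T_{A_\gamma^r}^r=\gamma$. Then $\mathrm{ADD}_\infty(T_{A_\gamma^r}^r)$ is an increasing function of $r$ and $$\min_{0\le r<\infty}\mathrm{ADD}_\infty(T_{A_\gamma^r}^r)=\mathrm{ADD}_\infty(T_{A_\gamma^0}^0)<\mathrm{ADD}_\infty(T_{A_{\mathsf{Q}}}^{\mathsf{Q}_{A_{\mathsf{Q}}}}),$$ where $A_{\mathsf{Q}}$ is such that $\mathsf{E}_\infty T_{A_{\mathsf{Q}}}^{\mathsf{Q}_{A_{\mathsf{Q}}}}=\gamma$.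
   Context: Changepoint model: $X_1,X_2,\dots$ are independent; $f$ and $g$ are known probability densities with respect to a dominating measure. For $\nu\in\{0,1,2,\dots\}\cup\{\infty\}$, under $\mathsf{P}_\nu$ (expectation $\mathsf{E}_\nu$) the observations $X_1,\dots,X_\nu$ have density $f$ and $X_{\nu+1},X_{\nu+2},\dots$ have density $g$; so under $\mathsf{P}_\infty$ all observations are i.i.d. with density $f$, and under $\mathsf{P}_0$ i.i.d. with density $g$. Put $\Lambda_i=g(X_i)/f(X_i)$. A cdf $F$ is log-concave if $\log F(x)$ is a concave function. SR--$r$ procedure: for $r\ge 0$ and $A>0$, let $R_0^r=r$, $R_{n+1}^r=(1+R_n^r)\Lambda_{n+1}$ for $n\ge 0$, and $T_A^r=\inf\{n\ge 1: R_n^r\ge A\}$ (with $\inf\varnothing=\infty$). The case $r=0$ is the Shiryaev--Roberts (SR) procedure, with $R_n=R_n^0$ and $T_A=T_A^0$. Quasi-stationary distribution: $\mathsf{Q}_A(x)=\lim_{n\to\infty}\mathsf{P}_\infty(R_n\le x\mid T_A>n)$. Stationary distribution: $\mathsf{Q}_{\mathrm{st}}(x)=\lim_{n\to\infty}\mathsf{P}_\infty(R_n\le x)$. Both distributions are assumed to exist. SRP procedure: $R_0^{\mathsf{Q}_A}$ is random with distribution $\mathsf{Q}_A$ (independent of the observations), $R_{n+1}^{\mathsf{Q}_A}=(1+R_n^{\mathsf{Q}_A})\Lambda_{n+1}$ for $n\ge 0$, and $T_A^{\mathsf{Q}_A}=\inf\{n\ge 1: R_n^{\mathsf{Q}_A}\ge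 A\}$. For a stopping time $T$, $\mathrm{ADD}_\infty(T)=\lim_{\nu\to\infty}\mathsf{E}_\nu(T-\nu\mid T>\nu)$. *)

theory Defs
  imports "HOL-Probability.Probability"
begin

definition prob_density :: "'x measure \<Rightarrow> ('x \<Rightarrow> real) \<Rightarrow> bool" where
  "prob_density \<mu> f \<longleftrightarrow>
     f \<in> borel_measurable \<mu> \<and> (\<forall>x\<in>space \<mu>. 0 \<le> f x) \<and> (\<integral>\<^sup>+x. ennreal (f x) \<partial>\<mu>) = 1"

text \<open>
  The law \<open>P\<^sub>\<nu>\<close> of the observation sequence, on the canonical sample space: the coordinate \<open>\<omega> i\<close>
  is the observation \<open>X\<close> with index \<open>i + 1\<close>, so the first \<open>\<nu>\<close> observations, which have density
  \<open>f\<close>, are those with \<open>i < \<nu>\<close>.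
\<close>
definition obs_law :: "'x measure \<Rightarrow> ('x \<Rightarrow> real) \<Rightarrow> ('x \<Rightarrow> real) \<Rightarrow> enat \<Rightarrow> (nat \<Rightarrow> 'x) measure" where
  "obs_law \<mu> f g \<nu> =
     (\<Pi>\<^sub>M i\<in>UNIV. density \<mu> (\<lambda>x. ennreal (if enat i < \<nu> then f x else g x)))"

text \<open>
  The densities may vanish, so the likelihood ratio takes values in \<open>[0, \<infinity>]\<close>: with the division of
  \<^typ>\<open>ereal\<close> it is \<open>\<infinity>\<close> where \<open>g x > 0 = f x\<close>. Where both densities vanish it is \<open>0\<close>, but that
  set is null under every \<open>P\<^sub>\<nu>\<close>.
\<close>
definition likelihood_ratio :: "('x \<Rightarrow> real) \<Rightarrow> ('x \<Rightarrow> real) \<Rightarrow> 'x \<Rightarrow> ereal" where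
  "likelihood_ratio f g x = ereal (g x) / ereal (f x)"

primrec SR_stat ::
  "('x \<Rightarrow> real) \<Rightarrow> ('x \<Rightarrow> real) \<Rightarrow> real \<Rightarrow> (nat \<Rightarrow> 'x) \<Rightarrow> nat \<Rightarrow> ereal" where
  "SR_stat f g r \<omega> 0 = ereal r"
| "SR_stat f g r \<omega> (Suc n) = (1 + SR_stat f g r \<omega> n) * likelihood_ratio f g (\<omega> n)"

text \<open>The infimum of the empty set in \<^typ>\<open>enat\<close> is \<open>\<infinity>\<close>.\<close>
definition SR_time ::
  "('x \<Rightarrow> real) \<Rightarrow> ('x \<Rightarrow> real) \<Rightarrow> real \<Rightarrow> real \<Rightarrow> (nat \<Rightarrow> 'x) \<Rightarrow> enat" where
  "SR_time f g A r \<omega> = Inf {enat n | n. 1 \<le> n \<and> ereal A \<le> SR_stat f g r \<omega> n}"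

text \<open>The natural logarithm on \<open>[0, \<infinity>]\<close>, with \<open>log 0 = -\<infinity>\<close> (unlike \<^term>\<open>ln (0::real)\<close>, which is \<open>0\<close>).\<close>
definition ereal_ln :: "ereal \<Rightarrow> ereal" where
  "ereal_ln x = (if x \<le> 0 then -\<infinity> else if x = \<infinity> then \<infinity> else ereal (ln (real_of_ereal x)))"

text \<open>
  Concavity of \<open>log F\<close> as a function with values in \<open>[-\<infinity>, \<infinity>)\<close>; the value \<open>-\<infinity>\<close> is taken where
  \<open>F\<close> vanishes.
\<close>
definition log_concave :: "(real \<Rightarrow> real) \<Rightarrow> bool" where
  "log_concave F \<longleftrightarrow>
     (\<forall>x y t. 0 \<le> t \<and> t \<le> 1 \<longrightarrow>
        ereal (1 - t) * ereal_ln (ereal (F x)) + ereal t * ereal_ln (ereal (F y))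
          \<le> ereal_ln (ereal (F ((1 - t) * x + t * y))))"

definition log_LR_cdf ::
  "'x measure \<Rightarrow> ('x \<Rightarrow> real) \<Rightarrow> ('x \<Rightarrow> real) \<Rightarrow> enat \<Rightarrow> real \<Rightarrow> real" where
  "log_LR_cdf \<mu> f g \<nu> x =
     \<P>(\<omega> in obs_law \<mu> f g \<nu>. ereal_ln (likelihood_ratio f g (\<omega> 0)) \<le> ereal x)"

text \<open>
  \<open>limit_law H\<close> is the distribution whose cdf is the pointwise limit of \<open>H n\<close>. It is meaningful
  only under \<open>has_limit_law H\<close>, which says that this limit exists and is the cdf of a probability
  distribution on the reals.
\<close>
definition has_limit_law :: "(nat \<Rightarrow> real \<Rightarrow> real) \<Rightarrow> bool" where
  "has_limit_law H \<longleftrightarrow> (\<exists>M. real_distribution M \<and> (\<forall>x. (\<lambda>n. H n x) \<longlonglongrightarrow> cdf M x))"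

definition limit_law :: "(nat \<Rightarrow> real \<Rightarrow> real) \<Rightarrow> real measure" where
  "limit_law H = interval_measure (\<lambda>x. lim (\<lambda>n. H n x))"

definition stationary_cdf_seq ::
  "'x measure \<Rightarrow> ('x \<Rightarrow> real) \<Rightarrow> ('x \<Rightarrow> real) \<Rightarrow> nat \<Rightarrow> real \<Rightarrow> real" where
  "stationary_cdf_seq \<mu> f g n x = \<P>(\<omega> in obs_law \<mu> f g \<infinity>. SR_stat f g 0 \<omega> n \<le> ereal x)"

definition quasi_stationary_cdf_seq ::
  "'x measure \<Rightarrow> ('x \<Rightarrow> real) \<Rightarrow> ('x \<Rightarrow> real) \<Rightarrow> real \<Rightarrow> nat \<Rightarrow> real \<Rightarrow> real" where
  "quasi_stationary_cdf_seq \<mu> f g A n x =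
     \<P>(\<omega> in obs_law \<mu> f g \<infinity>. SR_stat f g 0 \<omega> n \<le> ereal x \<bar> enat n < SR_time f g A 0 \<omega>)"

definition quasi_stationary_law ::
  "'x measure \<Rightarrow> ('x \<Rightarrow> real) \<Rightarrow> ('x \<Rightarrow> real) \<Rightarrow> real \<Rightarrow> real measure" where
  "quasi_stationary_law \<mu> f g A = limit_law (quasi_stationary_cdf_seq \<mu> f g A)"

text \<open>
  For the SRP procedure the sample space carries an additional first coordinate, the starting
  value, which has the quasi-stationary law and is independent of the observations.
\<close>
definition SRP_law ::
  "'x measure \<Rightarrow> ('x \<Rightarrow> real) \<Rightarrow> ('x \<Rightarrow> real) \<Rightarrow> real \<Rightarrow> enat \<Rightarrow> (real \<times> (nat \<Rightarrow> 'x)) measure" where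
  "SRP_law \<mu> f g A \<nu> = quasi_stationary_law \<mu> f g A \<Otimes>\<^sub>M obs_law \<mu> f g \<nu>"

definition SRP_time ::
  "('x \<Rightarrow> real) \<Rightarrow> ('x \<Rightarrow> real) \<Rightarrow> real \<Rightarrow> real \<times> (nat \<Rightarrow> 'x) \<Rightarrow> enat" where
  "SRP_time f g A = (\<lambda>(r, \<omega>). SR_time f g A r \<omega>)"

text \<open>
  In the next two definitions \<open>P\<close> is the family \<open>P\<^sub>\<nu>\<close> of laws on the sample space of the stopping
  time \<open>T\<close>. Conditioning on the event \<open>T > \<nu>\<close> is expressed by \<^const>\<open>uniform_measure\<close>.
\<close>
definition ARL :: "(enat \<Rightarrow> 'w measure) \<Rightarrow> ('w \<Rightarrow> enat) \<Rightarrow> ennreal" where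
  "ARL P T = (\<integral>\<^sup>+\<omega>. ennreal_of_enat (T \<omega>) \<partial>P \<infinity>)"

definition ADD_inf :: "(enat \<Rightarrow> 'w measure) \<Rightarrow> ('w \<Rightarrow> enat) \<Rightarrow> ennreal" where
  "ADD_inf P T =
     lim (\<lambda>\<nu>::nat. \<integral>\<^sup>+\<omega>. ennreal_of_enat (T \<omega> - enat \<nu>)
            \<partial>uniform_measure (P (enat \<nu>)) {\<omega> \<in> space (P (enat \<nu>)). enat \<nu> < T \<omega>})"

end

theory Submission
  imports Defs
begin

text \<open>
  Fix a threshold \<open>A\<close>. Given that no alarm has been raised, the statistic forgets its head start, so
  the asymptotic delay of the SR--r procedure is a number \<open>h(A)\<close> that does not depend on \<open>r\<close>, and the
  delay of the SRP procedure is \<open>h(A)\<close> as well. The mean time to a false alarm decreases strictly with the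
  starting value and increases with the threshold. At a common false alarm level the threshold is
  therefore a strictly increasing function of \<open>r\<close>, and the threshold of the SRP procedure, which starts
  at a positive value, exceeds that of the SR procedure. Everything reduces to the claim that \<open>h\<close> is
  strictly increasing.

  Divided by \<open>A\<close>, the statistic moves from \<open>z\<close> to \<open>(1 / A + z) \<Lambda>\<close> and is stopped at level one. Raising the
  threshold thus means lowering the drift. A lower drift has two effects. From a given state it
  delays the alarm; this is a pathwise comparison. And it makes the state at the changepoint smaller
  given that no alarm has been raised, which delays the alarm again. The second effect is not
  pathwise, because conditioning on survival acts differently on the two processes. It holds in the
  reversed hazard rate order, in which \<open>m1\<close> is below \<open>m2\<close> if the ratio of the distribution function of \<open>m2\<close>
  to that of \<open>m1\<close> is increasing. This order is insensitive to truncation at the threshold. If the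
  distribution function of \<open>log \<Lambda>\<close> is log-concave, then multiplication by \<open>\<Lambda>\<close> preserves the order
  (\<open>rh_le_mix\<close>); moreover the logarithm of the surviving state inherits log-concavity
  (\<open>log_conc_step_law\<close>), and for such a state adding a larger drift means moving up in the order
  (\<open>rh_le_add_log_conc\<close>). By induction the surviving states for two drifts are ordered
  (\<open>rh_le_state_drift\<close>). The first effect is bounded away from zero uniformly in the state (\<open>uniform_gap\<close>):
  if two ordered chains had the same mean stopping time, the upper one could never be stopped
  (\<open>mean_time_equal_imp_infinite\<close>).

  The head start is forgotten for the following reason. By the same order, the conditional mean delay
  after \<open>n\<close> steps is antitone in the starting value, so it suffices to compare the starting values zero
  and \<open>A\<close>. Their means are monotone in \<open>n\<close>. With probability bounded below, the chain from zero comes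
  above, and the chain from \<open>A\<close> below, a level \<open>x0\<close> (\<open>contract_start\<close>, \<open>contract_threshold\<close>); hence the two means
  have the same limit. That conditioning on survival far into the future does not spoil these
  probabilities is a Harnack inequality for survival probabilities (\<open>survival_comparison\<close>). It rests on
  the essential infimum \<open>lo\<close> of \<open>\<Lambda>\<close>: trajectories with factors close to \<open>lo\<close> are attracted by the fixed
  point \<open>lo / (1 - lo)\<close>, which never exceeds the threshold. If it equals the threshold, the inequality
  fails, but then every surviving trajectory converges to \<open>A\<close>, and the limit is found directly
  (\<open>limit_critical\<close>).
\<close>

section \<open>The reversed hazard rate order\<close>
lemma suminf_one_ennreal: "(\<Sum>n::nat. 1 :: ennreal) = \<top>"
proof (rule ccontr)
  assume "\<not> ?thesis"
  then obtain r where r: "(\<Sum>n::nat. 1 :: ennreal) = ennreal r" "0 \<le> r"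
    by (cases "\<Sum>n::nat. 1 :: ennreal") auto
  have "real n \<le> r" for n
  proof -
    have "ennreal (real n) = (\<Sum>i<n. 1)" by (simp add: ennreal_of_nat_eq_real_of_nat)
    also have "\<dots> \<le> ennreal r" unfolding r(1)[symmetric] by (rule sum_le_suminf) auto
    finally show ?thesis using r(2) by simp
  qed
  then show False using reals_Archimedean2[of r] by (meson linorder_not_less)
qed

text \<open>
  A down-set of reals is empty, everything, or a half-line; closed half-lines and the whole line are
  limits of open half-lines.
\<close>
lemma emeasure_down_set_mono:
  fixes a b :: "real measure"
  assumes "finite_measure a" "finite_measure b" "sets a = sets borel" "sets b = sets borel"
    and le: "\<And>t. emeasure a {..<t} \<le> emeasure b {..<t}"
    and D: "D \<in> sets borel" "\<And>x y. y \<in> D \<Longrightarrow> x \<le> y \<Longrightarrow> x \<in> D"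
  shows "emeasure a D \<le> emeasure b D"
proof -
  interpret a: finite_measure a by fact
  interpret b: finite_measure b by fact
  have cont_le: "emeasure a (\<Inter>n. {..<t + 1 / real (Suc n)}) \<le> emeasure b (\<Inter>n. {..<t + 1 / real (Suc n)})" for t
  proof (rule LIMSEQ_le)
    have dec: "decseq (\<lambda>n. {..<t + 1 / real (Suc n)})"
      by (auto simp: decseq_def frac_le intro: less_le_trans)
    show "(\<lambda>n. emeasure a {..<t + 1 / real (Suc n)}) \<longlonglongrightarrow> emeasure a (\<Inter>n. {..<t + 1 / real (Suc n)})"
      by (rule Lim_emeasure_decseq[OF _ dec]) (auto simp: assms a.emeasure_finite)
    show "(\<lambda>n. emeasure b {..<t + 1 / real (Suc n)}) \<longlonglongrightarrow> emeasure b (\<Inter>n. {..<t + 1 / real (Suc n)})"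
      by (rule Lim_emeasure_decseq[OF _ dec]) (auto simp: assms b.emeasure_finite)
  qed (use le in auto)
  have Inter: "(\<Inter>n. {..<t + 1 / real (Suc n)}) = {..t}" for t :: real
  proof -
    have "x \<le> t" if "\<And>n. x < t + 1 / real (Suc n)" for x
    proof (rule field_le_epsilon)
      fix e :: real assume "0 < e"
      then obtain n where "1 / real (Suc n) < e" using nat_approx_posE by blast
      then show "x \<le> t + e" using that[of n] by linarith
    qed
    then show ?thesis by (auto intro: le_less_trans simp: add_pos_pos)
  qed
  have UNIV_le: "emeasure a UNIV \<le> emeasure b UNIV"
  proof (rule LIMSEQ_le)
    have inc: "incseq (\<lambda>n. {..<real n})"
      by (auto simp: incseq_def intro: less_le_trans)
    have U: "(\<Union>n. {..<real n}) = UNIV" using reals_Archimedean2 by auto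
    show "(\<lambda>n. emeasure a {..<real n}) \<longlonglongrightarrow> emeasure a UNIV"
      using Lim_emeasure_incseq[OF _ inc, of a] by (simp add: assms U image_subset_iff)
    show "(\<lambda>n. emeasure b {..<real n}) \<longlonglongrightarrow> emeasure b UNIV"
      using Lim_emeasure_incseq[OF _ inc, of b] by (simp add: assms U image_subset_iff)
  qed (use le in auto)
  consider "D = {}" | "D = UNIV" | "D \<noteq> {}" "bdd_above D"
    by (metis D(2) bdd_above.I nle_le UNIV_eq_I)
  then show ?thesis
  proof cases
    case 3
    have "D = {..<Sup D} \<or> D = {..Sup D}"
    proof (cases "Sup D \<in> D")
      case True
      then show ?thesis using 3 D(2) by (auto intro: cSup_upper)
    next
      case False
      have "x \<in> D \<longleftrightarrow> x < Sup D" for x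
        by (metis "3" D(2) False cSup_upper less_cSup_iff less_eq_real_def order_less_imp_le)
      then show ?thesis by auto
    qed
    then show ?thesis using le cont_le Inter by metis
  qed (use UNIV_le in auto)
qed

lemma borel_measurable_antimono_ennreal:
  fixes h :: "real \<Rightarrow> ennreal"
  assumes h: "antimono h"
  shows "h \<in> borel_measurable borel"
proof (rule borel_measurableI_greater)
  fix u
  have "is_interval {x. u < h x}"
    unfolding is_interval_1 using h by (auto simp: antimono_def intro: less_le_trans)
  then have "{x. u < h x} \<in> sets borel"
    using is_real_interval by (metis atLeastAtMost_borel
      atLeastLessThan_borel atLeast_borel atMost_borel greaterThanAtMost_borel greaterThanLessThan_borel
      greaterThan_borel lessThan_borel sets.empty_sets space_borel sets.top)
  then show "{x \<in> space borel. u < h x} \<in> sets borel" by simp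
qed

text \<open>
  Layer cake: an antitone function is a superposition of indicators of its superlevel sets, which are
  down-sets.
\<close>
lemma nn_integral_antimono_le:
  fixes a b :: "real measure" and h :: "real \<Rightarrow> ennreal"
  assumes fa: "finite_measure a" and fb: "finite_measure b"
    and sa: "sets a = sets borel" and sb: "sets b = sets borel"
    and le: "\<And>t. emeasure a {..<t} \<le> emeasure b {..<t}"
    and h: "antimono h"
  shows "(\<integral>\<^sup>+x. h x \<partial>a) \<le> (\<integral>\<^sup>+x. h x \<partial>b)"
proof -
  interpret a: finite_measure a by fact
  interpret b: finite_measure b by fact
  have [measurable_cong]: "sets a = sets borel" "sets b = sets borel" by fact+
  have [measurable]: "h \<in> borel_measurable borel"
    using h by (rule borel_measurable_antimono_ennreal)
  have hdown: "{x. u < h x} \<in> sets borel" for u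
    by measurable
  have layer: "h x = (\<integral>\<^sup>+u. indicator {0..} u * indicator {..<h x} (ennreal u) \<partial>lborel)" for x
  proof (cases "h x")
    case (real r)
    have "(\<integral>\<^sup>+u. indicator {0..} u * indicator {..<h x} (ennreal u) \<partial>lborel) = (\<integral>\<^sup>+u. indicator {0..<r} u \<partial>lborel)"
      by (rule nn_integral_cong) (use real in \<open>auto simp: indicator_def ennreal_less_iff\<close>)
    then show ?thesis using real by simp
  next
    case top
    have "(\<integral>\<^sup>+u. indicator {0..} u * indicator {..<h x} (ennreal u) \<partial>lborel) = (\<integral>\<^sup>+u. indicator {0::real..} u \<partial>lborel)"
      by (rule nn_integral_cong) (use top in \<open>auto simp: indicator_def ennreal_less_top\<close>)
    also have "\<dots> = \<infinity>"
    proof (rule ccontr)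
      assume "\<not> ?thesis"
      then obtain r where r: "0 \<le> r" "emeasure lborel {0::real..} = ennreal r"
        by (cases "emeasure lborel {0::real..}") auto
      obtain n where n: "r < real n" using reals_Archimedean2 by blast
      have "ennreal (real n) = emeasure lborel {0..real n}" by simp
      also have "\<dots> \<le> emeasure lborel {0::real..}" by (rule emeasure_mono) auto
      finally show False using r n by simp
    qed
    finally show ?thesis using top by simp
  qed
  have swap: "(\<integral>\<^sup>+x. h x \<partial>m) = (\<integral>\<^sup>+u. indicator {0..} u * emeasure m {x. ennreal u < h x} \<partial>lborel)"
    if "finite_measure m" and [measurable_cong]: "sets m = sets borel" for m :: "real measure"
  proof -
    interpret m: finite_measure m by fact
    interpret p: pair_sigma_finite m lborel ..
    have "(\<integral>\<^sup>+x. h x \<partial>m) = (\<integral>\<^sup>+x. \<integral>\<^sup>+u. indicator {0..} u * indicator {..<h x} (ennreal u) \<partial>lborel \<partial>m)"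
      using layer by simp
    also have "\<dots> = (\<integral>\<^sup>+u. \<integral>\<^sup>+x. indicator {0..} u * indicator {..<h x} (ennreal u) \<partial>m \<partial>lborel)"
    proof (rule p.Fubini'[symmetric])
      have "(\<lambda>(x, u). indicator {0..} u * indicator {z. ennreal (snd z) < h (fst z)} (x, u) :: ennreal) \<in> borel_measurable (m \<Otimes>\<^sub>M lborel)"
        by measurable
      then show "(\<lambda>(x, u). indicator {0..} u * indicator {..<h x} (ennreal u) :: ennreal) \<in> borel_measurable (m \<Otimes>\<^sub>M lborel)"
        by (simp add: indicator_def case_prod_beta cong: if_cong)
    qed
    also have "\<dots> = (\<integral>\<^sup>+u. indicator {0..} u * emeasure m {x. ennreal u < h x} \<partial>lborel)"
    proof (rule nn_integral_cong)
      fix u :: real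
      have "(\<integral>\<^sup>+x. indicator {0..} u * indicator {..<h x} (ennreal u) \<partial>m)
          = (\<integral>\<^sup>+x. indicator {0..} u * indicator {x. ennreal u < h x} x \<partial>m)"
        by (rule nn_integral_cong) (auto simp: indicator_def)
      also have "\<dots> = indicator {0..} u * emeasure m {x. ennreal u < h x}"
        by (subst nn_integral_cmult_indicator) (use hdown that in auto)
      finally show "(\<integral>\<^sup>+x. indicator {0..} u * indicator {..<h x} (ennreal u) \<partial>m)
          = indicator {0..} u * emeasure m {x. ennreal u < h x}" .
    qed
    finally show ?thesis .
  qed
  show ?thesis unfolding swap[OF fa sa] swap[OF fb sb]
  proof (intro nn_integral_mono mult_left_mono)
    fix u
    show "emeasure a {x. ennreal u < h x} \<le> emeasure b {x. ennreal u < h x}"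
      by (rule emeasure_down_set_mono[OF fa fb sa sb le hdown])
        (use h in \<open>auto simp: antimono_def intro: less_le_trans\<close>)
  qed auto
qed

text \<open>
  The reversed hazard rate order: the ratio of the distribution function of \<open>m2\<close> to that of \<open>m1\<close> is
  increasing. Multiplied out, the condition makes sense where these functions vanish and does not
  depend on the total masses, so it can be used for the law of the statistic on the event of survival
  without normalising it. It is preserved when both measures are restricted to a half-line
  \<open>{..<A}\<close>, which is why it, and not the usual stochastic order, describes a process that is observed
  only as long as it stays below a threshold.
\<close>
definition rh_le :: "real measure \<Rightarrow> real measure \<Rightarrow> bool" where
  "rh_le m1 m2 \<longleftrightarrow> (\<forall>s t. s \<le> t \<longrightarrow>
     emeasure m2 {..<s} * emeasure m1 {..<t} \<le> emeasure m1 {..<s} * emeasure m2 {..<t})"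

lemma rh_leD:
  "rh_le m1 m2 \<Longrightarrow> s \<le> t \<Longrightarrow>
    emeasure m2 {..<s} * emeasure m1 {..<t} \<le> emeasure m1 {..<s} * emeasure m2 {..<t}"
  by (simp add: rh_le_def)

text \<open>
  The middle measure must not vanish, because the zero measure is comparable with every measure.
\<close>
lemma rh_le_trans:
  assumes fin: "finite_measure m1" "finite_measure m2" "finite_measure m3"
    and sets: "sets m1 = sets borel" "sets m2 = sets borel" "sets m3 = sets borel"
    and pos: "emeasure m2 UNIV \<noteq> 0"
    and le12: "rh_le m1 m2" and le23: "rh_le m2 m3"
  shows "rh_le m1 m3"
  unfolding rh_le_def
proof (intro allI impI)
  interpret m1: finite_measure m1 by fact
  interpret m2: finite_measure m2 by fact
  interpret m3: finite_measure m3 by fact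
  fix s t :: real assume st: "s \<le> t"
  define F where "F i u = emeasure (if i = 1 then m1 else if i = (2::nat) then m2 else m3) {..<u}" for i u
  have fin: "F i u \<noteq> \<top>" for i u
    by (auto simp: F_def)
  have a: "F 2 s * F 1 t \<le> F 1 s * F 2 t" and b: "F 3 s * F 2 t \<le> F 2 s * F 3 t"
    using rh_leD[OF le12 st] rh_leD[OF le23 st] by (auto simp: F_def)
  have "F 3 s * F 1 t \<le> F 1 s * F 3 t"
  proof (cases "F 2 t = 0")
    case False
    have "F 2 t * (F 3 s * F 1 t) = (F 3 s * F 2 t) * F 1 t" by (simp add: ac_simps)
    also have "\<dots> \<le> (F 2 s * F 3 t) * F 1 t" using b by (rule mult_right_mono) simp
    also have "\<dots> = (F 2 s * F 1 t) * F 3 t" by (simp add: ac_simps)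
    also have "\<dots> \<le> (F 1 s * F 2 t) * F 3 t" using a by (rule mult_right_mono) simp
    also have "\<dots> = F 2 t * (F 1 s * F 3 t)" by (simp add: ac_simps)
    finally show ?thesis using False fin by (simp add: ennreal_mult_le_mult_iff)
  next
    case True
    have "\<exists>n. F 2 (real n) \<noteq> 0"
    proof (rule ccontr)
      assume "\<not> ?thesis"
      then have "{..<real n} \<in> null_sets m2" for n using sets by (auto simp: F_def null_sets_def)
      then have "(\<Union>n. {..<real n}) \<in> null_sets m2" by (intro null_sets_UN) auto
      moreover have "(\<Union>n. {..<real n}) = UNIV" using reals_Archimedean2 by auto
      ultimately show False using pos by auto
    qed
    then obtain n where n: "F 2 (real n) \<noteq> 0" by auto
    define u where "u = max t (real n)"
    have u: "F 2 u \<noteq> 0"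
    proof -
      have "F 2 (real n) \<le> F 2 u" unfolding F_def u_def
        by (auto intro!: emeasure_mono simp: sets)
      then show ?thesis using n by auto
    qed
    have "F 3 t * F 2 u \<le> F 2 t * F 3 u" using rh_leD[OF le23, of t u] by (simp add: F_def u_def)
    then have t0: "F 3 t = 0" using u True by simp
    have "F 3 s \<le> F 3 t" unfolding F_def using st by (auto intro!: emeasure_mono simp: sets)
    then show ?thesis using t0 by simp
  qed
  then show "emeasure m3 {..<s} * emeasure m1 {..<t} \<le> emeasure m1 {..<s} * emeasure m3 {..<t}"
    by (simp add: F_def)
qed

text \<open>
  The two assumptions compare \<open>p2 / p1\<close> and \<open>q2 / q1\<close> with the same ratio \<open>F2 / F1\<close>; the zero cases
  are what has to be checked.
\<close>
lemma cross_mult_le_cancel: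
  fixes p1 p2 q1 q2 F1 F2 :: ennreal
  assumes fin: "F1 < \<top>" "F2 < \<top>"
    and p: "F1 * p2 \<le> F2 * p1" and q: "F2 * q1 \<le> F1 * q2"
    and p0: "F2 = 0 \<Longrightarrow> p2 = 0"
  shows "p2 * q1 \<le> p1 * q2"
proof (cases "F2 = 0")
  case True
  then show ?thesis using p0 by simp
next
  case F2: False
  show ?thesis
  proof (cases "F1 = 0")
    case True
    then have "q1 = 0" using q F2 by simp
    then show ?thesis by simp
  next
    case F1: False
    have "(F1 * F2) * (p2 * q1) = (F1 * p2) * (F2 * q1)" by (simp add: ac_simps)
    also have "\<dots> \<le> (F2 * p1) * (F1 * q2)" by (rule mult_mono[OF p q]) auto
    also have "\<dots> = (F1 * F2) * (p1 * q2)" by (simp add: ac_simps)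
    finally show ?thesis using F1 F2 fin
      by (subst (asm) ennreal_mult_le_mult_iff) (auto simp: ennreal_mult_eq_top_iff)
  qed
qed

text \<open>
  Weighting both measures with an antitone function and normalising turns the reversed hazard rate
  order into the usual stochastic order. At a cut point \<open>c\<close>, normalise both measures to have the same
  mass \<open>F1 * F2\<close> below \<open>c\<close>. Then below \<open>c\<close> the measure \<open>m1\<close> dominates on all half-lines, and above \<open>c\<close> the
  measure \<open>m2\<close> does, so an antitone weight gives \<open>m1\<close> relatively more below \<open>c\<close> and less above.
\<close>
lemma rh_le_weighted:
  fixes m1 m2 :: "real measure" and \<beta> :: "real \<Rightarrow> ennreal"
  assumes fin: "finite_measure m1" "finite_measure m2"
    and sets: "sets m1 = sets borel" "sets m2 = sets borel"
    and rh: "rh_le m1 m2" and \<beta>: "antimono \<beta>" and [measurable]: "\<beta> \<in> borel_measurable borel"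
  shows "(\<integral>\<^sup>+x. \<beta> x * indicator {..<c} x \<partial>m2) * (\<integral>\<^sup>+x. \<beta> x \<partial>m1)
    \<le> (\<integral>\<^sup>+x. \<beta> x * indicator {..<c} x \<partial>m1) * (\<integral>\<^sup>+x. \<beta> x \<partial>m2)"
proof -
  interpret m1: finite_measure m1 by fact
  interpret m2: finite_measure m2 by fact
  note [measurable_cong] = sets
  define F1 F2 where F: "F1 = emeasure m1 {..<c}" "F2 = emeasure m2 {..<c}"
  have Ffin: "F1 < \<top>" "F2 < \<top>" by (auto simp: F less_top[symmetric])
  define r where "r K m S = density m (\<lambda>x. K * indicator S x)" for K :: ennreal and m :: "real measure" and S
  have r_em: "emeasure (r K m S) D = K * emeasure m (S \<inter> D)"
    if [measurable_cong]: "sets m = sets borel" and [measurable]: "S \<in> sets borel" "D \<in> sets borel" for K m S D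
  proof -
    have "emeasure (r K m S) D = (\<integral>\<^sup>+x. K * indicator S x * indicator D x \<partial>m)"
      unfolding r_def by (subst emeasure_density) auto
    also have "\<dots> = (\<integral>\<^sup>+x. K * indicator (S \<inter> D) x \<partial>m)"
      by (rule nn_integral_cong) (auto simp: indicator_def)
    also have "\<dots> = K * emeasure m (S \<inter> D)"
      by (rule nn_integral_cmult_indicator) measurable
    finally show ?thesis .
  qed
  have r_int: "(\<integral>\<^sup>+x. \<beta> x \<partial>r K m S) = K * (\<integral>\<^sup>+x. \<beta> x * indicator S x \<partial>m)"
    if [measurable_cong]: "sets m = sets borel" and [measurable]: "S \<in> sets borel" for K m S
    unfolding r_def
    by (subst nn_integral_density, measurable, subst nn_integral_cmult[symmetric], measurable)
      (simp add: ac_simps)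
  have r_fin: "finite_measure (r K m S)" if "finite_measure m" "sets m = sets borel" "S \<in> sets borel" "K < \<top>" for K m S
  proof (rule finite_measureI)
    interpret m: finite_measure m by fact
    have "space m = UNIV" using that(2) sets_eq_imp_space_eq by fastforce
    then show "emeasure (r K m S) (space (r K m S)) \<noteq> \<infinity>"
      using r_em[OF that(2,3), of UNIV K] that(4) by (auto simp: r_def ennreal_mult_eq_top_iff)
  qed
  have r_sets: "sets (r K m S) = sets m" for K m S by (simp add: r_def)
  \<comment> \<open>The measures restricted to \<open>{..<c}\<close> and scaled to the common mass \<open>F1 * F2\<close>.\<close>
  have p: "F1 * (\<integral>\<^sup>+x. \<beta> x * indicator {..<c} x \<partial>m2) \<le> F2 * (\<integral>\<^sup>+x. \<beta> x * indicator {..<c} x \<partial>m1)"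
    unfolding r_int[OF sets(1), symmetric, OF lessThan_borel] r_int[OF sets(2), symmetric, OF lessThan_borel]
  proof (rule nn_integral_antimono_le[OF r_fin r_fin])
    fix t
    show "emeasure (r F1 m2 {..<c}) {..<t} \<le> emeasure (r F2 m1 {..<c}) {..<t}"
    proof (cases "t \<le> c")
      case True
      then have "{..<c} \<inter> {..<t} = {..<t}" by auto
      then show ?thesis using rh_leD[OF rh True] by (simp add: r_em sets F ac_simps)
    next
      case False
      then have "{..<c} \<inter> {..<t} = {..<c}" by auto
      then show ?thesis by (simp add: r_em sets F ac_simps)
    qed
  qed (auto simp: fin sets Ffin r_sets \<beta>)
  \<comment> \<open>The measures restricted to \<open>{c..}\<close>; the mass \<open>F1 * F2\<close> below \<open>c\<close> cancels.\<close>
  have q: "F2 * (\<integral>\<^sup>+x. \<beta> x * indicator {c..} x \<partial>m1) \<le> F1 * (\<integral>\<^sup>+x. \<beta> x * indicator {c..} x \<partial>m2)"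
    unfolding r_int[OF sets(1), symmetric, OF atLeast_borel] r_int[OF sets(2), symmetric, OF atLeast_borel]
  proof (rule nn_integral_antimono_le[OF r_fin r_fin])
    fix t
    show "emeasure (r F2 m1 {c..}) {..<t} \<le> emeasure (r F1 m2 {c..}) {..<t}"
    proof (cases "c \<le> t")
      case True
      have split: "emeasure m {..<t} = emeasure m {..<c} + emeasure m {c..<t}" if "sets m = sets borel" for m :: "real measure"
        using True that by (subst plus_emeasure) (auto simp: ivl_disj_un)
      have "F2 * (F1 + emeasure m1 {c..<t}) \<le> F1 * (F2 + emeasure m2 {c..<t})"
        using rh_leD[OF rh True] by (simp add: split sets F)
      then have "F1 * F2 + F2 * emeasure m1 {c..<t} \<le> F1 * F2 + F1 * emeasure m2 {c..<t}"
        by (simp add: distrib_left mult.commute)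
      moreover have "F1 * F2 \<noteq> \<infinity>" using Ffin by (auto simp: ennreal_mult_eq_top_iff)
      moreover have "{c..} \<inter> {..<t} = {c..<t}" by auto
      ultimately show ?thesis by (simp add: r_em sets ennreal_add_left_cancel_le)
    next
      case False
      then have "{c..} \<inter> {..<t} = {}" by auto
      then show ?thesis by (simp add: r_em sets)
    qed
  qed (auto simp: fin sets Ffin r_sets \<beta>)
  have total: "(\<integral>\<^sup>+x. \<beta> x \<partial>m) = (\<integral>\<^sup>+x. \<beta> x * indicator {..<c} x \<partial>m) + (\<integral>\<^sup>+x. \<beta> x * indicator {c..} x \<partial>m)"
    if [measurable_cong]: "sets m = sets borel" for m
    by (subst nn_integral_add[symmetric], measurable, intro nn_integral_cong) (auto simp: indicator_def)
  have "(\<integral>\<^sup>+x. \<beta> x * indicator {..<c} x \<partial>m2) * (\<integral>\<^sup>+x. \<beta> x * indicator {c..} x \<partial>m1)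
      \<le> (\<integral>\<^sup>+x. \<beta> x * indicator {..<c} x \<partial>m1) * (\<integral>\<^sup>+x. \<beta> x * indicator {c..} x \<partial>m2)"
  proof (rule cross_mult_le_cancel[OF Ffin p q])
    assume "F2 = 0"
    then have "AE x in m2. x \<notin> {..<c}" by (intro AE_not_in) (auto simp: F null_sets_def sets)
    then show "(\<integral>\<^sup>+x. \<beta> x * indicator {..<c} x \<partial>m2) = 0"
      by (subst nn_integral_0_iff_AE) (auto simp: indicator_def elim!: eventually_mono)
  qed
  then show ?thesis
    unfolding total[OF sets(1)] total[OF sets(2)]
    by (simp add: distrib_left ac_simps add_mono)
qed

text \<open>
  The basic composition property. The quotient of the two integrals is the mean of the antitone
  function \<open>\<alpha> / \<beta>\<close> under the measure weighted with \<open>\<beta>\<close>, and these weighted measures are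
  stochastically ordered.
\<close>
lemma rh_le_nn_integral_ratio:
  fixes m1 m2 :: "real measure" and \<alpha> \<beta> :: "real \<Rightarrow> ennreal"
  assumes fin: "finite_measure m1" "finite_measure m2"
    and sets: "sets m1 = sets borel" "sets m2 = sets borel"
    and rh: "rh_le m1 m2"
    and \<beta>: "antimono \<beta>" and [measurable]: "\<alpha> \<in> borel_measurable borel" "\<beta> \<in> borel_measurable borel"
    and ratio: "\<And>x y. x \<le> y \<Longrightarrow> \<alpha> y * \<beta> x \<le> \<alpha> x * \<beta> y"
    and \<alpha>0: "\<And>x. \<beta> x = 0 \<Longrightarrow> \<alpha> x = 0" and \<beta>fin: "\<And>x. \<beta> x \<le> 1"
  shows "(\<integral>\<^sup>+x. \<alpha> x \<partial>m2) * (\<integral>\<^sup>+x. \<beta> x \<partial>m1) \<le> (\<integral>\<^sup>+x. \<alpha> x \<partial>m1) * (\<integral>\<^sup>+x. \<beta> x \<partial>m2)"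
proof -
  interpret m1: finite_measure m1 by fact
  interpret m2: finite_measure m2 by fact
  note [measurable_cong] = sets
  have sp: "space m1 = UNIV" "space m2 = UNIV" using sets_eq_imp_space_eq[OF sets(1)] sets_eq_imp_space_eq[OF sets(2)] by auto
  define B1 B2 where B: "B1 = (\<integral>\<^sup>+x. \<beta> x \<partial>m1)" "B2 = (\<integral>\<^sup>+x. \<beta> x \<partial>m2)"
  have Bfin: "B1 < \<top>" "B2 < \<top>"
  proof -
    have "B1 \<le> (\<integral>\<^sup>+x. 1 \<partial>m1)" "B2 \<le> (\<integral>\<^sup>+x. 1 \<partial>m2)"
      unfolding B using \<beta>fin by (auto intro!: nn_integral_mono simp del: nn_integral_const)
    then show "B1 < \<top>" "B2 < \<top>"
      using m1.emeasure_finite[of UNIV] m2.emeasure_finite[of UNIV]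
      by (auto simp: sp less_top[symmetric] top_unique)
  qed
  define \<eta> where "\<eta> x = \<alpha> x / \<beta> x" for x
  have \<beta>top: "\<beta> x \<noteq> \<top>" for x using \<beta>fin[of x] by (auto simp: top_unique)
  have \<alpha>\<eta>: "\<alpha> x = \<eta> x * \<beta> x" for x
    using \<alpha>0[of x] \<beta>top[of x] unfolding \<eta>_def
    by (cases "\<beta> x = 0") (auto simp: ennreal_divide_times ennreal_mult_divide_eq less_top)
  have \<eta>_antimono: "antimono \<eta>"
  proof
    fix x y :: real assume xy: "x \<le> y"
    show "\<eta> y \<le> \<eta> x"
    proof (cases "\<beta> y = 0")
      case True
      then show ?thesis using \<alpha>0 by (simp add: \<eta>_def)
    next
      case False
      then have bx: "\<beta> x \<noteq> 0" using antimonoD[OF \<beta> xy] by auto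
      have "(\<beta> x * \<beta> y) * \<eta> y = \<alpha> y * \<beta> x" by (simp add: \<alpha>\<eta> ac_simps)
      also have "\<dots> \<le> \<alpha> x * \<beta> y" using ratio[OF xy] .
      also have "\<dots> = (\<beta> x * \<beta> y) * \<eta> x" by (simp add: \<alpha>\<eta> ac_simps)
      finally show ?thesis using False bx \<beta>top
        by (subst (asm) ennreal_mult_le_mult_iff) (auto simp: ennreal_mult_eq_top_iff)
    qed
  qed
  have [measurable]: "\<eta> \<in> borel_measurable borel" unfolding \<eta>_def by measurable
  have d_int: "(\<integral>\<^sup>+x. \<eta> x \<partial>density m (\<lambda>x. K * \<beta> x)) = K * (\<integral>\<^sup>+x. \<alpha> x \<partial>m)"
    if [measurable_cong]: "sets m = sets borel" for K m
    by (subst nn_integral_density, measurable, subst nn_integral_cmult[symmetric], measurable)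
      (simp add: \<alpha>\<eta> ac_simps)
  have d_em: "emeasure (density m (\<lambda>x. K * \<beta> x)) {..<t} = K * (\<integral>\<^sup>+x. \<beta> x * indicator {..<t} x \<partial>m)"
    if [measurable_cong]: "sets m = sets borel" for K m t
  proof -
    have "emeasure (density m (\<lambda>x. K * \<beta> x)) {..<t} = (\<integral>\<^sup>+x. K * \<beta> x * indicator {..<t} x \<partial>m)"
      by (rule emeasure_density) auto
    also have "\<dots> = K * (\<integral>\<^sup>+x. \<beta> x * indicator {..<t} x \<partial>m)"
      by (subst nn_integral_cmult[symmetric], measurable) (simp add: ac_simps)
    finally show ?thesis .
  qed
  have d_fin: "finite_measure (density m (\<lambda>x. K * \<beta> x))"
    if "K < \<top>" "(\<integral>\<^sup>+x. \<beta> x \<partial>m) < \<top>" and [measurable_cong]: "sets m = sets borel" for K m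
  proof (rule finite_measureI)
    have "emeasure (density m (\<lambda>x. K * \<beta> x)) (space m) = (\<integral>\<^sup>+x. K * \<beta> x * indicator (space m) x \<partial>m)"
      by (rule emeasure_density) auto
    also have "\<dots> = (\<integral>\<^sup>+x. K * \<beta> x \<partial>m)"
      by (rule nn_integral_cong) simp
    also have "\<dots> = K * (\<integral>\<^sup>+x. \<beta> x \<partial>m)"
      by (rule nn_integral_cmult) simp
    finally have "emeasure (density m (\<lambda>x. K * \<beta> x)) (space m) = K * (\<integral>\<^sup>+x. \<beta> x \<partial>m)" .
    then show "emeasure (density m (\<lambda>x. K * \<beta> x)) (space (density m (\<lambda>x. K * \<beta> x))) \<noteq> \<infinity>"
      using that by (auto simp: ennreal_mult_eq_top_iff)
  qed
  have "B1 * (\<integral>\<^sup>+x. \<alpha> x \<partial>m2) \<le> B2 * (\<integral>\<^sup>+x. \<alpha> x \<partial>m1)"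
    unfolding d_int[OF sets(1), symmetric] d_int[OF sets(2), symmetric]
  proof (rule nn_integral_antimono_le)
    fix t
    show "emeasure (density m2 (\<lambda>x. B1 * \<beta> x)) {..<t} \<le> emeasure (density m1 (\<lambda>x. B2 * \<beta> x)) {..<t}"
      unfolding d_em[OF sets(1)] d_em[OF sets(2)]
      using rh_le_weighted[OF fin sets rh \<beta>, of t] by (simp add: B ac_simps)
  qed (use Bfin in \<open>auto intro!: d_fin simp: sets \<eta>_antimono B\<close>)
  then show ?thesis by (simp add: B ac_simps)
qed

section \<open>The survival kernel of the statistic\<close>
text \<open>
  The transition operator of \<open>x \<mapsto> (c + x) l\<close>, with \<open>l\<close> drawn from \<open>M\<close>, killed when the new value
  reaches \<open>A\<close>. The drift \<open>c\<close> is \<open>1\<close> for the Shiryaev--Roberts statistic. Other values of \<open>c\<close> serve to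
  compare two thresholds: divided by \<open>A\<close>, the statistic has drift \<open>1 / A\<close> and threshold \<open>1\<close>.
\<close>
definition step :: "real \<Rightarrow> real \<Rightarrow> real measure \<Rightarrow> (real \<Rightarrow> ennreal) \<Rightarrow> real \<Rightarrow> ennreal" where
  "step c A M u x = (\<integral>\<^sup>+l. u ((c + x) * l) * indicator {..<A} ((c + x) * l) \<partial>M)"

lemma steps_borel:
  assumes "sigma_finite_measure m" and [measurable_cong]: "sets m = sets borel" and u: "u \<in> borel_measurable borel"
  shows "(step c A m ^^ n) u \<in> borel_measurable borel"
proof (induction n)
  case (Suc n)
  interpret sigma_finite_measure m by fact
  define v where "v = (step c A m ^^ n) u"
  have [measurable]: "v \<in> borel_measurable borel" using Suc by (simp add: v_def)
  note [measurable_cong] = assms(2)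
  have "step c A m v \<in> borel_measurable borel"
    unfolding step_def[abs_def] by measurable
  then show ?case by (simp add: v_def)
qed (simp add: u)

lemma step_cong:
  assumes "AE l in m. 0 \<le> l" "0 \<le> c" "0 \<le> x" "\<And>y. 0 \<le> y \<Longrightarrow> u y = v y"
  shows "step c A m u x = step c A m v x"
  unfolding step_def
  by (rule nn_integral_cong_AE, use assms(1) in \<open>rule eventually_mono\<close>) (use assms in auto)

lemma steps_suminf:
  assumes sf: "sigma_finite_measure m" and sets[measurable_cong]: "sets m = sets borel"
    and u: "\<And>j. u j \<in> borel_measurable borel"
  shows "(step c A m ^^ n) (\<lambda>y. \<Sum>j. u j y) x = (\<Sum>j. (step c A m ^^ n) (u j) x)"
proof (induction n arbitrary: x)
  case (Suc n)
  have [measurable]: "(step c A m ^^ n) (u j) \<in> borel_measurable borel" for j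
    by (rule steps_borel[OF sf sets u])
  have "(step c A m ^^ n) (\<lambda>y. \<Sum>j. u j y) = (\<lambda>y. \<Sum>j. (step c A m ^^ n) (u j) y)"
    using Suc by auto
  then have "(step c A m ^^ Suc n) (\<lambda>y. \<Sum>j. u j y) x
    = (\<integral>\<^sup>+l. (\<Sum>j. (step c A m ^^ n) (u j) ((c + x) * l) * indicator {..<A} ((c + x) * l)) \<partial>m)"
    by (simp add: step_def[of c A m _ x])
  also have "\<dots> = (\<Sum>j. (step c A m ^^ Suc n) (u j) x)"
    by (subst nn_integral_suminf) (simp_all add: step_def[of c A m _ x])
  finally show ?case .
qed simp

text \<open>
  The same transition acting forward on the law of the state.
\<close>
definition step_law :: "real \<Rightarrow> real \<Rightarrow> real measure \<Rightarrow> real measure \<Rightarrow> real measure" where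
  "step_law c A M m = distr (density (m \<Otimes>\<^sub>M M) (\<lambda>z. indicator {..<A} ((c + fst z) * snd z)))
     borel (\<lambda>z. (c + fst z) * snd z)"

definition surv :: "real \<Rightarrow> real \<Rightarrow> real measure \<Rightarrow> nat \<Rightarrow> real \<Rightarrow> ennreal" where
  "surv c A M n = (step c A M ^^ n) (\<lambda>_. 1)"

definition mean_time :: "real \<Rightarrow> real \<Rightarrow> real measure \<Rightarrow> real \<Rightarrow> ennreal" where
  "mean_time c A M x = (\<Sum>n. surv c A M n x)"

text \<open>
  Log-concavity, in the logarithm of the variable, of the distribution function: the four points
  \<open>s\<close>, \<open>\<sigma> s\<close>, \<open>t\<close> and \<open>\<sigma> t\<close> have logarithms whose outer and inner pairs have the same sum.
  Equivalently, multiplication by any \<open>\<sigma> \<ge> 1\<close> increases the measure in the reversed hazard rate order.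
  Open half-lines are used because the process survives while it is strictly below the threshold.
\<close>
definition log_conc :: "real measure \<Rightarrow> bool" where
  "log_conc m \<longleftrightarrow> (\<forall>\<sigma> s t. 1 \<le> \<sigma> \<longrightarrow> 0 < s \<longrightarrow> s \<le> t \<longrightarrow>
     emeasure m {..<s} * emeasure m {..<\<sigma> * t} \<le> emeasure m {..<\<sigma> * s} * emeasure m {..<t})"

lemma log_concD:
  "log_conc m \<Longrightarrow> 1 \<le> \<sigma> \<Longrightarrow> 0 < s \<Longrightarrow> s \<le> t \<Longrightarrow>
    emeasure m {..<s} * emeasure m {..<\<sigma> * t} \<le> emeasure m {..<\<sigma> * s} * emeasure m {..<t}"
  by (simp add: log_conc_def)

text \<open>
  Replacing the factor applied to the smaller point by a larger one only strengthens the inequality.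
  Adding a constant stretches small values by larger factors than large ones, which is how this form
  arises.
\<close>
lemma log_conc_ratio:
  assumes "log_conc m" and sets: "sets m = sets borel" and "0 < u" "u \<le> u'" "1 \<le> \<sigma>'" "\<sigma>' \<le> \<sigma>"
  shows "emeasure m {..<u} * emeasure m {..<\<sigma>' * u'} \<le> emeasure m {..<\<sigma> * u} * emeasure m {..<u'}"
proof -
  have "emeasure m {..<u} * emeasure m {..<\<sigma>' * u'} \<le> emeasure m {..<\<sigma>' * u} * emeasure m {..<u'}"
    using assms by (intro log_concD) auto
  also have "\<dots> \<le> emeasure m {..<\<sigma> * u} * emeasure m {..<u'}"
  proof (intro mult_right_mono emeasure_mono)
    have "\<sigma>' * u \<le> \<sigma> * u" using assms by (intro mult_right_mono) auto
    then show "{..<\<sigma>' * u} \<subseteq> {..<\<sigma> * u}" by auto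
  qed (auto simp: sets)
  finally show ?thesis .
qed

lemma emeasure_lessThan_nonneg:
  fixes m :: "real measure"
  assumes "AE y in m. 0 \<le> y" "sets m = sets borel" "t \<le> 0"
  shows "emeasure m {..<t} = 0"
proof -
  have "emeasure m {..<t} = emeasure m {y \<in> space m. y < t}"
    using assms sets_eq_imp_space_eq[OF assms(2)] by (intro arg_cong[where f = "emeasure m"]) auto
  also have "\<dots> = 0"
    using assms by (intro emeasure_eq_0_AE) (auto elim!: eventually_mono)
  finally show ?thesis .
qed

lemma emeasure_distr_mult_add:
  fixes m :: "real measure"
  assumes [measurable_cong]: "sets m = sets borel" and "0 < \<sigma>"
  shows "emeasure (distr m borel (\<lambda>y. \<sigma> * (c + y))) {..<t} = emeasure m {..<t / \<sigma> - c}"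
proof -
  have "(\<lambda>y. \<sigma> * (c + y)) -` {..<t} \<inter> space m = {..<t / \<sigma> - c}"
    using assms sets_eq_imp_space_eq[OF assms(1)] by (auto simp: field_simps)
  then show ?thesis by (subst emeasure_distr) auto
qed

lemma emeasure_distr_add:
  fixes m :: "real measure"
  assumes "sets m = sets borel"
  shows "emeasure (distr m borel (\<lambda>y. c + y)) {..<t} = emeasure m {..<t - c}"
  using emeasure_distr_mult_add[OF assms, of 1] by simp

lemma rh_le_add:
  assumes "sets m1 = sets borel" "sets m2 = sets borel" "rh_le m1 m2"
  shows "rh_le (distr m1 borel (\<lambda>y. c + y)) (distr m2 borel (\<lambda>y. c + y))"
  using assms unfolding rh_le_def by (auto simp: emeasure_distr_add)

text \<open>
  For a log-concave law, adding a larger constant increases the measure in the reversed hazard rate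
  order. This fails for general laws.
\<close>
lemma rh_le_add_log_conc:
  assumes sets: "sets m = sets borel" and nonneg: "AE y in m. 0 \<le> y" and lc: "log_conc m" and "c \<le> c'"
  shows "rh_le (distr m borel (\<lambda>y. c + y)) (distr m borel (\<lambda>y. c' + y))"
  unfolding rh_le_def emeasure_distr_add[OF sets]
proof (intro allI impI)
  fix s t :: real assume st: "s \<le> t"
  show "emeasure m {..<s - c'} * emeasure m {..<t - c} \<le> emeasure m {..<s - c} * emeasure m {..<t - c'}"
  proof (cases "s - c' \<le> 0")
    case True
    then show ?thesis by (simp add: emeasure_lessThan_nonneg[OF nonneg sets])
  next
    case False
    then have pos: "0 < s - c'" "0 < t - c'" using st by auto
    \<comment> \<open>The shift by \<open>c' - c\<close> written as a stretching factor, which is larger at \<open>s - c'\<close> than at \<open>t - c'\<close>.\<close>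
    have "emeasure m {..<s - c'} * emeasure m {..<(t - c) / (t - c') * (t - c')}
        \<le> emeasure m {..<(s - c) / (s - c') * (s - c')} * emeasure m {..<t - c'}"
    proof (rule log_conc_ratio[OF lc sets])
      have "0 \<le> (c' - c) * (t - s)" using st assms by simp
      then show "(t - c) / (t - c') \<le> (s - c) / (s - c')"
        using pos by (simp add: divide_le_eq pos_le_divide_eq field_simps)
    qed (use pos assms st in \<open>auto simp: field_simps\<close>)
    then show ?thesis using pos by simp
  qed
qed

text \<open>
  Adding a constant preserves log-concavity, expressed through scaling.
\<close>
lemma rh_le_scale_log_conc:
  assumes sets: "sets m = sets borel" and nonneg: "AE y in m. 0 \<le> y" and lc: "log_conc m"
    and "1 \<le> \<sigma>" "0 \<le> c"
  shows "rh_le (distr m borel (\<lambda>y. c + y)) (distr m borel (\<lambda>y. \<sigma> * (c + y)))"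
proof -
  have \<sigma>: "0 < \<sigma>" using assms by simp
  show ?thesis
    unfolding rh_le_def emeasure_distr_add[OF sets] emeasure_distr_mult_add[OF sets \<sigma>]
  proof (intro allI impI)
    fix s t :: real assume st: "s \<le> t"
    define u v where "u = s / \<sigma> - c" and "v = t / \<sigma> - c"
    have uv: "u \<le> v" "s = \<sigma> * (u + c)" "t = \<sigma> * (v + c)"
      using st \<sigma> by (auto simp: u_def v_def divide_right_mono)
    show "emeasure m {..<u} * emeasure m {..<t - c} \<le> emeasure m {..<s - c} * emeasure m {..<v}"
    proof (cases "u \<le> 0")
      case True
      then show ?thesis by (simp add: emeasure_lessThan_nonneg[OF nonneg sets])
    next
      case False
      then have pos: "0 < u" "0 < v" using uv by auto
      have k: "0 \<le> (\<sigma> - 1) * c" using assms by simp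
      have "emeasure m {..<u} * emeasure m {..<(\<sigma> + (\<sigma> - 1) * c / v) * v}
          \<le> emeasure m {..<(\<sigma> + (\<sigma> - 1) * c / u) * u} * emeasure m {..<v}"
      proof (rule log_conc_ratio[OF lc sets])
        show "\<sigma> + (\<sigma> - 1) * c / v \<le> \<sigma> + (\<sigma> - 1) * c / u"
          using k pos uv by (simp add: divide_left_mono)
        have "0 \<le> (\<sigma> - 1) * c / v" using k pos by simp
        then show "1 \<le> \<sigma> + (\<sigma> - 1) * c / v" using assms by linarith
      qed (use pos assms uv in auto)
      moreover have "(\<sigma> + (\<sigma> - 1) * c / v) * v = t - c" "(\<sigma> + (\<sigma> - 1) * c / u) * u = s - c"
        using pos uv by (auto simp: field_simps)
      ultimately show ?thesis by simp
    qed
  qed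
qed

text \<open>
  The law of the likelihood ratio. Under the post-change distribution the ratio may be infinite; the
  statistic then crosses every threshold, so only the finite part of its law enters the kernel, and
  that part may have mass less than one.
\<close>
locale pos_subprob =
  fixes M :: "real measure"
  assumes sets_M[measurable_cong]: "sets M = sets borel"
    and total_le_1: "emeasure M UNIV \<le> 1"
    and pos: "AE l in M. 0 < l"
begin

lemma space_M: "space M = UNIV"
  using sets_eq_imp_space_eq[OF sets_M] by simp

sublocale finite_measure M
  using total_le_1 by (intro finite_measureI) (auto simp: space_M top_unique)

lemma steps_measurable:
  "u \<in> borel_measurable borel \<Longrightarrow> (step c A M ^^ n) u \<in> borel_measurable borel"
  by (rule steps_borel[OF sigma_finite_measure_axioms sets_M])

lemma step_measurable:
  "u \<in> borel_measurable borel \<Longrightarrow> step c A M u \<in> borel_measurable borel"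
  using steps_measurable[where n = 1] by simp

lemma surv_measurable[measurable]: "surv c A M n \<in> borel_measurable borel"
  unfolding surv_def by (rule steps_measurable) simp

lemma mean_time_measurable[measurable]: "mean_time c A M \<in> borel_measurable borel"
  unfolding mean_time_def by measurable

text \<open>
  A pathwise comparison: the two chains use the same factor \<open>l\<close>. The last premise of \<open>le\<close> records that
  two chains which start from the same value \<open>c + x\<close> move to the same state.
\<close>
lemma step_le:
  assumes x: "0 < c + x" "c + x \<le> c' + x'"
    and le: "\<And>y y'. 0 \<le> y \<Longrightarrow> y \<le> y' \<Longrightarrow> y' < A \<Longrightarrow> (c + x = c' + x' \<Longrightarrow> y = y') \<Longrightarrow> v y' \<le> u y"
  shows "step c' A M v x' \<le> step c A M u x"
  unfolding step_def
proof (rule nn_integral_mono_AE, use pos in \<open>rule eventually_mono\<close>)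
  fix l :: real assume l: "0 < l"
  have "(c + x) * l \<le> (c' + x') * l" using x l by (intro mult_right_mono) auto
  moreover have "0 \<le> (c + x) * l" using x l by simp
  moreover have "c + x = c' + x' \<Longrightarrow> (c + x) * l = (c' + x') * l" by simp
  ultimately show "v ((c' + x') * l) * indicator {..<A} ((c' + x') * l)
      \<le> u ((c + x) * l) * indicator {..<A} ((c + x) * l)"
    using le[of "(c + x) * l" "(c' + x') * l"] by (auto simp: indicator_def)
qed

lemma step_mono:
  assumes "0 < c" "0 \<le> x" "\<And>y. 0 \<le> y \<Longrightarrow> y < A \<Longrightarrow> u y \<le> v y"
  shows "step c A M u x \<le> step c A M v x"
  by (rule step_le) (use assms in auto)

lemma step_antimono:
  assumes "0 < c" "antimono_on {0..} u"
  shows "antimono_on {0..} (step c A M u)"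
  by (rule monotone_onI, rule step_le) (use assms in \<open>auto simp: monotone_on_def\<close>)

lemma steps_antimono:
  "0 < c \<Longrightarrow> antimono_on {0..} u \<Longrightarrow> antimono_on {0..} ((step c A M ^^ n) u)"
  by (induction n) (auto intro: step_antimono)

lemma steps_mono:
  assumes "0 < c" "\<And>y. 0 \<le> y \<Longrightarrow> u y \<le> v y"
  shows "0 \<le> x \<Longrightarrow> (step c A M ^^ n) u x \<le> (step c A M ^^ n) v x"
  by (induction n arbitrary: x) (use assms in \<open>auto intro!: step_mono\<close>)

lemma step_cmult:
  "u \<in> borel_measurable borel \<Longrightarrow> step c A M (\<lambda>y. k * u y) x = k * step c A M u x"
  unfolding step_def by (simp add: nn_integral_cmult mult.assoc)

lemma steps_cmult:
  assumes "u \<in> borel_measurable borel"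
  shows "(step c A M ^^ n) (\<lambda>y. k * u y) x = k * (step c A M ^^ n) u x"
proof (induction n arbitrary: x)
  case (Suc n)
  then have "(step c A M ^^ n) (\<lambda>y. k * u y) = (\<lambda>y. k * (step c A M ^^ n) u y)" by auto
  then show ?case using assms by (simp add: step_cmult steps_measurable)
qed simp

lemma step_add:
  "u \<in> borel_measurable borel \<Longrightarrow> v \<in> borel_measurable borel \<Longrightarrow>
    step c A M (\<lambda>y. u y + v y) x = step c A M u x + step c A M v x"
  unfolding step_def by (simp add: nn_integral_add distrib_right)

lemma steps_add:
  assumes "u \<in> borel_measurable borel" "v \<in> borel_measurable borel"
  shows "(step c A M ^^ n) (\<lambda>y. u y + v y) x = (step c A M ^^ n) u x + (step c A M ^^ n) v x"
proof (induction n arbitrary: x)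
  case (Suc n)
  then have "(step c A M ^^ n) (\<lambda>y. u y + v y) = (\<lambda>y. (step c A M ^^ n) u y + (step c A M ^^ n) v y)" by auto
  then show ?case using assms by (simp add: step_add steps_measurable)
qed simp

lemma surv_0[simp]: "surv c A M 0 x = 1"
  by (simp add: surv_def)

lemma surv_Suc: "surv c A M (Suc n) x = step c A M (surv c A M n) x"
  by (simp add: surv_def)

lemma surv_add: "surv c A M (k + n) = (step c A M ^^ k) (surv c A M n)"
  by (simp add: surv_def funpow_add)

lemma mean_time_rec: "mean_time c A M x = 1 + step c A M (mean_time c A M) x"
proof -
  have "step c A M (mean_time c A M) x
      = (\<integral>\<^sup>+l. (\<Sum>n. surv c A M n ((c + x) * l) * indicator {..<A} ((c + x) * l)) \<partial>M)"
    unfolding step_def mean_time_def by simp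
  also have "\<dots> = (\<Sum>n. surv c A M (Suc n) x)"
    by (subst nn_integral_suminf) (simp_all add: surv_Suc step_def)
  finally show ?thesis
    unfolding mean_time_def by (subst suminf_offset[of _ 1]) auto
qed

lemma surv_antimono: "0 < c \<Longrightarrow> antimono_on {0..} (surv c A M n)"
  unfolding surv_def by (intro steps_antimono) (auto simp: monotone_on_def)

lemma surv_le_start: "0 < c \<Longrightarrow> 0 \<le> x \<Longrightarrow> x \<le> x' \<Longrightarrow> surv c A M n x' \<le> surv c A M n x"
  using surv_antimono[of c A n] by (auto simp: monotone_on_def)

lemma step_1_le: "step c A M (\<lambda>_. 1) x \<le> 1"
proof -
  have "step c A M (\<lambda>_. 1) x \<le> (\<integral>\<^sup>+l. 1 \<partial>M)"
    unfolding step_def by (intro nn_integral_mono) (auto simp: indicator_def)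
  then show ?thesis using total_le_1 by (simp add: space_M)
qed

lemma surv_decseq: "0 < c \<Longrightarrow> 0 \<le> x \<Longrightarrow> surv c A M (Suc n) x \<le> surv c A M n x"
proof -
  assume *: "0 < c" "0 \<le> x"
  have "surv c A M (Suc n) x = (step c A M ^^ n) (surv c A M 1) x" using surv_add[of c A n 1] by simp
  also have "\<dots> \<le> (step c A M ^^ n) (\<lambda>_. 1) x"
    using * by (intro steps_mono) (auto simp: surv_def step_1_le)
  finally show ?thesis by (simp add: surv_def)
qed

lemma surv_mono_n: "0 < c \<Longrightarrow> 0 \<le> x \<Longrightarrow> m \<le> n \<Longrightarrow> surv c A M n x \<le> surv c A M m x"
  by (rule lift_Suc_antimono_le[of "\<lambda>n. surv c A M n x"]) (auto intro: surv_decseq)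

lemma surv_le_1: "0 < c \<Longrightarrow> 0 \<le> x \<Longrightarrow> surv c A M n x \<le> 1"
  using surv_mono_n[of c x 0 n A] by simp

lemma surv_fin[simp]: "0 < c \<Longrightarrow> 0 \<le> x \<Longrightarrow> surv c A M n x < \<top>"
  using surv_le_1[of c x A n] by (auto intro: le_less_trans)

text \<open>
  The invariant of the coupling is the order of the sums \<open>c + x\<close>; the states themselves are then
  ordered after the first step.
\<close>
lemma surv_le:
  assumes "0 < c" "c \<le> c'"
  shows "0 \<le> x \<Longrightarrow> 0 \<le> x' \<Longrightarrow> c + x \<le> c' + x' \<Longrightarrow> surv c' A M n x' \<le> surv c A M n x"
proof (induction n arbitrary: x x')
  case (Suc n)
  show ?case unfolding surv_Suc
    by (rule step_le) (use Suc assms in auto)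
qed simp

lemma mean_time_le:
  assumes "0 < c" "c \<le> c'" "0 \<le> x" "0 \<le> x'" "c + x \<le> c' + x'"
  shows "mean_time c' A M x' \<le> mean_time c A M x"
  unfolding mean_time_def using surv_le[OF assms] by (intro suminf_le) auto

lemma mean_time_antimono: "0 < c \<Longrightarrow> antimono_on {0..} (mean_time c A M)"
  by (rule monotone_onI, rule mean_time_le) auto

lemma surv_le_threshold:
  assumes "0 < c" "A \<le> A'"
  shows "0 \<le> x \<Longrightarrow> surv c A M n x \<le> surv c A' M n x"
proof (induction n arbitrary: x)
  case (Suc n)
  show ?case unfolding surv_Suc step_def
  proof (rule nn_integral_mono_AE, use pos in \<open>rule eventually_mono\<close>)
    fix l :: real assume l: "0 < l"
    have "0 \<le> (c + x) * l" using l assms Suc by simp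
    then show "surv c A M n ((c + x) * l) * indicator {..<A} ((c + x) * l)
      \<le> surv c A' M n ((c + x) * l) * indicator {..<A'} ((c + x) * l)"
      using Suc.IH[of "(c + x) * l"] assms by (auto simp: indicator_def)
  qed
qed simp

lemma mean_time_le_threshold:
  "0 < c \<Longrightarrow> A \<le> A' \<Longrightarrow> 0 \<le> x \<Longrightarrow> mean_time c A M x \<le> mean_time c A' M x"
  unfolding mean_time_def using surv_le_threshold by (intro suminf_le) auto

text \<open>
  The statistic with drift \<open>1\<close> and threshold \<open>A\<close>, multiplied by \<open>\<kappa>\<close>.
\<close>
lemma step_scale:
  assumes "0 < \<kappa>"
  shows "step \<kappa> (\<kappa> * A) M u (\<kappa> * x) = step 1 A M (\<lambda>y. u (\<kappa> * y)) x"
  unfolding step_def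
proof (rule nn_integral_cong)
  fix l
  have "(\<kappa> + \<kappa> * x) * l = \<kappa> * ((1 + x) * l)" by (simp add: algebra_simps)
  then show "u ((\<kappa> + \<kappa> * x) * l) * indicator {..<\<kappa> * A} ((\<kappa> + \<kappa> * x) * l)
    = u (\<kappa> * ((1 + x) * l)) * indicator {..<A} ((1 + x) * l)"
    using assms by (simp only: mult_less_cancel_left_pos indicator_def lessThan_iff)
qed

lemma steps_scale:
  assumes "0 < \<kappa>"
  shows "(step \<kappa> (\<kappa> * A) M ^^ n) u (\<kappa> * x) = (step 1 A M ^^ n) (\<lambda>y. u (\<kappa> * y)) x"
  by (induction n arbitrary: x) (simp_all add: step_scale[OF assms])

lemma surv_scale: "0 < \<kappa> \<Longrightarrow> surv \<kappa> (\<kappa> * A) M n (\<kappa> * x) = surv 1 A M n x"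
  unfolding surv_def by (simp add: steps_scale)

lemma mean_time_scale: "0 < \<kappa> \<Longrightarrow> mean_time \<kappa> (\<kappa> * A) M (\<kappa> * x) = mean_time 1 A M x"
  unfolding mean_time_def by (simp add: surv_scale)

section \<open>Laws of the surviving state\<close>
definition state_law :: "real measure \<Rightarrow> bool" where
  "state_law m \<longleftrightarrow> finite_measure m \<and> sets m = sets borel \<and> (AE y in m. 0 \<le> y)"

lemma nn_integral_step_law:
  assumes m: "state_law m" and [measurable]: "u \<in> borel_measurable borel"
  shows "(\<integral>\<^sup>+y. u y \<partial>step_law c A M m) = (\<integral>\<^sup>+y. step c A M u y \<partial>m)"
proof -
  have [measurable_cong]: "sets m = sets borel" using m by (simp add: state_law_def)
  interpret m: finite_measure m using m by (simp add: state_law_def)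
  interpret p: pair_sigma_finite m M ..
  have "(\<integral>\<^sup>+y. u y \<partial>step_law c A M m)
      = (\<integral>\<^sup>+z. indicator {..<A} ((c + fst z) * snd z) * u ((c + fst z) * snd z) \<partial>(m \<Otimes>\<^sub>M M))"
    unfolding step_law_def
    by (subst nn_integral_distr, measurable, subst nn_integral_density, measurable)
  also have "\<dots> = (\<integral>\<^sup>+z. u ((c + fst z) * snd z) * indicator {..<A} ((c + fst z) * snd z) \<partial>(m \<Otimes>\<^sub>M M))"
    by (rule nn_integral_cong) (rule mult.commute)
  also have "\<dots> = (\<integral>\<^sup>+y. step c A M u y \<partial>m)"
    by (subst nn_integral_fst[symmetric], measurable) (simp add: step_def[abs_def])
  finally show ?thesis .
qed

lemma sets_step_law[simp, measurable_cong]: "sets (step_law c A M m) = sets borel"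
  by (simp add: step_law_def)

lemma space_step_law[simp]: "space (step_law c A M m) = UNIV"
  by (simp add: step_law_def)

lemma step_law_state_law:
  assumes m: "state_law m" and "0 < c"
  shows "state_law (step_law c A M m)"
  unfolding state_law_def
proof (intro conjI)
  have [measurable_cong]: "sets m = sets borel" using m by (simp add: state_law_def)
  interpret m: finite_measure m using m by (simp add: state_law_def)
  have "emeasure (step_law c A M m) UNIV = (\<integral>\<^sup>+y. 1 \<partial>step_law c A M m)" by simp
  also have "\<dots> = (\<integral>\<^sup>+y. step c A M (\<lambda>_. 1) y \<partial>m)" by (rule nn_integral_step_law[OF m]) simp
  also have "\<dots> \<le> (\<integral>\<^sup>+y. 1 \<partial>m)" by (intro nn_integral_mono) (simp add: step_1_le)
  finally show "finite_measure (step_law c A M m)"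
    by (intro finite_measureI) (auto simp: top_unique)
  have "(\<integral>\<^sup>+y. indicator {..<0} y \<partial>step_law c A M m) = (\<integral>\<^sup>+y. step c A M (indicator {..<0}) y \<partial>m)"
    by (rule nn_integral_step_law[OF m]) simp
  also have "\<dots> = (\<integral>\<^sup>+y. 0 \<partial>m)"
  proof (rule nn_integral_cong_AE)
    have "AE y in m. 0 \<le> y" using m by (simp add: state_law_def)
    then show "AE y in m. step c A M (indicator {..<0}) y = 0"
    proof eventually_elim
      fix y :: real assume y: "0 \<le> y"
      have "AE l in M. indicator {..<0} ((c + y) * l) * indicator {..<A} ((c + y) * l) = (0::ennreal)"
        using pos by eventually_elim (use y assms in \<open>auto simp: indicator_def not_less\<close>)
      then show "step c A M (indicator {..<0}) y = 0"
        unfolding step_def by (subst nn_integral_cong_AE) auto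
    qed
  qed
  finally have "emeasure (step_law c A M m) {..<0} = 0" by simp
  then show "AE y in step_law c A M m. 0 \<le> y"
    by (intro AE_I[of _ _ "{..<0}"]) auto
qed simp

lemma emeasure_quotient_measurable[measurable]:
  "(\<lambda>y. emeasure M {..<u / y}) \<in> borel_measurable borel"
proof -
  have "(\<lambda>y. emeasure M (Pair y -` {z \<in> space (borel \<Otimes>\<^sub>M M). snd z < u / fst z})) \<in> borel_measurable borel"
    by (rule measurable_emeasure_Pair) measurable
  then show ?thesis by (simp add: space_pair_measure space_M vimage_def lessThan_def)
qed

text \<open>
  The distribution function after one step is a mixture of rescaled distribution functions of \<open>M\<close>.
  Truncation at the threshold only caps the argument.
\<close>
lemma emeasure_step_law:
  assumes m: "state_law m" and c: "0 < c"
  shows "emeasure (step_law c A M m) {..<t}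
    = (\<integral>\<^sup>+y. emeasure M {..<min t A / y} \<partial>distr m borel (\<lambda>y. c + y))"
proof -
  have [measurable_cong]: "sets m = sets borel" using m by (simp add: state_law_def)
  have "emeasure (step_law c A M m) {..<t} = (\<integral>\<^sup>+y. indicator {..<t} y \<partial>step_law c A M m)" by simp
  also have "\<dots> = (\<integral>\<^sup>+y. step c A M (indicator {..<t}) y \<partial>m)"
    by (rule nn_integral_step_law[OF m]) simp
  also have "\<dots> = (\<integral>\<^sup>+y. emeasure M {..<min t A / (c + y)} \<partial>m)"
  proof (rule nn_integral_cong_AE)
    have "AE y in m. 0 \<le> y" using m by (simp add: state_law_def)
    then show "AE y in m. step c A M (indicator {..<t}) y = emeasure M {..<min t A / (c + y)}"
    proof eventually_elim
      fix y :: real assume y: "0 \<le> y"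
      have "step c A M (indicator {..<t}) y = (\<integral>\<^sup>+l. indicator {..<min t A / (c + y)} l \<partial>M)"
        unfolding step_def
        by (intro nn_integral_cong) (use y c in \<open>auto simp: indicator_def field_simps min_def split: if_splits\<close>)
      then show "step c A M (indicator {..<t}) y = emeasure M {..<min t A / (c + y)}"
        by (simp add: sets_M)
    qed
  qed
  also have "\<dots> = (\<integral>\<^sup>+y. emeasure M {..<min t A / y} \<partial>distr m borel (\<lambda>y. c + y))"
    by (subst nn_integral_distr) auto
  finally show ?thesis .
qed

text \<open>
  Multiplication by an independent log-concave factor preserves the reversed hazard rate order: with
  \<open>F u = emeasure M {..<u}\<close>, log-concavity says that the ratio \<open>F (s / y) / F (t / y)\<close> is antitone in \<open>y\<close> for
  \<open>s \<le> t\<close>, so the basic composition property applies to the two mixtures.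
\<close>
lemma rh_le_mix:
  assumes lc: "log_conc M"
    and fin: "finite_measure m1" "finite_measure m2"
    and sets: "sets m1 = sets borel" "sets m2 = sets borel"
    and supp: "AE y in m1. d \<le> y" "AE y in m2. d \<le> y" and d: "0 < d"
    and rh: "rh_le m1 m2" and st: "s \<le> t"
  shows "(\<integral>\<^sup>+y. emeasure M {..<s / y} \<partial>m2) * (\<integral>\<^sup>+y. emeasure M {..<t / y} \<partial>m1)
    \<le> (\<integral>\<^sup>+y. emeasure M {..<s / y} \<partial>m1) * (\<integral>\<^sup>+y. emeasure M {..<t / y} \<partial>m2)"
proof -
  \<comment> \<open>Capping \<open>y\<close> from below makes the integrand antitone on the whole line; the measures do not see it.\<close>
  define f where "f u y = emeasure M {..<u / max d y}" for u y
  have f0: "f u y = 0" if "u \<le> 0" for u y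
    unfolding f_def using that d pos
    by (intro emeasure_lessThan_nonneg) (auto simp: sets_M divide_le_0_iff elim: eventually_mono)
  have f_antimono: "antimono (f u)" for u
  proof (cases "u \<le> 0")
    case True
    then show ?thesis by (simp add: antimono_def f0)
  next
    case False
    show ?thesis
    proof
      fix x y :: real assume "x \<le> y"
      then have "u / max d y \<le> u / max d x" using False d by (intro divide_left_mono) (auto simp: max_def)
      then show "f u y \<le> f u x" unfolding f_def by (intro emeasure_mono) (auto simp: sets_M)
    qed
  qed
  have eq: "(\<integral>\<^sup>+y. emeasure M {..<u / y} \<partial>m) = (\<integral>\<^sup>+y. f u y \<partial>m)" if "AE y in m. d \<le> y" for m u
    using that by (intro nn_integral_cong_AE, eventually_elim) (simp add: f_def max_absorb2)
  show ?thesis unfolding eq[OF supp(1)] eq[OF supp(2)]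
  proof (rule rh_le_nn_integral_ratio[OF fin sets rh f_antimono])
    fix x y :: real assume xy: "x \<le> y"
    show "f s y * f t x \<le> f s x * f t y"
    proof (cases "s \<le> 0")
      case True
      then show ?thesis by (simp add: f0)
    next
      case False
      have "emeasure M {..<s / max d y} * emeasure M {..<(max d y / max d x) * (t / max d y)}
        \<le> emeasure M {..<(max d y / max d x) * (s / max d y)} * emeasure M {..<t / max d y}"
        using False d xy st by (intro log_concD[OF lc]) (auto simp: divide_right_mono max_def)
      then show ?thesis using d by (simp add: f_def)
    qed
  next
    fix x
    have "f s x \<le> f t x" unfolding f_def
      using st d by (intro emeasure_mono) (auto simp: sets_M intro: less_le_trans divide_right_mono)
    then show "f t x = 0 \<Longrightarrow> f s x = 0" by simp
    have "f t x \<le> emeasure M UNIV" unfolding f_def by (intro emeasure_mono) (auto simp: sets_M)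
    then show "f t x \<le> 1" using total_le_1 by simp
  qed (auto intro: borel_measurable_antimono_ennreal f_antimono)
qed

lemma state_law_add:
  assumes "state_law m"
  shows "finite_measure (distr m borel (\<lambda>y. c + y))" "AE y in distr m borel (\<lambda>y. c + y). c \<le> y"
proof -
  interpret m: finite_measure m using assms by (simp add: state_law_def)
  have [measurable_cong]: "sets m = sets borel" and "AE y in m. 0 \<le> y" using assms by (auto simp: state_law_def)
  then show "finite_measure (distr m borel (\<lambda>y. c + y))" "AE y in distr m borel (\<lambda>y. c + y). c \<le> y"
    by (auto intro!: m.finite_measure_distr simp: AE_distr_iff)
qed

lemma rh_le_step_law:
  assumes lc: "log_conc M" and m: "state_law m1" "state_law m2" and c: "0 < c" "c \<le> c'"
    and rh: "rh_le (distr m1 borel (\<lambda>y. c + y)) (distr m2 borel (\<lambda>y. c' + y))"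
  shows "rh_le (step_law c A M m1) (step_law c' A M m2)"
  unfolding rh_le_def
proof (intro allI impI)
  fix s t :: real assume "s \<le> t"
  then have "min s A \<le> min t A" by auto
  moreover have "AE y in distr m2 borel (\<lambda>y. c' + y). c \<le> y"
    using state_law_add(2)[OF m(2), of c'] by eventually_elim (use c in simp)
  ultimately show "emeasure (step_law c' A M m2) {..<s} * emeasure (step_law c A M m1) {..<t}
      \<le> emeasure (step_law c A M m1) {..<s} * emeasure (step_law c' A M m2) {..<t}"
    using c by (simp add: emeasure_step_law m)
      (rule rh_le_mix[OF lc], auto intro: state_law_add m rh)
qed

text \<open>
  Log-concavity of the state survives a step: \<open>c + y\<close> is increased by scaling, multiplication by the
  likelihood ratio preserves this, and so does truncation at the threshold.
\<close>
lemma log_conc_step_law: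
  assumes lc: "log_conc M" and m: "state_law m" and lcm: "log_conc m" and c: "0 < c"
  shows "log_conc (step_law c A M m)"
proof -
  have sm[measurable_cong]: "sets m = sets borel" using m by (simp add: state_law_def)
  interpret m: finite_measure m using m by (simp add: state_law_def)
  define H where "H t = (\<integral>\<^sup>+y. emeasure M {..<t / y} \<partial>distr m borel (\<lambda>y. c + y))" for t
  have F: "emeasure (step_law c A M m) {..<t} = H (min t A)" for t
    unfolding H_def by (rule emeasure_step_law[OF m c])
  have H_mono: "H s \<le> H t" if "s \<le> t" for s t
    unfolding H_def
  proof (rule nn_integral_mono_AE, use state_law_add(2)[OF m, of c] in \<open>rule eventually_mono\<close>)
    fix y assume "c \<le> y"
    then have "s / y \<le> t / y" using that c by (intro divide_right_mono) auto
    then show "emeasure M {..<s / y} \<le> emeasure M {..<t / y}" by (intro emeasure_mono) (auto simp: sets_M)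
  qed
  have H: "H s * H (\<sigma> * t) \<le> H (\<sigma> * s) * H t" if \<sigma>: "1 \<le> \<sigma>" and st: "s \<le> t" for \<sigma> s t
  proof -
    \<comment> \<open>\<open>H u\<close> is also the distribution function at \<open>\<sigma> u\<close> of the product with the state scaled by \<open>\<sigma>\<close>.\<close>
    have eq: "H u = (\<integral>\<^sup>+y. emeasure M {..<\<sigma> * u / y} \<partial>distr m borel (\<lambda>y. \<sigma> * (c + y)))" for u
      unfolding H_def using \<sigma> by (subst (1 2) nn_integral_distr) auto
    have "AE y in m. 0 \<le> y" using m by (simp add: state_law_def)
    then have "AE y in distr m borel (\<lambda>y. \<sigma> * (c + y)). c \<le> y"
    proof (subst AE_distr_iff, measurable, eventually_elim)
      fix y :: real assume "0 \<le> y"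
      then have "1 * (c + y) \<le> \<sigma> * (c + y)" using \<sigma> c by (intro mult_right_mono) auto
      then show "c \<le> \<sigma> * (c + y)" using \<open>0 \<le> y\<close> by simp
    qed
    moreover have "\<sigma> * s \<le> \<sigma> * t" using \<sigma> st by (intro mult_left_mono) auto
    moreover have "rh_le (distr m borel (\<lambda>y. c + y)) (distr m borel (\<lambda>y. \<sigma> * (c + y)))"
      using m \<sigma> c lcm by (intro rh_le_scale_log_conc) (auto simp: state_law_def)
    ultimately have "(\<integral>\<^sup>+y. emeasure M {..<\<sigma> * s / y} \<partial>distr m borel (\<lambda>y. \<sigma> * (c + y))) * H (\<sigma> * t)
      \<le> H (\<sigma> * s) * (\<integral>\<^sup>+y. emeasure M {..<\<sigma> * t / y} \<partial>distr m borel (\<lambda>y. \<sigma> * (c + y)))"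
      unfolding H_def
      by (intro rh_le_mix[OF lc, where d = c] state_law_add[OF m] m.finite_measure_distr c) auto
    then show ?thesis by (simp flip: eq)
  qed
  show ?thesis
    unfolding log_conc_def F
  proof (intro allI impI)
    fix \<sigma> s t :: real assume \<sigma>: "1 \<le> \<sigma>" and s: "0 < s" and st: "s \<le> t"
    have ss: "1 * s \<le> \<sigma> * s" "1 * t \<le> \<sigma> * t" "\<sigma> * s \<le> \<sigma> * t"
      using \<sigma> s st by (auto intro!: mult_right_mono mult_left_mono)
    show "H (min s A) * H (min (\<sigma> * t) A) \<le> H (min (\<sigma> * s) A) * H (min t A)"
    proof (cases "A \<le> \<sigma> * s")
      case True
      have "H (min s A) \<le> H (min t A)" using st by (intro H_mono) auto
      then show ?thesis using True ss by (simp add: min_absorb2 mult.commute mult_left_mono)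
    next
      case False
      define T where "T = min (\<sigma> * t) A / \<sigma>"
      have T: "s \<le> T" "T \<le> min t A" "\<sigma> * T = min (\<sigma> * t) A"
      proof -
        show "s \<le> T" using False ss \<sigma> by (simp add: T_def pos_le_divide_eq mult.commute)
        show "\<sigma> * T = min (\<sigma> * t) A" using \<sigma> by (simp add: T_def)
        have "0 < A" using False ss(1) s by linarith
        then have "A \<le> A * \<sigma>" using \<sigma> by simp
        then show "T \<le> min t A"
          using \<sigma> unfolding T_def by (auto simp: pos_divide_le_eq mult.commute min_le_iff_disj)
      qed
      have "H s * H (\<sigma> * T) \<le> H (\<sigma> * s) * H T" using H[OF \<sigma> T(1)] .
      also have "\<dots> \<le> H (\<sigma> * s) * H (min t A)" using H_mono[OF T(2)] by (rule mult_left_mono) simp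
      finally show ?thesis using False ss by (simp add: T min_absorb1)
    qed
  qed
qed

definition state :: "real \<Rightarrow> real \<Rightarrow> real \<Rightarrow> nat \<Rightarrow> real measure" where
  "state c A x n = (step_law c A M ^^ n) (return borel x)"

lemma state_law_state: "0 < c \<Longrightarrow> 0 \<le> x \<Longrightarrow> state_law (state c A x n)"
proof (induction n)
  case 0
  then have "AE y in return borel x. 0 \<le> y" by (subst AE_return) auto
  then show ?case
    by (auto simp: state_def state_law_def intro!: prob_space.finite_measure prob_space_return)
next
  case (Suc n)
  then show ?case by (auto simp: state_def intro: step_law_state_law)
qed

lemma sets_state[simp, measurable_cong]: "sets (state c A x n) = sets borel"
  by (cases n) (simp_all add: state_def)

lemma nn_integral_state:
  assumes "0 < c" "0 \<le> x"
  shows "u \<in> borel_measurable borel \<Longrightarrow> (\<integral>\<^sup>+y. u y \<partial>state c A x n) = (step c A M ^^ n) u x"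
proof (induction n arbitrary: u)
  case 0
  then show ?case by (simp add: state_def nn_integral_return)
next
  case (Suc n)
  have "(\<integral>\<^sup>+y. u y \<partial>state c A x (Suc n)) = (\<integral>\<^sup>+y. step c A M u y \<partial>state c A x n)"
    using nn_integral_step_law[OF state_law_state[OF assms] Suc.prems] by (simp add: state_def)
  also have "\<dots> = (step c A M ^^ n) (step c A M u) x" by (rule Suc.IH[OF step_measurable[OF Suc.prems]])
  finally show ?case by (simp add: funpow_Suc_right del: funpow.simps)
qed

lemma emeasure_state_UNIV: "0 < c \<Longrightarrow> 0 \<le> x \<Longrightarrow> emeasure (state c A x n) UNIV = surv c A M n x"
  using nn_integral_state[of c x "\<lambda>_. 1" A n] sets_eq_imp_space_eq[OF sets_state[of c A x n]]
  by (simp add: surv_def)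

lemma log_conc_state: 
  assumes "log_conc M" "0 < c"
  shows "log_conc (state c A 0 n)"
proof (induction n)
  case 0
  show ?case by (auto simp: log_conc_def state_def indicator_def)
next
  case (Suc n)
  have "log_conc (step_law c A M (state c A 0 n))"
    using assms by (intro log_conc_step_law state_law_state Suc) auto
  then show ?case by (simp add: state_def)
qed

lemma rh_le_state_start:
  assumes lc: "log_conc M" and c: "0 < c" and x: "0 \<le> x" "x \<le> x'"
  shows "rh_le (state c A x n) (state c A x' n)"
proof (induction n)
  case 0
  then show ?case using x by (auto simp: rh_le_def state_def indicator_def)
next
  case (Suc n)
  have "rh_le (step_law c A M (state c A x n)) (step_law c A M (state c A x' n))"
    using c x Suc by (intro rh_le_step_law[OF lc] state_law_state rh_le_add) auto
  then show ?case by (simp add: state_def)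
qed

text \<open>
  A smaller drift makes the surviving state smaller, in the reversed hazard rate order. Each step uses
  that the two states are ordered, that adding the larger drift increases the state further because
  its law is log-concave, and that multiplication by the likelihood ratio preserves the order.
\<close>
lemma rh_le_state_drift:
  assumes lc: "log_conc M" and c: "0 < c" "c \<le> c'" and pos: "\<And>n. surv c' A M n 0 \<noteq> 0"
  shows "rh_le (state c A 0 n) (state c' A 0 n)"
proof (induction n)
  case 0
  then show ?case by (auto simp: rh_le_def state_def)
next
  case (Suc n)
  have c': "0 < c'" using c by simp
  let ?m1 = "state c A 0 n" and ?m2 = "state c' A 0 n"
  have m: "state_law ?m1" "state_law ?m2" using c c' by (auto intro: state_law_state)
  have "rh_le (distr ?m1 borel (\<lambda>y. c + y)) (distr ?m2 borel (\<lambda>y. c' + y))"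
  proof (rule rh_le_trans)
    show "rh_le (distr ?m1 borel (\<lambda>y. c + y)) (distr ?m2 borel (\<lambda>y. c + y))"
      by (rule rh_le_add) (auto intro: Suc)
    show "rh_le (distr ?m2 borel (\<lambda>y. c + y)) (distr ?m2 borel (\<lambda>y. c' + y))"
      using m(2) log_conc_state[OF lc c'] c by (intro rh_le_add_log_conc) (auto simp: state_law_def)
    have "emeasure (distr ?m2 borel (\<lambda>y. c + y)) UNIV = surv c' A M n 0"
      using emeasure_state_UNIV[OF c', of 0 A n] sets_eq_imp_space_eq[OF sets_state[of c' A 0 n]]
      by (subst emeasure_distr) auto
    then show "emeasure (distr ?m2 borel (\<lambda>y. c + y)) UNIV \<noteq> 0" using pos by simp
  qed (auto intro: state_law_add m)
  then have "rh_le (step_law c A M ?m1) (step_law c' A M ?m2)"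
    by (intro rh_le_step_law[OF lc] m c)
  then show ?case by (simp add: state_def)
qed

text \<open>
  The reversed hazard rate order implies the usual stochastic order of the normalised measures.
\<close>
lemma rh_le_nn_integral_mean:
  assumes m: "state_law m1" "state_law m2" and rh: "rh_le m1 m2"
    and u: "antimono_on {0..} u"
  shows "(\<integral>\<^sup>+y. u y \<partial>m2) * emeasure m1 UNIV \<le> (\<integral>\<^sup>+y. u y \<partial>m1) * emeasure m2 UNIV"
proof -
  have sets: "sets m1 = sets borel" "sets m2 = sets borel" 
    and fin: "finite_measure m1" "finite_measure m2" using m by (auto simp: state_law_def)
  note sp = sets_eq_imp_space_eq[OF sets(1)] sets_eq_imp_space_eq[OF sets(2)]
  interpret m1: finite_measure m1 by fact
  interpret m2: finite_measure m2 by fact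
  have um: "antimono (\<lambda>y. u (max 0 y))"
    using u by (intro antimonoI) (auto simp: monotone_on_def)
  then have meas[measurable]: "(\<lambda>y. u (max 0 y)) \<in> borel_measurable borel" by (rule borel_measurable_antimono_ennreal)
  have eq: "(\<integral>\<^sup>+y. u y \<partial>m) = (\<integral>\<^sup>+y. u (max 0 y) \<partial>m)" if "state_law m" for m
    using that unfolding state_law_def
    by (intro nn_integral_cong_AE) (auto elim!: eventually_mono simp: max_absorb2)
  define K1 K2 where K: "K1 = emeasure m1 UNIV" "K2 = emeasure m2 UNIV"
  have inc: "incseq (\<lambda>n. {..<real n})" and U: "(\<Union>n. {..<real n}) = UNIV"
    using reals_Archimedean2 by (auto simp: incseq_def intro: less_le_trans)
  have lim: "(\<lambda>n. emeasure m {..<real n}) \<longlonglongrightarrow> emeasure m UNIV" if "sets m = sets borel" for m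
    using Lim_emeasure_incseq[OF _ inc, of m] that by (simp add: U image_subset_iff)
  have cdf: "emeasure m2 {..<t} * K1 \<le> emeasure m1 {..<t} * K2" for t
  proof (rule LIMSEQ_le)
    show "(\<lambda>n. emeasure m2 {..<t} * emeasure m1 {..<real n}) \<longlonglongrightarrow> emeasure m2 {..<t} * K1"
      unfolding K by (intro ennreal_tendsto_cmult lim sets) (auto simp: less_top[symmetric])
    show "(\<lambda>n. emeasure m1 {..<t} * emeasure m2 {..<real n}) \<longlonglongrightarrow> emeasure m1 {..<t} * K2"
      unfolding K by (intro ennreal_tendsto_cmult lim sets) (auto simp: less_top[symmetric])
    obtain N where N: "t \<le> real N" using real_arch_simple by blast
    show "\<exists>N. \<forall>n\<ge>N. emeasure m2 {..<t} * emeasure m1 {..<real n} \<le> emeasure m1 {..<t} * emeasure m2 {..<real n}"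
      using N by (intro exI[of _ N] allI impI rh_leD[OF rh]) auto
  qed
  have "(\<integral>\<^sup>+y. u (max 0 y) \<partial>scale_measure K1 m2) \<le> (\<integral>\<^sup>+y. u (max 0 y) \<partial>scale_measure K2 m1)"
  proof (rule nn_integral_antimono_le[OF _ _ _ _ _ um])
    show "finite_measure (scale_measure K1 m2)" "finite_measure (scale_measure K2 m1)"
      using fin by (auto intro!: finite_measureI simp: K sp space_scale_measure ennreal_mult_eq_top_iff)
  qed (use cdf in \<open>auto simp: sets mult.commute\<close>)
  then have "K1 * (\<integral>\<^sup>+y. u (max 0 y) \<partial>m2) \<le> K2 * (\<integral>\<^sup>+y. u (max 0 y) \<partial>m1)"
    by (subst (asm) (1 2) nn_integral_scale_measure) (auto simp: measurable_cong_sets[OF sets(1) refl] measurable_cong_sets[OF sets(2) refl])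
  then show ?thesis by (simp add: eq m K mult.commute)
qed

text \<open>
  Given survival for \<open>n\<close> steps, the state is stochastically larger for a larger starting value.
\<close>
lemma steps_ratio_antimono:
  assumes lc: "log_conc M" and c: "0 < c" and x: "0 \<le> x" "x \<le> x'"
    and u: "antimono_on {0..} u" "u \<in> borel_measurable borel"
  shows "(step c A M ^^ n) u x' * surv c A M n x \<le> (step c A M ^^ n) u x * surv c A M n x'"
  using rh_le_nn_integral_mean[OF state_law_state state_law_state rh_le_state_start[OF lc c x] u(1), of A n] c x u(2)
  by (simp add: nn_integral_state emeasure_state_UNIV)

text \<open>
  Given survival for \<open>n\<close> steps, the state is stochastically smaller for a smaller drift.
\<close>
lemma steps_ratio_drift:
  assumes lc: "log_conc M" and c: "0 < c" "c \<le> c'" and pos: "\<And>n. surv c' A M n 0 \<noteq> 0"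
    and u: "antimono_on {0..} u" "u \<in> borel_measurable borel"
  shows "(step c' A M ^^ n) u 0 * surv c A M n 0 \<le> (step c A M ^^ n) u 0 * surv c' A M n 0"
  using rh_le_nn_integral_mean[OF state_law_state state_law_state rh_le_state_drift[OF lc c pos] u(1), of n] c u(2)
  by (simp add: nn_integral_state emeasure_state_UNIV)

end

section \<open>The likelihood ratio under the pre-change law\<close>
locale lr_law = pos_subprob +
  assumes total_1: "emeasure M UNIV = 1"
    and lc: "log_conc M"
begin

definition cdf_less :: "real \<Rightarrow> ennreal" where "cdf_less t = emeasure M {..<t}"

lemma cdf_less_mono: "s \<le> t \<Longrightarrow> cdf_less s \<le> cdf_less t"
  unfolding cdf_less_def by (intro emeasure_mono) (auto simp: sets_M)

lemma cdf_less_nonpos: "t \<le> 0 \<Longrightarrow> cdf_less t = 0"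
  unfolding cdf_less_def using pos
  by (intro emeasure_lessThan_nonneg) (auto simp: sets_M elim: eventually_mono)

lemma cdf_less_le_1: "cdf_less t \<le> 1"
  using emeasure_mono[of "{..<t}" UNIV M] total_1 by (simp add: cdf_less_def sets_M)

lemma cdf_less_tendsto: "(\<lambda>n. cdf_less (real n)) \<longlonglongrightarrow> 1"
proof -
  have inc: "incseq (\<lambda>n. {..<real n})" and U: "(\<Union>n. {..<real n}) = UNIV"
    using reals_Archimedean2 by (auto simp: incseq_def intro: less_le_trans)
  then show ?thesis
    using Lim_emeasure_incseq[OF _ inc, of M] by (simp add: cdf_less_def U image_subset_iff sets_M total_1)
qed

text \<open>
  A log-concave distribution function that is constant and positive on an interval has reached its
  final value: with \<open>\<sigma> = t / s\<close>, log-concavity gives \<open>F (\<sigma> u) \<le> F u\<close> for all \<open>u \<ge> s\<close>. Hence the law charges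
  every interval between its essential infimum and its essential supremum.
\<close>
lemma null_interval:
  assumes "s < t" "emeasure M {s..<t} = 0"
  shows "cdf_less t = 0 \<or> cdf_less s = 1"
proof (rule disjCI)
  assume s1: "cdf_less s \<noteq> 1"
  have eq: "cdf_less t = cdf_less s"
  proof -
    have "emeasure M {..<t} = emeasure M {..<s} + emeasure M {s..<t}"
      using assms by (subst plus_emeasure) (auto simp: ivl_disj_un sets_M)
    then show ?thesis using assms by (simp add: cdf_less_def)
  qed
  show "cdf_less t = 0"
  proof (rule ccontr)
    assume nz: "cdf_less t \<noteq> 0"
    then have s: "0 < s" using eq cdf_less_nonpos[of s] by force
    define \<sigma> where "\<sigma> = t / s"
    have \<sigma>: "1 < \<sigma>" "\<sigma> * s = t" using s assms by (auto simp: \<sigma>_def)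
    have step: "cdf_less (\<sigma> * u) \<le> cdf_less u" if "s \<le> u" for u
    proof -
      have "cdf_less s * cdf_less (\<sigma> * u) \<le> cdf_less s * cdf_less u"
        using log_concD[OF lc, of \<sigma> s u] \<sigma> s that eq by (simp add: cdf_less_def)
      moreover have "cdf_less s \<noteq> \<top>" using cdf_less_le_1[of s] by (auto simp: top_unique)
      ultimately show ?thesis using nz eq by (simp add: ennreal_mult_le_mult_iff)
    qed
    have iter: "s \<le> \<sigma> ^ k * s \<and> cdf_less (\<sigma> ^ k * s) \<le> cdf_less s" for k
    proof (induction k)
      case (Suc k)
      have "1 * (\<sigma> ^ k * s) \<le> \<sigma> * (\<sigma> ^ k * s)" using \<sigma> s by (intro mult_right_mono) auto
      moreover have "cdf_less (\<sigma> * (\<sigma> ^ k * s)) \<le> cdf_less s"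
        using step[of "\<sigma> ^ k * s"] Suc by (blast intro: order_trans)
      ultimately show ?case using Suc by (simp add: mult.assoc)
    qed simp
    have "cdf_less (real n) \<le> cdf_less s" for n
    proof -
      obtain k where "real n / s < \<sigma> ^ k" using real_arch_pow[OF \<sigma>(1)] by blast
      then have "real n \<le> \<sigma> ^ k * s" using s by (simp add: field_simps)
      then show ?thesis using iter[of k] cdf_less_mono order_trans by blast
    qed
    then have "1 \<le> cdf_less s" using cdf_less_tendsto by (intro LIMSEQ_le_const2) auto
    then show False using s1 cdf_less_le_1[of s] by simp
  qed
qed

text \<open>
  The essential infimum of the likelihood ratio.
\<close>
definition lo :: real where "lo = Inf {t. cdf_less t \<noteq> 0}"

lemma lo_facts:
  shows lo_nonneg: "0 \<le> lo" and cdf_less_lo: "cdf_less lo = 0" and cdf_less_pos: "lo < t \<Longrightarrow> cdf_less t \<noteq> 0"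
proof -
  let ?S = "{t. cdf_less t \<noteq> 0}"
  have ne: "?S \<noteq> {}"
  proof
    assume "?S = {}"
    then have "(\<lambda>n. cdf_less (real n)) = (\<lambda>_. 0)" by auto
    then have "(\<lambda>n. 0::ennreal) \<longlonglongrightarrow> 1" using cdf_less_tendsto by simp
    then show False using LIMSEQ_unique[OF tendsto_const] by fastforce
  qed
  have lb: "0 \<le> t" if "t \<in> ?S" for t using that cdf_less_nonpos[of t] by force
  then have bdd: "bdd_below ?S" by (intro bdd_belowI)
  show "0 \<le> lo" unfolding lo_def using ne lb by (intro cInf_greatest) auto
  show "cdf_less t \<noteq> 0" if t: "lo < t"
  proof -
    obtain s where "s \<in> ?S" "s < t" using t cInf_less_iff[OF ne bdd] by (auto simp: lo_def)
    then show ?thesis using cdf_less_mono[of s t] by auto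
  qed
  have below: "cdf_less t = 0" if "t < lo" for t
    using that cInf_lower[OF _ bdd, of t] by (auto simp: lo_def)
  have inc: "incseq (\<lambda>n. {..<lo - 1 / real (Suc n)})"
    by (auto simp: incseq_def frac_le intro!: less_le_trans)
  have U: "(\<Union>n. {..<lo - 1 / real (Suc n)}) = {..<lo}"
  proof -
    have "\<exists>n. x < lo - 1 / real (Suc n)" if "x < lo" for x
      using nat_approx_posE[of "lo - x"] that by (metis diff_gt_0_iff_gt less_diff_eq add.commute)
    moreover have "lo - 1 / real (Suc n) < lo" for n by simp
    ultimately show ?thesis by (auto intro: less_trans)
  qed
  have "(\<lambda>n. cdf_less (lo - 1 / real (Suc n))) \<longlonglongrightarrow> cdf_less lo"
    using Lim_emeasure_incseq[OF _ inc, of M] by (simp only: U cdf_less_def) (simp add: image_subset_iff sets_M)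
  moreover have "(\<lambda>n. cdf_less (lo - 1 / real (Suc n))) = (\<lambda>_. 0)" by (intro ext below) simp
  ultimately show "cdf_less lo = 0" using LIMSEQ_unique[OF tendsto_const] by fastforce
qed

lemma AE_lo_le: "AE l in M. lo \<le> l"
  using cdf_less_lo by (intro AE_I[of _ _ "{..<lo}"]) (auto simp: cdf_less_def sets_M)

abbreviation S :: "real \<Rightarrow> nat \<Rightarrow> real \<Rightarrow> ennreal" where "S A \<equiv> surv 1 A M"

lemma step_ge:
  assumes "antimono_on {0..} u" "0 \<le> x" "(1 + x) * e \<le> A"
  shows "cdf_less e * u ((1 + x) * e) \<le> step 1 A M u x"
proof (cases "0 < e")
  case True
  have "cdf_less e * u ((1 + x) * e) = (\<integral>\<^sup>+l. u ((1 + x) * e) * indicator {..<e} l \<partial>M)"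
    by (subst nn_integral_cmult_indicator) (auto simp: sets_M cdf_less_def mult.commute)
  also have "\<dots> \<le> step 1 A M u x"
    unfolding step_def
  proof (rule nn_integral_mono_AE, use pos in \<open>rule eventually_mono\<close>)
    fix l :: real assume l: "0 < l"
    show "u ((1 + x) * e) * indicator {..<e} l \<le> u ((1 + x) * l) * indicator {..<A} ((1 + x) * l)"
    proof (cases "l < e")
      case True
      then have "(1 + x) * l < (1 + x) * e" using assms by (intro mult_strict_left_mono) auto
      moreover have "0 \<le> (1 + x) * l" using assms l by simp
      moreover have "(1 + x) * l < A" using \<open>(1 + x) * l < (1 + x) * e\<close> assms(3) by simp
      ultimately show ?thesis using monotone_onD[OF assms(1), of "(1 + x) * l" "(1 + x) * e"]
        by (simp add: indicator_def)
    qed simp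
  qed
  finally show ?thesis .
qed (simp add: cdf_less_nonpos)

lemma step_le_lo:
  assumes "antimono_on {0..} u" "0 \<le> x"
  shows "step 1 A M u x \<le> u ((1 + x) * lo)"
proof -
  have "step 1 A M u x \<le> (\<integral>\<^sup>+l. u ((1 + x) * lo) \<partial>M)"
    unfolding step_def
  proof (rule nn_integral_mono_AE, use AE_lo_le in \<open>rule eventually_mono\<close>)
    fix l :: real assume l: "lo \<le> l"
    then have "(1 + x) * lo \<le> (1 + x) * l" "0 \<le> (1 + x) * lo" using assms lo_nonneg by (auto intro: mult_left_mono)
    then show "u ((1 + x) * l) * indicator {..<A} ((1 + x) * l) \<le> u ((1 + x) * lo)"
      using monotone_onD[OF assms(1), of "(1 + x) * lo" "(1 + x) * l"] by (auto simp: indicator_def)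
  qed
  then show ?thesis by (simp add: total_1 space_M)
qed

text \<open>
  The trajectory of the statistic when all likelihood ratios are equal to \<open>e\<close>. With \<open>e = lo\<close> it is the
  smallest possible trajectory; it converges to the fixed point \<open>lo / (1 - lo)\<close>.
\<close>
definition path :: "real \<Rightarrow> nat \<Rightarrow> real \<Rightarrow> real" where
  "path e k = (\<lambda>x. (1 + x) * e) ^^ k"

lemma path_0[simp]: "path e 0 x = x"
  by (simp add: path_def)

lemma path_Suc: "path e (Suc k) x = path e k ((1 + x) * e)"
  unfolding path_def by (simp only: funpow_Suc_right o_apply)

lemma path_Suc': "path e (Suc k) x = (1 + path e k x) * e"
  by (simp add: path_def)

lemma path_eq: "e \<noteq> 1 \<Longrightarrow> path e k x = e / (1 - e) + (x - e / (1 - e)) * e ^ k"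
proof (induction k)
  case (Suc k)
  define d where "d = e / (1 - e)"
  have "(1 + d) * e = d" using Suc.prems by (simp add: d_def field_simps)
  have "path e k x = d + (x - d) * e ^ k" using Suc by (simp add: d_def)
  moreover have "(1 + (d + p)) * e = (1 + d) * e + p * e" for p by (simp add: algebra_simps)
  ultimately have "path e (Suc k) x = (1 + d) * e + (x - d) * e ^ Suc k"
    by (simp add: path_Suc' mult.assoc mult.commute)
  then show ?case unfolding \<open>(1 + d) * e = d\<close> by (simp add: d_def)
qed simp

lemma path_nonneg: "0 \<le> e \<Longrightarrow> 0 \<le> x \<Longrightarrow> 0 \<le> path e k x"
  by (induction k) (auto simp: path_Suc')

lemma path_mono: "0 \<le> e \<Longrightarrow> x \<le> y \<Longrightarrow> path e k x \<le> path e k y"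
  by (induction k) (auto simp: path_Suc' intro!: mult_right_mono)

lemma path_le: "0 \<le> e \<Longrightarrow> (1 + A) * e \<le> A \<Longrightarrow> x \<le> A \<Longrightarrow> path e k x \<le> A"
proof (induction k)
  case (Suc k)
  then have "(1 + path e k x) * e \<le> (1 + A) * e" by (intro mult_right_mono) auto
  then show ?case using Suc by (simp add: path_Suc')
qed simp

lemma path_tendsto:
  assumes "0 \<le> e" "e < 1"
  shows "(\<lambda>k. path e k x) \<longlonglongrightarrow> e / (1 - e)"
proof -
  have "(\<lambda>k. e / (1 - e) + (x - e / (1 - e)) * e ^ k) \<longlonglongrightarrow> e / (1 - e) + (x - e / (1 - e)) * 0"
    using assms by (intro tendsto_intros LIMSEQ_realpow_zero)
  then show ?thesis using assms by (simp add: path_eq)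
qed

lemma steps_ge:
  assumes u: "antimono_on {0..} u" and e: "0 \<le> e" "(1 + A) * e \<le> A"
  shows "0 \<le> x \<Longrightarrow> x \<le> A \<Longrightarrow> cdf_less e ^ k * u (path e k x) \<le> (step 1 A M ^^ k) u x"
proof (induction k arbitrary: x)
  case (Suc k)
  have le: "(1 + x) * e \<le> A" using path_le[OF e Suc.prems(2), of 1] by (simp add: path_Suc')
  have "cdf_less e ^ Suc k * u (path e (Suc k) x) = cdf_less e * (cdf_less e ^ k * u (path e k ((1 + x) * e)))"
    by (simp add: path_Suc mult.assoc)
  also have "\<dots> \<le> cdf_less e * (step 1 A M ^^ k) u ((1 + x) * e)"
    using Suc le e by (intro mult_left_mono Suc.IH) auto
  also have "\<dots> \<le> (step 1 A M ^^ Suc k) u x"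
    using step_ge[OF steps_antimono[OF _ u] Suc.prems(1) le] by simp
  finally show ?case .
qed simp

lemma steps_le_lo:
  assumes u: "antimono_on {0..} u"
  shows "0 \<le> x \<Longrightarrow> (step 1 A M ^^ k) u x \<le> u (path lo k x)"
proof (induction k arbitrary: x)
  case (Suc k)
  have "(step 1 A M ^^ Suc k) u x \<le> (step 1 A M ^^ k) u ((1 + x) * lo)"
    using step_le_lo[OF steps_antimono[OF _ u] Suc.prems] by simp
  also have "\<dots> \<le> u (path lo (Suc k) x)"
    using Suc lo_nonneg by (simp add: path_Suc)
  finally show ?case .
qed simp

text \<open>
  If the threshold were smaller than the limit of the smallest trajectory, every trajectory would
  gain at least \<open>\<delta>\<close> in each step until it is stopped, so survival would be impossible after finitely
  many steps.
\<close>
lemma threshold_ge: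
  assumes pos: "\<And>n. S A n 0 \<noteq> 0" and A: "0 < A"
  shows "(1 + A) * lo \<le> A"
proof (rule ccontr)
  assume "\<not> ?thesis"
  then have gt: "A < (1 + A) * lo" by simp
  define \<delta> where "\<delta> = min lo ((1 + A) * lo - A)"
  have \<delta>: "0 < \<delta>" using gt A lo_nonneg by (cases "lo = 0") (auto simp: \<delta>_def)
  have incr: "x + \<delta> \<le> (1 + x) * lo" if "0 \<le> x" "x \<le> A" for x
  proof (cases "1 \<le> lo")
    case True
    then have "1 * x \<le> lo * x" using that by (intro mult_right_mono) auto
    then show ?thesis by (auto simp: \<delta>_def algebra_simps)
  next
    case False
    then have "(1 - lo) * x \<le> (1 - lo) * A" using that by (intro mult_left_mono) auto
    then show ?thesis by (auto simp: \<delta>_def algebra_simps min_le_iff_disj)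
  qed
  have zero: "S A (Suc n) x = 0" if "0 \<le> x" "A \<le> x + real (Suc n) * \<delta>" for n x
    using that
  proof (induction n arbitrary: x)
    case (0 x)
    have "S A (Suc 0) x \<le> (\<integral>\<^sup>+l. 0 \<partial>M)"
      unfolding surv_Suc step_def
    proof (rule nn_integral_mono_AE, use AE_lo_le in \<open>rule eventually_mono\<close>)
      fix l assume l: "lo \<le> l"
      have "(1 + x) * lo \<le> (1 + x) * l" using l 0 by (intro mult_left_mono) auto
      moreover have "A \<le> (1 + x) * lo"
      proof (cases "x \<le> A")
        case True
        then show ?thesis using incr[of x] 0 by simp
      next
        case False
        then have "(1 + A) * lo \<le> (1 + x) * lo" using lo_nonneg by (intro mult_right_mono) auto
        then show ?thesis using gt by simp
      qed
      ultimately show "S A 0 ((1 + x) * l) * indicator {..<A} ((1 + x) * l) \<le> 0" by simp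
    qed
    then show ?case by simp
  next
    case (Suc n x)
    have "S A (Suc (Suc n)) x \<le> (\<integral>\<^sup>+l. 0 \<partial>M)"
      unfolding surv_Suc[of _ _ "Suc n"] step_def
    proof (rule nn_integral_mono_AE, use AE_lo_le in \<open>rule eventually_mono\<close>)
      fix l assume l: "lo \<le> l"
      have ge: "(1 + x) * lo \<le> (1 + x) * l" using l Suc by (intro mult_left_mono) auto
      have nn: "0 \<le> (1 + x) * l" using l lo_nonneg Suc by simp
      show "S A (Suc n) ((1 + x) * l) * indicator {..<A} ((1 + x) * l) \<le> 0"
      proof (cases "(1 + x) * l < A")
        case True
        have "x \<le> A"
        proof (rule ccontr)
          assume "\<not> x \<le> A"
          then have "(1 + A) * lo \<le> (1 + x) * lo" using lo_nonneg by (intro mult_right_mono) auto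
          then show False using gt ge True by simp
        qed
        then have "A \<le> (1 + x) * l + real (Suc n) * \<delta>"
          using incr[of x] Suc.prems ge by (simp add: algebra_simps)
        then have "S A (Suc n) ((1 + x) * l) = 0" using Suc.IH nn by blast
        then show ?thesis by simp
      qed simp
    qed
    then show ?case by simp
  qed
  obtain n where "A / \<delta> < real n" using reals_Archimedean2 by blast
  then have "A \<le> 0 + real (Suc n) * \<delta>" using \<delta> by (simp add: field_simps)
  then show False using zero[of 0 n] pos by auto
qed

lemma next_lt_threshold:
  assumes "(1 + A) * lo \<le> A" "0 < A" "y < A"
  shows "(1 + y) * lo < A"
proof (cases "lo = 0")
  case False
  then have "(1 + y) * lo < (1 + A) * lo" using lo_nonneg assms by (intro mult_strict_right_mono) auto
  then show ?thesis using assms by simp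
qed (use assms in simp)

text \<open>
  Factors close to the essential infimum keep the state below the threshold.
\<close>
lemma surv_pos:
  assumes A: "(1 + A) * lo \<le> A" "0 < A"
  shows "0 \<le> x \<Longrightarrow> (1 + x) * lo < A \<Longrightarrow> S A n x \<noteq> 0"
proof (induction n arbitrary: x)
  case (Suc n)
  define e where "e = (lo + A / (1 + x)) / 2"
  have *: "lo < A / (1 + x)" using Suc by (simp add: field_simps)
  then have "lo < e" "e < A / (1 + x)"
    using less_half_sum[OF *] gt_half_sum[OF *] by (simp_all add: e_def)
  then have e: "lo < e" "(1 + x) * e < A"
    using Suc by (auto simp: pos_less_divide_eq mult.commute)
  have "0 \<le> (1 + x) * e" using e lo_nonneg Suc by simp
  then have "S A n ((1 + x) * e) \<noteq> 0"
    using next_lt_threshold[OF A e(2)] by (intro Suc.IH)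
  then have "cdf_less e * S A n ((1 + x) * e) \<noteq> 0" using cdf_less_pos[OF e(1)] by simp
  moreover have "cdf_less e * S A n ((1 + x) * e) \<le> S A (Suc n) x"
    unfolding surv_Suc using e Suc by (intro step_ge surv_antimono) auto
  ultimately show ?case by auto
qed simp

lemma degenerate_surv:
  assumes deg: "\<And>e. cdf_less e = 0 \<or> cdf_less e = 1"
  shows "S A n x = 0 \<or> S A n x = 1"
proof -
  have "AE l in M. l = lo"
  proof -
    have "AE l in M. l < lo + 1 / real (Suc n)" for n
    proof -
      have "cdf_less (lo + 1 / real (Suc n)) = 1" using deg cdf_less_pos[of "lo + 1 / real (Suc n)"] by force
      then have "emeasure M (UNIV - {..<lo + 1 / real (Suc n)}) = 0"
        using emeasure_compl[of "{..<lo + 1 / real (Suc n)}" M] by (simp add: cdf_less_def sets_M space_M total_1)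
      then show ?thesis by (intro AE_I[of _ _ "UNIV - {..<lo + 1 / real (Suc n)}"]) (auto simp: sets_M)
    qed
    then have "AE l in M. \<forall>n. l < lo + 1 / real (Suc n)" by (simp add: AE_all_countable)
    with AE_lo_le show ?thesis
    proof eventually_elim
      fix l assume l: "lo \<le> l" "\<forall>n. l < lo + 1 / real (Suc n)"
      show "l = lo"
      proof (rule ccontr)
        assume "l \<noteq> lo"
        then have "0 < l - lo" using l by simp
        then obtain n where "1 / real (Suc n) < l - lo" using nat_approx_posE by blast
        then show False using l(2) by (smt (verit))
      qed
    qed
  qed
  then have eq: "step 1 A M u x = u ((1 + x) * lo) * indicator {..<A} ((1 + x) * lo)" for u x
  proof -
    have "step 1 A M u x = (\<integral>\<^sup>+l. u ((1 + x) * lo) * indicator {..<A} ((1 + x) * lo) \<partial>M)"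
      unfolding step_def using \<open>AE l in M. l = lo\<close> by (intro nn_integral_cong_AE) (auto elim!: eventually_mono)
    then show ?thesis by (simp add: space_M total_1)
  qed
  show ?thesis
    by (induction n arbitrary: x) (auto simp: surv_Suc eq indicator_def)
qed

text \<open>
  For a constant likelihood ratio the statistic is deterministic, so its time of stopping is either
  bounded or infinite.
\<close>
lemma nondegenerate:
  assumes pos: "\<And>n. S A n 0 \<noteq> 0" and fin: "mean_time 1 A M 0 < \<top>"
  shows "\<exists>e. cdf_less e \<noteq> 0 \<and> cdf_less e \<noteq> 1"
proof (rule ccontr)
  assume "\<not> ?thesis"
  then have "S A n 0 = 1" for n using degenerate_surv[of A n 0] pos[of n] by auto
  then have "mean_time 1 A M 0 = (\<Sum>n. 1)" by (simp add: mean_time_def)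
  also have "\<dots> = \<top>" by (rule suminf_one_ennreal)
  finally show False using fin by simp
qed

lemma cdf_less_strict:
  assumes nd: "cdf_less e0 \<noteq> 1" and e: "lo < e" "e \<le> e0" and s: "s < e"
  shows "cdf_less s < cdf_less e"
proof -
  have "cdf_less s \<noteq> cdf_less e"
  proof
    assume eq: "cdf_less s = cdf_less e"
    have "emeasure M {..<e} = emeasure M {..<s} + emeasure M {s..<e}"
      using s by (subst plus_emeasure) (auto simp: ivl_disj_un sets_M)
    then have "cdf_less e + 0 = cdf_less e + emeasure M {s..<e}" using eq by (simp add: cdf_less_def)
    moreover have "cdf_less e \<noteq> \<top>" using cdf_less_le_1[of e] by (auto simp: top_unique)
    ultimately have "emeasure M {s..<e} = 0" by (simp only: ennreal_add_left_cancel) auto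
    then have "cdf_less e = 0 \<or> cdf_less s = 1" using null_interval[OF s] by simp
    then have "cdf_less e = 1" using cdf_less_pos[OF e(1)] eq by auto
    then show False using cdf_less_mono[OF e(2)] cdf_less_le_1[of e0] nd by simp
  qed
  then show ?thesis using cdf_less_mono[of s e] s by (simp add: less_le)
qed

lemma exists_level:
  assumes nd: "\<exists>e. cdf_less e \<noteq> 0 \<and> cdf_less e \<noteq> 1" and u: "lo < u"
  obtains e0 where "lo < e0" "e0 < u" "cdf_less e0 \<noteq> 1"
proof -
  obtain e where e: "cdf_less e \<noteq> 0" "cdf_less e \<noteq> 1" using nd by blast
  have "lo < e" using e cdf_less_mono[of e lo] cdf_less_lo by (cases "lo < e") auto
  define e0 where "e0 = min e ((lo + u) / 2)"
  have "cdf_less e0 \<noteq> 1"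
    using cdf_less_mono[of e0 e] e(2) cdf_less_le_1[of e] by (auto simp: e0_def)
  moreover have "lo < e0" "e0 < u" using \<open>lo < e\<close> less_half_sum[OF u] gt_half_sum[OF u]
    by (auto simp: e0_def min_less_iff_disj)
  ultimately show ?thesis using that by blast
qed

end

section \<open>Survival probabilities from different starting values\<close>
text \<open>
  The threshold lies strictly above the limit of the smallest trajectory. In the remaining case
  \<open>(1 + A) * lo = A\<close> the statistic can survive for ever only by converging to \<open>A\<close>.
\<close>
locale noncritical = lr_law +
  fixes A :: real
  assumes A_pos: "0 < A" and noncrit: "(1 + A) * lo < A"
    and nondeg: "\<exists>e. cdf_less e \<noteq> 0 \<and> cdf_less e \<noteq> 1"
begin

definition fixpt :: real where "fixpt = lo / (1 - lo)"

lemma lo_less_1: "lo < 1"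
proof -
  have "lo * A \<le> A * lo" by simp
  then have "A * lo < A" using noncrit lo_nonneg by (simp add: algebra_simps)
  then show ?thesis using A_pos by simp
qed

lemma fixpt: "0 \<le> fixpt" "(1 + fixpt) * lo = fixpt" "fixpt < A"
  using lo_less_1 lo_nonneg noncrit by (auto simp: fixpt_def field_simps)

text \<open>
  A factor of at most \<open>e0\<close> does not take a state from below \<open>d\<close> to above it. The level \<open>x0\<close> lies between
  the limit of the smallest trajectory and \<open>d\<close>, so close to that limit that from \<open>path lo m 0\<close> upwards it is
  exceeded as soon as the factor is at least \<open>e0\<close>.
\<close>
lemma exists_levels:
  obtains e0 d x0 m where "lo < e0" "e0 < 1" "cdf_less e0 \<noteq> 1" "(1 + d) * e0 = d" "d < A"
    "fixpt < x0" "x0 < d" "x0 < (1 + path lo m 0) * e0"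
proof -
  have "lo < A / (1 + A)" using noncrit A_pos by (simp add: field_simps)
  then obtain e0 where e0: "lo < e0" "e0 < A / (1 + A)" "cdf_less e0 \<noteq> 1"
    using exists_level[OF nondeg] by blast
  have "A / (1 + A) < 1" using A_pos by simp
  then have e1: "e0 < 1" using e0 by simp
  define d where "d = e0 / (1 - e0)"
  have d: "(1 + d) * e0 = d" "d < A"
    using e1 e0 A_pos by (auto simp: d_def field_simps)
  have "fixpt < d"
    using lo_less_1 e0 e1 lo_nonneg by (simp add: fixpt_def d_def field_simps)
  have fe: "fixpt < (1 + fixpt) * e0"
  proof -
    have "(1 + fixpt) * lo < (1 + fixpt) * e0" using e0 fixpt by (intro mult_strict_left_mono) auto
    then show ?thesis using fixpt by simp
  qed
  define x0 where "x0 = (fixpt + (1 + fixpt) * e0) / 2"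
  have x0: "fixpt < x0" "x0 < (1 + fixpt) * e0" using less_half_sum[OF fe] gt_half_sum[OF fe] by (simp_all add: x0_def)
  have "(1 + fixpt) * e0 < (1 + d) * e0" using \<open>fixpt < d\<close> e0 lo_nonneg by (intro mult_strict_right_mono) auto
  then have "x0 < d" using x0 d by simp
  have "(\<lambda>m. (1 + path lo m 0) * e0) \<longlonglongrightarrow> (1 + fixpt) * e0"
    unfolding fixpt_def by (intro tendsto_intros path_tendsto lo_nonneg lo_less_1)
  then have "eventually (\<lambda>m. x0 < (1 + path lo m 0) * e0) sequentially"
    using x0 by (intro order_tendstoD)
  then obtain m where "x0 < (1 + path lo m 0) * e0" by (auto simp: eventually_sequentially)
  then show ?thesis using that e0 e1 d x0 \<open>x0 < d\<close> by blast
qed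

text \<open>
  Even from the threshold, factors close to \<open>lo\<close> bring the state down to the level \<open>x0\<close> in a fixed number
  of steps. For antitone \<open>u\<close> this bounds all later survival probabilities and means at once.
\<close>
lemma descend:
  assumes "fixpt < x0"
  shows "\<exists>k c. c \<noteq> 0 \<and> c \<le> 1 \<and> (\<forall>u. antimono_on {0..} u \<longrightarrow> c * u x0 \<le> (step 1 A M ^^ k) u A)"
proof -
  have "lo * (1 + x0) < x0"
    using assms lo_less_1 by (auto simp: fixpt_def field_simps)
  moreover have "0 < 1 + x0" using assms fixpt(1) by linarith
  ultimately have lt: "lo < x0 / (1 + x0)" "lo < A / (1 + A)"
    using noncrit A_pos by (simp_all add: pos_less_divide_eq mult.commute)
  obtain e where e: "lo < e" "e < x0 / (1 + x0)" "e < A / (1 + A)"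
    using lt dense[of lo "min (x0 / (1 + x0)) (A / (1 + A))"] by auto
  have e1: "e < 1"
  proof -
    have "A / (1 + A) < 1" using A_pos by simp
    then show ?thesis using e by linarith
  qed
  have eA: "(1 + A) * e \<le> A" using e A_pos by (simp add: field_simps)
  have e0: "0 \<le> e" using e lo_nonneg by simp
  have "e / (1 - e) < x0" using e e1 assms fixpt by (simp add: field_simps)
  then have "eventually (\<lambda>k. path e k A < x0) sequentially"
    using path_tendsto[OF e0 e1] by (intro order_tendstoD)
  then obtain k where k: "path e k A < x0" by (auto simp: eventually_sequentially)
  show ?thesis
  proof (intro exI[of _ k] exI[of _ "cdf_less e ^ k"] conjI allI impI)
    show "cdf_less e ^ k \<noteq> 0" using cdf_less_pos[OF e(1)] by simp
    show "cdf_less e ^ k \<le> 1" using cdf_less_le_1 by (intro power_le_one) auto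
    fix u :: "real \<Rightarrow> ennreal" assume u: "antimono_on {0..} u"
    have "u x0 \<le> u (path e k A)"
      using u k path_nonneg[OF e0, of A k] A_pos by (auto simp: monotone_on_def)
    then have "cdf_less e ^ k * u x0 \<le> cdf_less e ^ k * u (path e k A)" by (rule mult_left_mono) simp
    also have "\<dots> \<le> (step 1 A M ^^ k) u A" using A_pos by (intro steps_ge u e0 eA) auto
    finally show "cdf_less e ^ k * u x0 \<le> (step 1 A M ^^ k) u A" .
  qed
qed

lemma surv_A_pos: "S A n A \<noteq> 0"
  using noncrit A_pos by (intro surv_pos) auto

lemma surv_real: "0 \<le> x \<Longrightarrow> S A n x = ennreal (enn2real (S A n x))"
  using surv_fin[of 1 x A n] by (simp add: less_top)

text \<open>
  A Harnack inequality: the best and the worst starting value have survival probabilities of the same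
  order. Only starting values below the fixed point could have an advantage. To exploit it, the chain
  has to stay below \<open>x0\<close>, which has probability at most \<open>\<theta>\<close> per step; but a chain at \<open>d\<close> survives each step
  and stays at most \<open>d\<close> with the larger probability \<open>\<rho>\<close>. So the ratio \<open>r n am / r n d\<close> satisfies a
  recursion with factor \<open>\<theta> / \<rho> < 1\<close> and is bounded. All other starting values are compared with these
  through \<open>descend\<close> and the smallest trajectory.
\<close>
lemma survival_comparison: "\<exists>C. C < \<top> \<and> (\<forall>n. S A n 0 \<le> C * S A n A)"
proof -
  obtain e0 d x0 m where c: "lo < e0" "e0 < 1" "cdf_less e0 \<noteq> 1" "(1 + d) * e0 = d" "d < A"
    "fixpt < x0" "x0 < d" "x0 < (1 + path lo m 0) * e0" by (rule exists_levels)
  define am where "am = path lo m 0"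
  have am: "0 \<le> am" "am \<le> (1 + am) * lo" "am \<le> fixpt"
  proof -
    show "0 \<le> am" unfolding am_def by (intro path_nonneg lo_nonneg) simp
    have "path lo m 0 \<le> path lo m ((1 + 0) * lo)" by (rule path_mono) (simp_all add: lo_nonneg)
    also have "\<dots> = (1 + path lo m 0) * lo" using path_Suc[of lo m 0] path_Suc'[of lo m 0] by simp
    finally show "am \<le> (1 + am) * lo" by (simp add: am_def)
    show "am \<le> fixpt" unfolding am_def by (intro path_le) (simp_all add: fixpt lo_nonneg)
  qed
  have nn: "0 \<le> x0" "0 \<le> d" using c fixpt by auto
  obtain k b where b: "b \<noteq> 0" "b \<le> 1" "\<forall>u. antimono_on {0..} u \<longrightarrow> b * u x0 \<le> (step 1 A M ^^ k) u A"
    using descend[OF c(6)] by blast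
  define r where "r n x = enn2real (S A n x)" for n x
  have r: "S A n x = ennreal (r n x)" if "0 \<le> x" for n x using surv_real[OF that] by (simp add: r_def)
  have r0: "0 \<le> r n x" for n x by (simp add: r_def)
  define \<theta> where "\<theta> = enn2real (cdf_less (x0 / (1 + am)))"
  define \<rho> where "\<rho> = enn2real (cdf_less e0)"
  define \<beta> where "\<beta> = enn2real b"
  have fin: "cdf_less t \<noteq> \<top>" for t using cdf_less_le_1[of t] by (auto simp: top_unique)
  have \<theta>: "cdf_less (x0 / (1 + am)) = ennreal \<theta>" and \<rho>: "cdf_less e0 = ennreal \<rho>"
    using fin by (auto simp: \<theta>_def \<rho>_def less_top)
  have \<beta>: "b = ennreal \<beta>" "0 < \<beta>" proof -
    have "b \<noteq> \<top>" using b by (auto simp: top_unique)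
    then show "b = ennreal \<beta>" "0 < \<beta>"
      using b(1) by (auto simp: \<beta>_def less_top enn2real_positive_iff zero_less_iff_neq_zero)
  qed
  have \<theta>0: "0 \<le> \<theta>" and \<rho>0: "0 \<le> \<rho>" by (auto simp: \<theta>_def \<rho>_def)
  have \<theta>\<rho>: "\<theta> < \<rho>"
  proof -
    have "x0 / (1 + am) < e0" using c am by (simp add: am_def field_simps)
    then have "cdf_less (x0 / (1 + am)) < cdf_less e0" using cdf_less_strict[OF c(3) c(1)] by simp
    then show ?thesis by (simp add: \<theta> \<rho> \<theta>0 ennreal_less_iff)
  qed
  have up: "r (Suc n) am \<le> \<theta> * r n am + r n x0" for n
  proof -
    have "S A (Suc n) am \<le> (\<integral>\<^sup>+l. S A n am * indicator {..<x0 / (1 + am)} l + S A n x0 \<partial>M)"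
      unfolding surv_Suc step_def
    proof (rule nn_integral_mono_AE, use AE_lo_le in \<open>rule eventually_mono\<close>)
      fix l assume l: "lo \<le> l"
      have "(1 + am) * lo \<le> (1 + am) * l" using l am by (intro mult_left_mono) auto
      then have ge: "am \<le> (1 + am) * l" by (rule order_trans[OF am(2)])
      show "S A n ((1 + am) * l) * indicator {..<A} ((1 + am) * l)
          \<le> S A n am * indicator {..<x0 / (1 + am)} l + S A n x0"
      proof (cases "(1 + am) * l < x0")
        case True
        then have "l < x0 / (1 + am)" using am by (simp add: field_simps)
        then have "S A n ((1 + am) * l) \<le> S A n am * indicator {..<x0 / (1 + am)} l"
          using surv_le_start[of 1 am "(1 + am) * l" A n] ge am by simp
        then show ?thesis by (simp add: indicator_def add_increasing2)
      next
        case False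
        then have "S A n ((1 + am) * l) \<le> S A n x0" using nn by (intro surv_le_start) auto
        then show ?thesis by (simp add: indicator_def add_increasing)
      qed
    qed
    also have "\<dots> = S A n am * cdf_less (x0 / (1 + am)) + S A n x0"
      by (subst nn_integral_add)
        (auto simp: sets_M nn_integral_cmult_indicator cdf_less_def total_1 space_M)
    also have "\<dots> = ennreal (\<theta> * r n am + r n x0)"
      using am nn r0 \<theta>0 by (simp add: r \<theta> ennreal_mult ennreal_plus mult.commute)
    finally show ?thesis using am r0 \<theta>0 by (simp add: r del: ennreal_plus)
  qed
  have down: "\<rho> * r n d \<le> r (Suc n) d" for n
  proof -
    have "cdf_less e0 * S A n ((1 + d) * e0) \<le> S A (Suc n) d"
      unfolding surv_Suc using c nn by (intro step_ge surv_antimono) auto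
    then show ?thesis using nn r0 \<rho>0 by (simp add: r \<rho> c(4) flip: ennreal_mult)
  qed
  have drop: "\<beta> * r n x0 \<le> r n A" for n
  proof -
    have "b * S A n x0 \<le> S A (k + n) A" using b(3)[rule_format, OF surv_antimono[of 1 A n]] by (simp add: surv_add)
    also have "\<dots> \<le> S A n A" using A_pos by (intro surv_mono_n) auto
    finally show ?thesis using nn r0 \<beta> A_pos by (simp add: r flip: ennreal_mult)
  qed
  have mono: "r n y \<le> r n x" if "0 \<le> x" "x \<le> y" for n x y
    using surv_le_start[of 1 x y A n] that r0 by (simp add: r)
  \<comment> \<open>The fixed point of the recursion \<open>K \<mapsto> (\<theta> * K + 1 / \<beta>) / \<rho>\<close>, or the initial ratio \<open>1\<close>.\<close>
  define K where "K = max 1 (1 / \<beta> / (\<rho> - \<theta>))"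
  have K: "1 \<le> K" "1 / \<beta> \<le> K * (\<rho> - \<theta>)"
  proof -
    have "1 / \<beta> / (\<rho> - \<theta>) * (\<rho> - \<theta>) \<le> K * (\<rho> - \<theta>)"
      using \<theta>\<rho> by (intro mult_right_mono) (auto simp: K_def)
    then show "1 / \<beta> \<le> K * (\<rho> - \<theta>)" using \<theta>\<rho> by simp
  qed (simp add: K_def)
  have ratio: "r n am \<le> K * r n d" for n
  proof (induction n)
    case 0
    then show ?case using K by (simp add: r_def)
  next
    case (Suc n)
    have "r n x0 \<le> 1 / \<beta> * r n A" using drop[of n] \<beta> by (simp add: field_simps)
    also have "\<dots> \<le> 1 / \<beta> * r n d" using mono[of d A] nn c \<beta> by (intro mult_left_mono) auto
    finally have x0: "r n x0 \<le> 1 / \<beta> * r n d" .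
    have "r (Suc n) am \<le> \<theta> * r n am + r n x0" by (rule up)
    also have "\<dots> \<le> \<theta> * (K * r n d) + K * (\<rho> - \<theta>) * r n d"
      using Suc \<theta>0 order_trans[OF x0 mult_right_mono[OF K(2) r0]] by (intro add_mono mult_left_mono) auto
    also have "\<dots> = K * (\<rho> * r n d)" by (simp add: algebra_simps)
    also have "\<dots> \<le> K * r (Suc n) d" using down K by (intro mult_left_mono) auto
    finally show ?case .
  qed
  have \<rho>_pos: "0 < \<rho>" using \<theta>\<rho> \<theta>0 by simp
  have far: "\<rho> ^ j * r n d \<le> r (n + j) d" for n j
  proof (induction j)
    case (Suc j)
    have "\<rho> ^ Suc j * r n d = \<rho> * (\<rho> ^ j * r n d)" by simp
    also have "\<dots> \<le> \<rho> * r (n + j) d" using Suc \<rho>0 by (intro mult_left_mono) auto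
    also have "\<dots> \<le> r (n + Suc j) d" using down by simp
    finally show ?case .
  qed simp
  define C where "C = max (K / (\<beta> * \<rho> ^ m)) (1 / r m A)"
  have rA: "0 < r n A" for n
    using surv_A_pos[of n] r[of A n] A_pos r0[of n A] by (cases "r n A = 0") auto
  have "r n 0 \<le> C * r n A" for n
  proof (cases "m \<le> n")
    case True
    then obtain j where n: "n = j + m" by (metis le_add_diff_inverse2)
    have "S A n 0 \<le> S A j am"
    proof -
      have "(step 1 A M ^^ m) (S A j) 0 \<le> S A j am"
        unfolding am_def by (intro steps_le_lo surv_antimono) auto
      then show ?thesis by (simp add: n add.commute[of j] surv_add)
    qed
    then have "r n 0 \<le> r j am" using am r0 by (simp add: r)
    also have "\<dots> \<le> K * r j d" by (rule ratio)
    also have "\<dots> \<le> K * (r n d / \<rho> ^ m)"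
      using far[where n = j and j = m] K \<rho>_pos by (intro mult_left_mono) (auto simp: n field_simps)
    also have "\<dots> \<le> K * (r n x0 / \<rho> ^ m)"
      using mono[of x0 d n] nn c K \<rho>_pos by (intro mult_left_mono divide_right_mono) auto
    also have "\<dots> \<le> K * (r n A / \<beta> / \<rho> ^ m)"
      using drop[of n] \<beta> K \<rho>_pos by (intro mult_left_mono divide_right_mono) (auto simp: field_simps)
    also have "\<dots> = K / (\<beta> * \<rho> ^ m) * r n A" by (simp add: field_simps)
    also have "\<dots> \<le> C * r n A" using r0 by (intro mult_right_mono) (auto simp: C_def)
    finally show ?thesis .
  next
    case False
    have "S A n 0 \<le> 1" by (rule surv_le_1) auto
    then have "r n 0 \<le> 1" using r[of 0 n] by simp
    also have "\<dots> = 1 / r m A * r m A" using rA[of m] by simp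
    also have "\<dots> \<le> 1 / r m A * r n A"
    proof -
      have "S A m A \<le> S A n A" using False A_pos by (intro surv_mono_n) auto
      then show ?thesis using A_pos r0 rA[of m] by (intro mult_left_mono) (auto simp: r)
    qed
    also have "\<dots> \<le> C * r n A" using r0 by (intro mult_right_mono) (auto simp: C_def)
    finally show ?thesis .
  qed
  moreover have "0 \<le> C" using rA[of m] by (simp add: C_def le_max_iff_disj)
  ultimately have "S A n 0 \<le> ennreal C * S A n A" for n
    using A_pos r0 by (simp add: r flip: ennreal_mult)
  then show ?thesis by (intro exI[of _ "ennreal C"]) auto
qed

text \<open>
  From zero the state can exceed \<open>x0\<close> and survive: it stays at most \<open>d\<close> for \<open>m\<close> steps, is then at least
  \<open>path lo m 0\<close>, and the next factor may lie between \<open>x0 / (1 + path lo m 0)\<close> and \<open>A / (1 + d)\<close>, an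
  interval around \<open>e0\<close> and therefore of positive mass.
\<close>
lemma ascend:
  assumes c: "lo < e0" "e0 < 1" "cdf_less e0 \<noteq> 1" "(1 + d) * e0 = d" "d < A" "x0 < (1 + path lo m 0) * e0"
  shows "(step 1 A M ^^ Suc m) (indicator {x0..}) 0 \<noteq> 0"
proof -
  have e0: "0 < e0" using c lo_nonneg by simp
  have d: "0 < 1 + d" "0 < d"
  proof -
    have "d * (1 - e0) = e0" using c(4) by (simp add: algebra_simps)
    then show "0 < d" using e0 c(2) by (metis diff_gt_0_iff_gt zero_less_mult_pos2)
    then show "0 < 1 + d" by simp
  qed
  define q where "q = emeasure M {x0 / (1 + path lo m 0)..<A / (1 + d)}"
  have am: "0 \<le> path lo m 0" by (intro path_nonneg lo_nonneg) simp
  have i1: "x0 / (1 + path lo m 0) < e0" using c am by (simp add: field_simps)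
  have "e0 = d / (1 + d)" using c(4) d by (simp add: field_simps)
  then have i2: "e0 < A / (1 + d)" using c d by (simp add: divide_strict_right_mono)
  have q: "q \<noteq> 0"
  proof
    assume "q = 0"
    then have "cdf_less (A / (1 + d)) = 0 \<or> cdf_less (x0 / (1 + path lo m 0)) = 1"
      using null_interval i1 i2 by (simp add: q_def)
    moreover have "cdf_less (A / (1 + d)) \<noteq> 0" using cdf_less_pos i2 c by simp
    moreover have "cdf_less (x0 / (1 + path lo m 0)) \<noteq> 1"
      using cdf_less_mono[of "x0 / (1 + path lo m 0)" e0] i1 c(3) cdf_less_le_1[of e0] by auto
    ultimately show False by simp
  qed
  have stay: "cdf_less e0 ^ k \<le> (step 1 A M ^^ k) (indicator {path lo k x..d}) x" if "0 \<le> x" "x \<le> d" for k x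
    using that
  proof (induction k arbitrary: x)
    case (Suc k)
    have "cdf_less e0 ^ Suc k = (\<integral>\<^sup>+l. cdf_less e0 ^ k * indicator {..<e0} l \<partial>M)"
      by (subst nn_integral_cmult_indicator) (auto simp: sets_M cdf_less_def mult.commute)
    also have "\<dots> \<le> step 1 A M ((step 1 A M ^^ k) (indicator {path lo (Suc k) x..d})) x"
      unfolding step_def[of 1 A M "(step 1 A M ^^ k) (indicator {path lo (Suc k) x..d})"]
    proof (rule nn_integral_mono_AE, use AE_lo_le in \<open>rule eventually_mono\<close>)
      fix l assume l: "lo \<le> l"
      show "cdf_less e0 ^ k * indicator {..<e0} l
        \<le> (step 1 A M ^^ k) (indicator {path lo (Suc k) x..d}) ((1 + x) * l) * indicator {..<A} ((1 + x) * l)"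
      proof (cases "l < e0")
        case True
        have y: "0 \<le> (1 + x) * l" "(1 + x) * lo \<le> (1 + x) * l" "(1 + x) * l \<le> d"
        proof -
          have "(1 + x) * l \<le> (1 + d) * e0" using Suc.prems True l lo_nonneg by (intro mult_mono) auto
          then show "(1 + x) * l \<le> d" using c by simp
        qed (use Suc.prems l lo_nonneg in \<open>auto intro: mult_left_mono\<close>)
        have "cdf_less e0 ^ k \<le> (step 1 A M ^^ k) (indicator {path lo k ((1 + x) * l)..d}) ((1 + x) * l)"
          by (rule Suc.IH[OF y(1,3)])
        also have "\<dots> \<le> (step 1 A M ^^ k) (indicator {path lo (Suc k) x..d}) ((1 + x) * l)"
          using path_mono[OF lo_nonneg y(2), of k] y by (intro steps_mono) (auto simp: path_Suc indicator_def)
        finally show ?thesis using True y c by simp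
      qed simp
    qed
    finally show ?case by simp
  qed simp
  have "cdf_less e0 ^ m * q \<noteq> 0" using q cdf_less_pos[OF c(1)] by simp
  moreover have "cdf_less e0 ^ m * q \<le> (step 1 A M ^^ Suc m) (indicator {x0..}) 0"
  proof -
    have "cdf_less e0 ^ m * q \<le> q * (step 1 A M ^^ m) (indicator {path lo m 0..d}) 0"
      using stay[of 0 m] d by (simp add: mult.commute mult_left_mono)
    also have "\<dots> = (step 1 A M ^^ m) (\<lambda>y. q * indicator {path lo m 0..d} y) 0"
      by (rule steps_cmult[symmetric]) simp
    also have "\<dots> \<le> (step 1 A M ^^ m) (step 1 A M (indicator {x0..})) 0"
    proof (rule steps_mono)
      fix y :: real assume y: "0 \<le> y"
      show "q * indicator {path lo m 0..d} y \<le> step 1 A M (indicator {x0..}) y"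
      proof (cases "y \<in> {path lo m 0..d}")
        case True
        have "q = (\<integral>\<^sup>+l. indicator {x0 / (1 + path lo m 0)..<A / (1 + d)} l \<partial>M)" by (simp add: q_def sets_M)
        also have "\<dots> \<le> step 1 A M (indicator {x0..}) y"
          unfolding step_def
        proof (rule nn_integral_mono_AE, use pos in \<open>rule eventually_mono\<close>)
          fix l :: real assume l: "0 < l"
          show "indicator {x0 / (1 + path lo m 0)..<A / (1 + d)} l
            \<le> (indicator {x0..} ((1 + y) * l) * indicator {..<A} ((1 + y) * l) :: ennreal)"
          proof (cases "l \<in> {x0 / (1 + path lo m 0)..<A / (1 + d)}")
            case l': True
            then have "x0 \<le> (1 + path lo m 0) * l" "(1 + d) * l < A" using am d by (auto simp: field_simps)
            moreover have "(1 + path lo m 0) * l \<le> (1 + y) * l" "(1 + y) * l \<le> (1 + d) * l"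
              using True l by (auto intro!: mult_right_mono)
            ultimately show ?thesis by (simp add: indicator_def)
          qed simp
        qed
        finally show ?thesis using True by simp
      qed simp
    qed auto
    also have "\<dots> = (step 1 A M ^^ Suc m) (indicator {x0..}) 0"
      by (simp only: funpow_Suc_right o_apply)
    finally show ?thesis .
  qed
  ultimately show ?thesis by auto
qed

end

section \<open>Loss of memory of the starting value\<close>
context lr_law
begin

lemma steps_mono_below:
  assumes "0 < k" "0 \<le> x" "\<And>y. 0 \<le> y \<Longrightarrow> y < A \<Longrightarrow> u y \<le> v y"
  shows "(step 1 A M ^^ k) u x \<le> (step 1 A M ^^ k) v x"
proof -
  obtain j where k: "k = Suc j" using assms(1) by (cases k) auto
  show ?thesis unfolding k funpow_Suc_right o_apply
    using assms by (intro steps_mono step_mono) auto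
qed

text \<open>
  At the critical threshold the smallest trajectory from zero increases to the threshold and overtakes
  every admissible starting value.
\<close>
lemma critical_path:
  assumes eq: "(1 + A) * lo = A" and A: "0 < A" and r: "0 \<le> r" "(1 + r) * lo < A"
  shows "\<exists>k>0. r < path lo k 0"
proof -
  have lo: "0 < lo" "lo < 1"
  proof -
    show "0 < lo" using eq A lo_nonneg by (cases "lo = 0") auto
    then have "A * lo < A" using eq by (simp add: algebra_simps)
    then show "lo < 1" using A by simp
  qed
  have fix_A: "lo / (1 - lo) = A" using eq lo by (simp add: field_simps)
  have "(1 + r) * lo < (1 + A) * lo" using r eq by simp
  then have "r < A" using lo by simp
  then have "eventually (\<lambda>k. r < path lo k 0) sequentially"
    using path_tendsto[of lo 0] lo fix_A by (intro order_tendstoD) auto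
  then obtain k where k: "r < path lo k 0" by (auto simp: eventually_sequentially)
  moreover have "0 < k" using k r by (cases k) auto
  ultimately show ?thesis by blast
qed

lemma steps_mono_above:
  shows "0 < k \<Longrightarrow> 0 \<le> x \<Longrightarrow> (\<And>y. path lo k x \<le> y \<Longrightarrow> y < A \<Longrightarrow> u y \<le> v y) \<Longrightarrow>
    (step 1 A M ^^ k) u x \<le> (step 1 A M ^^ k) v x"
proof (induction k arbitrary: x)
  case (Suc k)
  show ?case
    unfolding funpow.simps o_apply step_def[of 1 A M _ x]
  proof (rule nn_integral_mono_AE, use AE_lo_le in \<open>rule eventually_mono\<close>)
    fix l assume l: "lo \<le> l"
    have y: "0 \<le> (1 + x) * l" "(1 + x) * lo \<le> (1 + x) * l"
      using Suc.prems l lo_nonneg by (auto intro: mult_left_mono)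
    have le: "path lo (Suc k) x \<le> path lo k ((1 + x) * l)"
      unfolding path_Suc using y by (intro path_mono lo_nonneg)
    show "(step 1 A M ^^ k) u ((1 + x) * l) * indicator {..<A} ((1 + x) * l)
        \<le> (step 1 A M ^^ k) v ((1 + x) * l) * indicator {..<A} ((1 + x) * l)"
    proof (cases "(1 + x) * l < A")
      case True
      have "(step 1 A M ^^ k) u ((1 + x) * l) \<le> (step 1 A M ^^ k) v ((1 + x) * l)"
      proof (cases "k = 0")
        case True
        then show ?thesis using Suc.prems(3)[of "(1 + x) * l"] le \<open>(1 + x) * l < A\<close> by simp
      next
        case False
        then show ?thesis using Suc.IH[OF _ y(1)] Suc.prems(3) le by (simp add: order_trans)
      qed
      then show ?thesis by (rule mult_right_mono) simp
    qed simp
  qed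
qed simp

end

text \<open>
  For an antitone \<open>u\<close>, the conditional mean of \<open>u\<close> at the state after \<open>n\<close> steps, given survival, is the
  quotient of the \<open>n\<close>-step kernel applied to \<open>u\<close> and to \<open>1\<close>. The aim is that its limit exists and does
  not depend on the starting value. It is antitone in the starting value, so zero gives the largest
  and the threshold the smallest mean.
\<close>
locale ratio = lr_law +
  fixes A :: real and u :: "real \<Rightarrow> ennreal"
  assumes A_pos: "0 < A" and crit: "(1 + A) * lo \<le> A"
    and u_antimono: "antimono_on {0..} u" and u_meas[measurable]: "u \<in> borel_measurable borel"
    and u_fin: "u 0 < \<top>"
begin

abbreviation W :: "nat \<Rightarrow> real \<Rightarrow> ennreal" where "W n \<equiv> (step 1 A M ^^ n) u"

definition w :: "nat \<Rightarrow> real \<Rightarrow> real" where "w n x = enn2real (W n x) / enn2real (S A n x)"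

definition s :: "nat \<Rightarrow> real \<Rightarrow> real" where "s n x = enn2real (S A n x)"

lemma S_eq: "0 \<le> x \<Longrightarrow> S A n x = ennreal (s n x)"
  using surv_fin[of 1 x A n] by (simp add: s_def less_top)

lemma s_nonneg: "0 \<le> s n x" by (simp add: s_def)

lemma w_nonneg: "0 \<le> w n x" by (simp add: w_def)

lemma s_pos: "0 \<le> x \<Longrightarrow> (1 + x) * lo < A \<Longrightarrow> 0 < s n x"
  using surv_pos[OF crit A_pos, of x n] S_eq[of x n] s_nonneg[of n x] by (cases "s n x = 0") auto

lemma W_fin: "0 \<le> x \<Longrightarrow> W n x < \<top>"
proof -
  assume x: "0 \<le> x"
  have "W n x \<le> (step 1 A M ^^ n) (\<lambda>_. u 0 * 1) x"
    using u_antimono x by (intro steps_mono) (auto simp: monotone_on_def)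
  also have "\<dots> = u 0 * S A n x" unfolding surv_def by (rule steps_cmult) simp
  also have "\<dots> < \<top>" using u_fin x by (simp add: ennreal_mult_less_top)
  finally show ?thesis .
qed

lemma W_eq: "0 \<le> x \<Longrightarrow> (1 + x) * lo < A \<Longrightarrow> W n x = ennreal (w n x) * S A n x"
  using s_pos[of x n] W_fin[of x n] s_nonneg[of n x] w_nonneg[of n x]
  by (simp add: S_eq flip: ennreal_mult) (simp add: w_def s_def less_top)

lemma below_dom: "y < A \<Longrightarrow> (1 + y) * lo < A"
  by (rule next_lt_threshold[OF crit A_pos])

lemma w_antimono:
  assumes x: "0 \<le> x" "x \<le> x'" "(1 + x') * lo < A"
  shows "w n x' \<le> w n x"
proof -
  have "(1 + x) * lo \<le> (1 + x') * lo" using x lo_nonneg by (intro mult_right_mono) auto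
  then have d: "(1 + x) * lo < A" using x by simp
  have "W n x' * S A n x \<le> W n x * S A n x'"
    using x by (intro steps_ratio_antimono[OF lc _ _ _ u_antimono u_meas]) auto
  then have "ennreal (w n x' * (s n x * s n x')) \<le> ennreal (w n x * (s n x * s n x'))"
    using x d s_nonneg w_nonneg by (simp add: W_eq S_eq ennreal_mult' mult_ac)
  then have "w n x' * (s n x * s n x') \<le> w n x * (s n x * s n x')"
    using s_nonneg w_nonneg by (subst (asm) ennreal_le_iff) auto
  moreover have "0 < s n x * s n x'" using x d s_pos by simp
  ultimately show ?thesis by (simp only: mult_le_cancel_right_pos)
qed

lemma W_le: "0 \<le> x \<Longrightarrow> x \<le> y \<Longrightarrow> (1 + y) * lo < A \<Longrightarrow> W n y \<le> ennreal (w n x) * S A n y"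
  using W_eq[of y n] w_antimono[of x y n] by (auto intro!: mult_right_mono ennreal_leI)

lemma W_ge: "0 \<le> y \<Longrightarrow> y \<le> x \<Longrightarrow> (1 + x) * lo < A \<Longrightarrow> ennreal (w n x) * S A n y \<le> W n y"
proof -
  assume x: "0 \<le> y" "y \<le> x" "(1 + x) * lo < A"
  have "(1 + y) * lo \<le> (1 + x) * lo" using x lo_nonneg by (intro mult_right_mono) auto
  then show ?thesis using W_eq[of y n] w_antimono[of y x n] x by (auto intro!: mult_right_mono ennreal_leI)
qed

lemma steps_S: "(step 1 A M ^^ k) (\<lambda>y. a * S A n y) x = a * S A (n + k) x"
  by (subst steps_cmult) (auto simp: surv_add add.commute)

lemma steps_W: "(step 1 A M ^^ k) (W n) x = W (n + k) x"
  by (simp only: add.commute[of n k] funpow_add o_apply)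

lemma w_le_of_bound:
  assumes "W n x \<le> ennreal h * S A n x" "0 \<le> h" "0 \<le> x" "(1 + x) * lo < A"
  shows "w n x \<le> h"
proof -
  have "ennreal (w n x * s n x) \<le> ennreal (h * s n x)"
    using assms w_nonneg s_nonneg by (simp add: W_eq S_eq ennreal_mult)
  then have "w n x * s n x \<le> h * s n x" using assms s_nonneg by (subst (asm) ennreal_le_iff) auto
  then show ?thesis using s_pos assms by simp
qed

lemma W_le_start: "0 < k \<Longrightarrow> 0 \<le> r \<Longrightarrow> W (n + k) r \<le> ennreal (w n 0) * S A (n + k) r"
  unfolding steps_W[symmetric] steps_S[symmetric]
  using below_dom by (intro steps_mono_below W_le) auto

lemma zero_dom: "(1 + 0) * lo < A"
  using below_dom[of 0] A_pos by simp

lemma w_start_decseq: "decseq (\<lambda>n. w n 0)"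
  unfolding decseq_Suc_iff
proof
  fix n
  have "W (n + 1) 0 \<le> ennreal (w n 0) * S A (n + 1) 0"
    by (intro W_le_start) auto
  then have "w (n + 1) 0 \<le> w n 0"
    by (rule w_le_of_bound[OF _ w_nonneg order_refl zero_dom])
  then show "w (Suc n) 0 \<le> w n 0" by simp
qed

lemma w_start_convergent: "\<exists>H\<ge>0. (\<lambda>n. w n 0) \<longlonglongrightarrow> H"
proof -
  have "\<forall>n. 0 \<le> w n 0" by (simp add: w_nonneg)
  from decseq_convergent[OF w_start_decseq this]
  obtain H where "(\<lambda>n. w n 0) \<longlonglongrightarrow> H" .
  then show ?thesis using w_nonneg by (meson LIMSEQ_le_const)
qed

lemma ratio_ennreal:
  assumes "0 \<le> r" "(1 + r) * lo < A"
  shows "W n r / S A n r = ennreal (w n r)"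
proof -
  have "ennreal (w n r) * S A n r / S A n r = ennreal (w n r)"
    using s_pos[OF assms, of n] assms(1)
    by (subst ennreal_mult_divide_eq) (auto simp: S_eq)
  then show ?thesis using W_eq[OF assms] by simp
qed

text \<open>
  A chain started at zero is at least \<open>path lo k 0 \<ge> r\<close> after \<open>k\<close> steps, which sandwiches the mean for \<open>r\<close>
  between the means for zero at times \<open>n + k\<close> and \<open>n\<close>.
\<close>
lemma limit_critical:
  assumes eq: "(1 + A) * lo = A"
  shows "\<exists>H\<ge>0. \<forall>r\<ge>0. (1 + r) * lo < A \<longrightarrow> (\<lambda>n. W n r / S A n r) \<longlonglongrightarrow> ennreal H"
proof -
  obtain H where H: "0 \<le> H" "(\<lambda>n. w n 0) \<longlonglongrightarrow> H" using w_start_convergent by blast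
  have "(\<lambda>n. W n r / S A n r) \<longlonglongrightarrow> ennreal H" if r: "0 \<le> r" "(1 + r) * lo < A" for r
  proof -
    obtain k where k: "0 < k" "r < path lo k 0"
      using critical_path[OF eq A_pos r] by blast
    have low: "w (n + k) 0 \<le> w n r" for n
    proof (rule w_le_of_bound[OF _ w_nonneg _ zero_dom])
      show "W (n + k) 0 \<le> ennreal (w n r) * S A (n + k) 0"
        unfolding steps_W[symmetric] steps_S[symmetric]
        using k r below_dom by (intro steps_mono_above W_le) auto
    qed simp
    have "(\<lambda>n. w n r) \<longlonglongrightarrow> H"
    proof (rule tendsto_sandwich)
      show "(\<lambda>n. w (n + k) 0) \<longlonglongrightarrow> H" using H(2) by (rule LIMSEQ_ignore_initial_segment)
      show "(\<lambda>n. w n 0) \<longlonglongrightarrow> H" by fact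
      show "\<forall>\<^sub>F n in sequentially. w (n + k) 0 \<le> w n r" using low by simp
      show "\<forall>\<^sub>F n in sequentially. w n r \<le> w n 0" using w_antimono[of 0 r] r by simp
    qed
    then show ?thesis using r by (simp add: ratio_ennreal tendsto_ennrealI)
  qed
  then show ?thesis using H by blast
qed

end

locale noncritical_ratio = ratio + noncritical
begin

lemma W_ge_threshold:
  assumes "0 < k" "0 \<le> r"
  shows "ennreal (w n A) * S A (n + k) r \<le> W (n + k) r"
proof -
  have "(step 1 A M ^^ k) (\<lambda>y. ennreal (w n A) * S A n y) r \<le> (step 1 A M ^^ k) (W n) r"
    by (rule steps_mono_below[OF assms], rule W_ge[OF _ _ noncrit]) simp_all
  then show ?thesis by (simp only: steps_S steps_W)
qed

lemma w_ge_of_bound: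
  assumes "ennreal h * S A n x \<le> W n x" "0 \<le> h" "0 \<le> x" "(1 + x) * lo < A"
  shows "h \<le> w n x"
proof -
  have "ennreal (h * s n x) = ennreal h * S A n x"
    using s_nonneg[of n x] assms(2) by (simp only: S_eq[OF assms(3)] ennreal_mult)
  also have "\<dots> \<le> W n x" by (rule assms(1))
  also have "\<dots> = ennreal (w n x * s n x)"
    using s_nonneg[of n x] w_nonneg[of n x]
    by (simp only: W_eq[OF assms(3,4)] S_eq[OF assms(3)] ennreal_mult)
  finally have "ennreal (h * s n x) \<le> ennreal (w n x * s n x)" .
  then have "h * s n x \<le> w n x * s n x"
    using s_nonneg[of n x] w_nonneg[of n x] by (subst (asm) ennreal_le_iff) auto
  then show ?thesis using s_pos[OF assms(3,4), of n] by (simp only: mult_le_cancel_right_pos)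
qed

lemma w_threshold_incseq: "incseq (\<lambda>n. w n A)"
  unfolding incseq_Suc_iff
proof
  fix n
  have "ennreal (w n A) * S A (n + 1) A \<le> W (n + 1) A"
    using A_pos by (intro W_ge_threshold) auto
  then have "w n A \<le> w (n + 1) A"
    using A_pos by (intro w_ge_of_bound[OF _ w_nonneg _ noncrit]) simp_all
  then show "w n A \<le> w (Suc n) A" by simp
qed

text \<open>
  With conditional probability at least \<open>\<delta>\<close> a chain started at zero is above \<open>x0\<close> after \<open>k\<close> steps; the
  probability is bounded below because survival from there is comparable with survival from zero.
  On that event the bound \<open>w n 0\<close> for the mean after \<open>n\<close> further steps improves to \<open>w n x0\<close>.
\<close>
lemma contract_start:
  assumes x0: "0 \<le> x0" "x0 \<le> A" and k: "0 < k" "(step 1 A M ^^ k) (indicator {x0..}) 0 \<noteq> 0"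
  shows "\<exists>\<delta>>0. \<forall>n. \<delta> * (w n 0 - w n x0) \<le> w n 0 - w (n + k) 0"
proof -
  obtain C' where C': "C' < \<top>" "\<And>n. S A n 0 \<le> C' * S A n A" using survival_comparison by blast
  define C where "C = max 1 (enn2real C')"
  have C: "1 \<le> C" "s n 0 \<le> C * s n A" for n
  proof -
    have "S A n 0 \<le> ennreal C * S A n A"
    proof -
      have "C' = ennreal (enn2real C')" using C'(1) by (simp add: less_top)
      then have "C' \<le> ennreal C" by (metis C_def ennreal_leI max.cobounded2)
      then show ?thesis using C'(2)[of n] by (meson mult_right_mono order_trans zero_le)
    qed
    then show "s n 0 \<le> C * s n A" using A_pos s_nonneg
      by (simp add: S_eq C_def flip: ennreal_mult)
  qed (simp add: C_def)
  define P where "P = (step 1 A M ^^ k) (indicator {x0..}) 0"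
  have "P \<le> (step 1 A M ^^ k) (\<lambda>_. 1) 0" unfolding P_def by (intro steps_mono) (auto simp: indicator_def)
  also have "\<dots> \<le> 1" using surv_le_1[of 1 0 A k] by (simp add: surv_def)
  finally have P1: "P \<le> 1" .
  define p where "p = enn2real P"
  have p: "P = ennreal p" "0 < p"
  proof -
    have "P \<noteq> \<top>" using P1 by (auto simp: top_unique)
    moreover have "P \<noteq> 0" using k(2) by (simp only: P_def) simp
    ultimately show "P = ennreal p" "0 < p"
      by (auto simp: p_def less_top enn2real_positive_iff zero_less_iff_neq_zero)
  qed
  have xdom: "(1 + x0) * lo < A"
  proof -
    have "(1 + x0) * lo \<le> (1 + A) * lo" using x0 lo_nonneg by (intro mult_right_mono) auto
    then show ?thesis using noncrit by simp
  qed
  have "p / C * (w n 0 - w n x0) \<le> w n 0 - w (n + k) 0" for n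
  proof -
    have hv: "w n x0 \<le> w n 0" using w_antimono[of 0 x0 n] x0 xdom by simp
    have "W (n + k) 0 + ennreal (w n 0 - w n x0) * S A n A * P
      = (step 1 A M ^^ k) (\<lambda>y. W n y + ennreal (w n 0 - w n x0) * S A n A * indicator {x0..} y) 0"
      unfolding P_def
      by (subst steps_add) (auto simp: steps_cmult steps_W intro!: steps_measurable)
    also have "\<dots> \<le> (step 1 A M ^^ k) (\<lambda>y. ennreal (w n 0) * S A n y) 0"
    proof (rule steps_mono_below[OF k(1)])
      fix y assume y: "0 \<le> y" "y < A"
      show "W n y + ennreal (w n 0 - w n x0) * S A n A * indicator {x0..} y \<le> ennreal (w n 0) * S A n y"
      proof (cases "x0 \<le> y")
        case True
        have "W n y + ennreal (w n 0 - w n x0) * S A n A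
          \<le> ennreal (w n x0) * S A n y + ennreal (w n 0 - w n x0) * S A n y"
          using y True x0 by (intro add_mono mult_left_mono W_le surv_le_start below_dom) auto
        also have "\<dots> = ennreal (w n 0) * S A n y"
          using hv w_nonneg by (simp add: ennreal_plus[symmetric] flip: distrib_right)
        finally show ?thesis using True by simp
      next
        case False
        then show ?thesis using y W_le[of 0 y n] below_dom by simp
      qed
    qed simp
    also have "\<dots> = ennreal (w n 0) * S A (n + k) 0" by (rule steps_S)
    finally have "ennreal (w (n + k) 0 * s (n + k) 0 + (w n 0 - w n x0) * s n A * p) \<le> ennreal (w n 0 * s (n + k) 0)"
      using W_eq[OF _ zero_dom, of "n + k"] hv w_nonneg s_nonneg p A_pos
      by (simp add: S_eq ennreal_mult ennreal_plus)
    then have 1: "w (n + k) 0 * s (n + k) 0 + (w n 0 - w n x0) * s n A * p \<le> w n 0 * s (n + k) 0"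
      using w_nonneg s_nonneg by (subst (asm) ennreal_le_iff) auto
    have "S A (n + k) 0 \<le> S A n 0" by (intro surv_mono_n) auto
    then have "s (n + k) 0 \<le> s n 0" using s_nonneg by (simp add: S_eq)
    then have "s (n + k) 0 / C \<le> s n A" using C(2)[of n] C(1) by (simp add: field_simps)
    then have "(w n 0 - w n x0) * p * (s (n + k) 0 / C) \<le> (w n 0 - w n x0) * p * s n A"
      using hv p by (intro mult_left_mono) auto
    then have "(p / C * (w n 0 - w n x0)) * s (n + k) 0 \<le> (w n 0 - w (n + k) 0) * s (n + k) 0"
      using 1 by (simp add: algebra_simps)
    then show ?thesis using s_pos[OF _ zero_dom, of "n + k"] by (simp only: mult_le_cancel_right_pos order_refl)
  qed
  moreover have "0 < p / C" using p C(1) by simp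
  ultimately show ?thesis by blast
qed

text \<open>
  The mirror image for a chain started at the threshold, which comes below \<open>x0\<close>.
\<close>
lemma contract_threshold:
  assumes x0: "0 \<le> x0" "x0 < A" and b: "b \<noteq> 0" "b \<le> (1::ennreal)"
    "\<forall>u. antimono_on {0..} u \<longrightarrow> b * u x0 \<le> (step 1 A M ^^ k) u A"
  shows "\<exists>\<delta>>0. \<forall>n. \<delta> * (w n x0 - w n A) \<le> w (n + k) A - w n A"
proof -
  have anti: "antimono_on {0..} (indicator {..x0} :: real \<Rightarrow> ennreal)"
    by (auto simp: monotone_on_def indicator_def)
  have k: "0 < k"
  proof (rule ccontr)
    assume "\<not> 0 < k"
    then show False using b(3)[rule_format, OF anti] b(1) x0 by simp
  qed
  define \<beta> where "\<beta> = enn2real b"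
  have \<beta>: "b = ennreal \<beta>" "0 < \<beta>"
  proof -
    have "b \<noteq> \<top>" using b(2) by (auto simp: top_unique)
    then show "b = ennreal \<beta>" "0 < \<beta>"
      using b(1) by (auto simp: \<beta>_def less_top enn2real_positive_iff zero_less_iff_neq_zero)
  qed
  have xdom: "(1 + x0) * lo < A" using x0 by (intro below_dom)
  have "\<beta> * (w n x0 - w n A) \<le> w (n + k) A - w n A" for n
  proof -
    have hv: "w n A \<le> w n x0" using w_antimono[of x0 A n] x0 noncrit by simp
    have "ennreal (w n A) * S A (n + k) A + ennreal (w n x0 - w n A) * S A n A * b
      \<le> ennreal (w n A) * S A (n + k) A + ennreal (w n x0 - w n A) * S A n A * (step 1 A M ^^ k) (indicator {..x0}) A"
      using b(3)[rule_format, OF anti] by (intro add_left_mono mult_left_mono) auto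
    also have "\<dots> = (step 1 A M ^^ k) (\<lambda>y. ennreal (w n A) * S A n y + ennreal (w n x0 - w n A) * S A n A * indicator {..x0} y) A"
      by (subst steps_add) (auto simp: steps_cmult steps_S intro!: steps_measurable)
    also have "\<dots> \<le> (step 1 A M ^^ k) (W n) A"
    proof (rule steps_mono_below[OF k])
      fix y assume y: "0 \<le> y" "y < A"
      show "ennreal (w n A) * S A n y + ennreal (w n x0 - w n A) * S A n A * indicator {..x0} y \<le> W n y"
      proof (cases "y \<le> x0")
        case True
        have "ennreal (w n A) * S A n y + ennreal (w n x0 - w n A) * S A n A
          \<le> ennreal (w n A) * S A n y + ennreal (w n x0 - w n A) * S A n y"
          using y by (intro add_left_mono mult_left_mono surv_le_start) auto
        also have "\<dots> = ennreal (w n x0) * S A n y"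
          using hv w_nonneg by (simp add: ennreal_plus[symmetric] flip: distrib_right)
        also have "\<dots> \<le> W n y" using y True xdom by (intro W_ge) auto
        finally show ?thesis using True by simp
      next
        case False
        then show ?thesis using y W_ge[of y A n] noncrit by simp
      qed
    qed (use A_pos in simp)
    also have "\<dots> = W (n + k) A" by (rule steps_W)
    finally have "ennreal (w n A * s (n + k) A + (w n x0 - w n A) * s n A * \<beta>) \<le> ennreal (w (n + k) A * s (n + k) A)"
      using W_eq[OF _ noncrit, of "n + k"] hv w_nonneg s_nonneg \<beta> A_pos
      by (simp add: S_eq ennreal_mult ennreal_plus)
    then have 1: "w n A * s (n + k) A + (w n x0 - w n A) * s n A * \<beta> \<le> w (n + k) A * s (n + k) A"
      using w_nonneg s_nonneg by (subst (asm) ennreal_le_iff) auto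
    have "S A (n + k) A \<le> S A n A" using A_pos by (intro surv_mono_n) auto
    then have "s (n + k) A \<le> s n A" using s_nonneg A_pos by (simp add: S_eq)
    then have "(w n x0 - w n A) * \<beta> * s (n + k) A \<le> (w n x0 - w n A) * \<beta> * s n A"
      using hv \<beta> by (intro mult_left_mono) auto
    then have "(\<beta> * (w n x0 - w n A)) * s (n + k) A \<le> (w (n + k) A - w n A) * s (n + k) A"
      using 1 by (simp add: algebra_simps)
    then show ?thesis
      using s_pos[OF less_imp_le[OF A_pos] noncrit, of "n + k"] by (simp only: mult_le_cancel_right_pos)
  qed
  then show ?thesis using \<beta> by blast
qed

text \<open>
  Both extreme means are monotone in time and converge, so the increments that bound their distances
  to \<open>w n x0\<close> tend to zero.
\<close>
lemma extreme_means_converge_together: "\<exists>H\<ge>0. (\<lambda>n. w n 0) \<longlonglongrightarrow> H \<and> (\<lambda>n. w n A) \<longlonglongrightarrow> H"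
proof -
  obtain e0 d x0 m where c: "lo < e0" "e0 < 1" "cdf_less e0 \<noteq> 1" "(1 + d) * e0 = d" "d < A"
    "fixpt < x0" "x0 < d" "x0 < (1 + path lo m 0) * e0" by (rule exists_levels)
  have x0: "0 \<le> x0" "x0 < A" using c fixpt by auto
  obtain H where H: "0 \<le> H" "(\<lambda>n. w n 0) \<longlonglongrightarrow> H" using w_start_convergent by blast
  have dA: "w n A \<le> w n 0" for n using w_antimono[of 0 A n] noncrit A_pos by simp
  have "\<forall>n. w n A \<le> w 0 0"
  proof
    fix n
    show "w n A \<le> w 0 0"
      using dA[of n] decseqD[OF w_start_decseq, of 0 n] by simp
  qed
  from incseq_convergent[OF w_threshold_incseq this]
  obtain L where L: "(\<lambda>n. w n A) \<longlonglongrightarrow> L" .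
  obtain \<delta> where \<delta>: "0 < \<delta>" "\<And>n. \<delta> * (w n 0 - w n x0) \<le> w n 0 - w (n + Suc m) 0"
    using contract_start[OF x0(1) less_imp_le[OF x0(2)] _ ascend[OF c(1-5,8)]] by blast
  obtain k b where b: "b \<noteq> 0" "b \<le> 1" "\<forall>u. antimono_on {0..} u \<longrightarrow> b * u x0 \<le> (step 1 A M ^^ k) u A"
    using descend[OF c(6)] by blast
  obtain \<epsilon> where \<epsilon>: "0 < \<epsilon>" "\<And>n. \<epsilon> * (w n x0 - w n A) \<le> w (n + k) A - w n A"
    using contract_threshold[OF x0 b] by blast
  have "w n 0 - w n A \<le> (w n 0 - w (n + Suc m) 0) / \<delta> + (w (n + k) A - w n A) / \<epsilon>" for n
  proof -
    have "w n 0 - w n x0 \<le> (w n 0 - w (n + Suc m) 0) / \<delta>" using \<delta> by (simp add: pos_le_divide_eq mult.commute)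
    moreover have "w n x0 - w n A \<le> (w (n + k) A - w n A) / \<epsilon>" using \<epsilon> by (simp add: pos_le_divide_eq mult.commute)
    ultimately show ?thesis by linarith
  qed
  moreover have "(\<lambda>n. (w n 0 - w (n + Suc m) 0) / \<delta> + (w (n + k) A - w n A) / \<epsilon>) \<longlonglongrightarrow> (H - H) / \<delta> + (L - L) / \<epsilon>"
    using \<delta>(1) \<epsilon>(1) by (intro tendsto_intros H L LIMSEQ_ignore_initial_segment) auto
  moreover have "(\<lambda>n. w n 0 - w n A) \<longlonglongrightarrow> H - L" by (intro tendsto_intros H L)
  ultimately have "H - L \<le> (H - H) / \<delta> + (L - L) / \<epsilon>" by (intro LIMSEQ_le) auto
  moreover have "L \<le> H" using L H dA by (intro LIMSEQ_le) auto
  ultimately have "L = H" by simp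
  then show ?thesis using H L by blast
qed

text \<open>
  After one step every surviving chain is below the threshold, whatever its starting value, which makes
  the convergence uniform.
\<close>
lemma limit_uniform:
  "\<exists>H\<ge>0. \<forall>e>0. \<forall>\<^sub>F n in sequentially. \<forall>r\<ge>0.
     ennreal (H - e) * S A n r \<le> W n r \<and> W n r \<le> ennreal (H + e) * S A n r"
proof -
  obtain H where H: "0 \<le> H" "(\<lambda>n. w n 0) \<longlonglongrightarrow> H" "(\<lambda>n. w n A) \<longlonglongrightarrow> H" using extreme_means_converge_together by blast
  show ?thesis
  proof (intro exI[of _ H] conjI allI impI H(1))
    fix e :: real assume e: "0 < e"
    have "\<forall>\<^sub>F n in sequentially. w n 0 < H + e" "\<forall>\<^sub>F n in sequentially. H - e < w n A"
      using order_tendstoD(2)[OF H(2), of "H + e"] order_tendstoD(1)[OF H(3), of "H - e"] e by auto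
    then have "\<forall>\<^sub>F n in sequentially. \<forall>r\<ge>0.
       ennreal (H - e) * S A (n + 1) r \<le> W (n + 1) r \<and> W (n + 1) r \<le> ennreal (H + e) * S A (n + 1) r"
    proof eventually_elim
      fix n assume a: "w n 0 < H + e" "H - e < w n A"
      show "\<forall>r\<ge>0. ennreal (H - e) * S A (n + 1) r \<le> W (n + 1) r \<and> W (n + 1) r \<le> ennreal (H + e) * S A (n + 1) r"
      proof (intro allI impI conjI)
        fix r :: real assume r: "0 \<le> r"
        have "ennreal (H - e) * S A (n + 1) r \<le> ennreal (w n A) * S A (n + 1) r"
          using a by (intro mult_right_mono ennreal_leI) auto
        also have "\<dots> \<le> W (n + 1) r" using r by (intro W_ge_threshold) auto
        finally show "ennreal (H - e) * S A (n + 1) r \<le> W (n + 1) r" .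
        have "W (n + 1) r \<le> ennreal (w n 0) * S A (n + 1) r" using r by (intro W_le_start) auto
        also have "\<dots> \<le> ennreal (H + e) * S A (n + 1) r"
          using a by (intro mult_right_mono ennreal_leI) auto
        finally show "W (n + 1) r \<le> ennreal (H + e) * S A (n + 1) r" .
      qed
    qed
    then show "\<forall>\<^sub>F n in sequentially. \<forall>r\<ge>0.
       ennreal (H - e) * S A n r \<le> W n r \<and> W n r \<le> ennreal (H + e) * S A n r"
      using eventually_sequentially_seg[of "\<lambda>n. \<forall>r\<ge>0.
       ennreal (H - e) * S A n r \<le> W n r \<and> W n r \<le> ennreal (H + e) * S A n r" 1] by blast
  qed
qed

end

section \<open>Strict monotonicity\<close>
lemma nn_integral_eq_imp_AE:
  fixes f g :: "'a \<Rightarrow> ennreal"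
  assumes [measurable]: "f \<in> borel_measurable m" "g \<in> borel_measurable m"
    and le: "AE x in m. f x \<le> g x" and eq: "(\<integral>\<^sup>+x. f x \<partial>m) = (\<integral>\<^sup>+x. g x \<partial>m)" and fin: "(\<integral>\<^sup>+x. g x \<partial>m) < \<top>"
  shows "AE x in m. f x = g x"
proof -
  have "(\<integral>\<^sup>+x. g x - f x \<partial>m) = (\<integral>\<^sup>+x. g x \<partial>m) - (\<integral>\<^sup>+x. f x \<partial>m)"
    using fin eq le by (intro nn_integral_diff) auto
  also have "\<dots> = 0" using eq by (simp add: diff_eq_0_iff_ennreal fin)
  finally have "AE x in m. g x - f x = 0" by (subst (asm) nn_integral_0_iff_AE) auto
  then show ?thesis using le
    by eventually_elim (auto simp: diff_eq_0_iff_ennreal intro: antisym)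
qed

context pos_subprob
begin

text \<open>
  A factor \<open>l \<ge> 1\<close> raises the state by at least one. Hence about \<open>A\<close> such factors in a row stop the chain.
\<close>
lemma surv_geometric:
  assumes q: "emeasure M {..<1} = ennreal q" "0 \<le> q" "q < 1"
  shows "0 \<le> x \<Longrightarrow> A \<le> x + real (Suc k) \<Longrightarrow> surv 1 A M (Suc k) x \<le> ennreal (1 - (1 - q) ^ Suc k)"
proof (induction k arbitrary: x)
  case 0
  have "surv 1 A M (Suc 0) x \<le> (\<integral>\<^sup>+l. indicator {..<1} l \<partial>M)"
    unfolding surv_Suc step_def
  proof (rule nn_integral_mono)
    fix l
    have "A \<le> (1 + x) * l" if "1 \<le> l"
    proof -
      have "(1 + x) * 1 \<le> (1 + x) * l" using 0 that by (intro mult_left_mono) auto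
      moreover have "A \<le> (1 + x) * 1" using 0 by simp
      ultimately show ?thesis by (rule order_trans[rotated])
    qed
    then show "surv 1 A M 0 ((1 + x) * l) * indicator {..<A} ((1 + x) * l) \<le> indicator {..<1} l"
      by (cases "1 \<le> l") (auto simp: indicator_def)
  qed
  then show ?case using q by (simp add: sets_M)
next
  case (Suc k)
  define a where "a = 1 - (1 - q) ^ Suc k"
  have a: "0 \<le> a" using q by (simp add: a_def power_le_one del: power_Suc)
  have rest: "emeasure M {1..} \<le> ennreal (1 - q)"
  proof -
    have "{..<1} \<union> {1::real..} = UNIV" by auto
    then have "emeasure M {..<1} + emeasure M {1..} = emeasure M UNIV"
      by (subst plus_emeasure) (auto simp: sets_M)
    then have le: "ennreal q + emeasure M {1..} \<le> 1" using total_le_1 q by simp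
    then obtain p where p: "emeasure M {1..} = ennreal p" "0 \<le> p"
      by (cases "emeasure M {1..}") (auto simp: top_unique)
    then show ?thesis using le q by (simp flip: ennreal_plus)
  qed
  have "surv 1 A M (Suc (Suc k)) x \<le> (\<integral>\<^sup>+l. indicator {..<1} l + ennreal a * indicator {1..} l \<partial>M)"
    unfolding surv_Suc[of _ _ "Suc k"] step_def
  proof (rule nn_integral_mono_AE, use pos in \<open>rule eventually_mono\<close>)
    fix l :: real assume l: "0 < l"
    have nn: "0 \<le> (1 + x) * l" using l Suc.prems by simp
    show "surv 1 A M (Suc k) ((1 + x) * l) * indicator {..<A} ((1 + x) * l)
        \<le> indicator {..<1} l + ennreal a * indicator {1..} l"
    proof (cases "l < 1")
      case True
      then show ?thesis using surv_le_1[of 1 "(1 + x) * l" A "Suc k"] nn by (auto simp: indicator_def)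
    next
      case False
      then have le: "(1 + x) * 1 \<le> (1 + x) * l" using Suc.prems by (intro mult_left_mono) auto
      have "A \<le> (1 + x) * 1 + real (Suc k)" using Suc.prems by simp
      then have "A \<le> (1 + x) * l + real (Suc k)" by (rule order_trans[OF _ add_right_mono[OF le]])
      then have "surv 1 A M (Suc k) ((1 + x) * l) \<le> ennreal a"
        unfolding a_def using nn by (intro Suc.IH) auto
      then show ?thesis using False by (auto simp: indicator_def)
    qed
  qed
  also have "\<dots> = ennreal q + ennreal a * emeasure M {1..}"
    by (subst nn_integral_add) (auto simp: sets_M nn_integral_cmult_indicator q(1))
  also have "\<dots> \<le> ennreal q + ennreal a * ennreal (1 - q)"
    using rest by (intro add_left_mono mult_left_mono) auto
  also have "\<dots> = ennreal (q + a * (1 - q))"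
    using q a by (simp add: ennreal_plus ennreal_mult)
  also have "q + a * (1 - q) = 1 - (1 - q) ^ Suc (Suc k)"
    by (simp add: a_def algebra_simps)
  finally show ?case .
qed

text \<open>
  Survival probabilities from zero lose a fixed fraction every \<open>m\<close> steps, so their partial sums
  satisfy \<open>s \<le> m + (1 - \<delta>) * s\<close>.
\<close>
lemma mean_time_finite:
  assumes q: "emeasure M {..<1} < 1" and x: "0 \<le> x"
  shows "mean_time 1 A M x < \<top>"
proof -
  define p where "p = enn2real (emeasure M {..<1})"
  have p: "emeasure M {..<1} = ennreal p" "0 \<le> p" "p < 1"
  proof -
    have "emeasure M {..<1} < \<top>" using q by (rule less_trans) simp
    then show e: "emeasure M {..<1} = ennreal p" by (simp add: p_def less_top)
    show "0 \<le> p" by (simp add: p_def)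
    then show "p < 1" using q e by (simp add: ennreal_less_iff flip: ennreal_1)
  qed
  obtain k where k: "A \<le> real k" using real_arch_simple by blast
  define m where "m = Suc k"
  define \<delta> where "\<delta> = (1 - p) ^ m"
  have \<delta>: "0 < \<delta>" "\<delta> \<le> 1" using p by (auto simp: \<delta>_def power_le_one)
  have m: "surv 1 A M m y \<le> ennreal (1 - \<delta>)" if "0 \<le> y" for y
    unfolding m_def \<delta>_def using that k p by (intro surv_geometric) auto
  define t where "t i = enn2real (surv 1 A M i 0)" for i
  have t: "surv 1 A M i 0 = ennreal (t i)" "0 \<le> t i" "t i \<le> 1" for i
  proof -
    show e: "surv 1 A M i 0 = ennreal (t i)" using surv_fin[of 1 0 A i] by (simp add: t_def less_top)
    show "0 \<le> t i" by (simp add: t_def)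
    then show "t i \<le> 1" using surv_le_1[of 1 0 A i] e by simp
  qed
  have decay: "t (m + i) \<le> (1 - \<delta>) * t i" for i
  proof -
    have "surv 1 A M (m + i) 0 = (step 1 A M ^^ m) (surv 1 A M i) 0" by (simp add: surv_add)
    also have "\<dots> \<le> (step 1 A M ^^ m) (\<lambda>_. surv 1 A M i 0 * 1) 0"
      by (intro steps_mono) (auto intro: surv_le_start)
    also have "\<dots> = surv 1 A M i 0 * surv 1 A M m 0" unfolding surv_def[of _ _ _ m] by (rule steps_cmult) simp
    also have "\<dots> \<le> surv 1 A M i 0 * ennreal (1 - \<delta>)" using m by (intro mult_left_mono) auto
    finally have "ennreal (t (m + i)) \<le> ennreal (t i * (1 - \<delta>))"
      using t \<delta> by (simp add: ennreal_mult)
    then show ?thesis using t \<delta> by (simp add: mult.commute)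
  qed
  have bound: "(\<Sum>i<n. t i) \<le> real m / \<delta>" for n
  proof -
    have "(\<Sum>i<n. t i) \<le> (\<Sum>i<m + n. t i)" using t by (intro sum_mono2) auto
    also have "\<dots> = (\<Sum>i<m. t i) + (\<Sum>i<n. t (m + i))"
      by (induction n) auto
    also have "\<dots> \<le> real m * 1 + (\<Sum>i<n. (1 - \<delta>) * t i)"
    proof (intro add_mono sum_mono decay)
      show "(\<Sum>i<m. t i) \<le> real m * 1" using sum_bounded_above[of "{..<m}" t 1] t by simp
    qed
    also have "\<dots> = real m + (1 - \<delta>) * (\<Sum>i<n. t i)" by (simp add: sum_distrib_left)
    finally have "\<delta> * (\<Sum>i<n. t i) \<le> real m" by (simp add: algebra_simps)
    then show ?thesis using \<delta> by (simp add: pos_le_divide_eq mult.commute)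
  qed
  have "mean_time 1 A M 0 \<le> ennreal (real m / \<delta>)"
    unfolding mean_time_def suminf_eq_SUP
  proof (rule SUP_least)
    fix n
    have "(\<Sum>i<n. surv 1 A M i 0) = ennreal (\<Sum>i<n. t i)" using t by simp
    also have "\<dots> \<le> ennreal (real m / \<delta>)" using bound by (rule ennreal_leI)
    finally show "(\<Sum>i<n. surv 1 A M i 0) \<le> ennreal (real m / \<delta>)" .
  qed
  also have "\<dots> < \<top>" by simp
  finally have "mean_time 1 A M 0 < \<top>" .
  then show ?thesis using mean_time_le[of 1 1 0 x A] x by (auto intro: le_less_trans)
qed

end

context lr_law
begin

text \<open>
  Suppose the chain that is ahead has the same mean stopping time as the one behind. Then almost surely
  no factor stops the one but not the other. The factors that would do so form an interval, which is
  not below the essential infimum and must therefore lie beyond the essential supremum: the chain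
  that is ahead is not stopped at all in this step. After the step the two chains are again in the
  same situation, so it is never stopped. The conclusion is stated for the law \<open>M\<close> while the means are
  taken under \<open>N\<close>, since under the latter the chain may be stopped by an infinite likelihood ratio.
\<close>
lemma mean_time_equal_imp_infinite:
  assumes N: "pos_subprob N" and null: "\<And>B. B \<in> sets borel \<Longrightarrow> emeasure N B = 0 \<Longrightarrow> emeasure M B = 0"
    and A: "0 < A" "(1 + A) * lo \<le> A" and c: "0 < c" "c \<le> c'" "c' \<le> 1"
  shows "0 \<le> x \<Longrightarrow> 0 \<le> x' \<Longrightarrow> c + x < c' + x' \<Longrightarrow> (c + x) * lo < A \<Longrightarrow> mean_time c A N x < \<top> \<Longrightarrow>
    mean_time c' A N x' = mean_time c A N x \<Longrightarrow> of_nat j \<le> mean_time c' A M x'"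
proof (induction j arbitrary: x x')
  case (Suc j)
  interpret N: pos_subprob N by fact
  note [measurable_cong] = N.sets_M
  define f where "f l = mean_time c' A N ((c' + x') * l) * indicator {..<A} ((c' + x') * l)" for l
  define g where "g l = mean_time c A N ((c + x) * l) * indicator {..<A} ((c + x) * l)" for l
  have [measurable]: "f \<in> borel_measurable borel" "g \<in> borel_measurable borel"
    unfolding f_def g_def by measurable
  have mf: "f \<in> borel_measurable N" "g \<in> borel_measurable N" by measurable
  have f: "mean_time c' A N x' = 1 + (\<integral>\<^sup>+l. f l \<partial>N)" and g: "mean_time c A N x = 1 + (\<integral>\<^sup>+l. g l \<partial>N)"
    using N.mean_time_rec[of c' A x'] N.mean_time_rec[of c A x] by (auto simp: step_def f_def g_def)
  have gfin: "(\<integral>\<^sup>+l. g l \<partial>N) < \<top>" using g Suc.prems by simp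
  have fg: "(\<integral>\<^sup>+l. f l \<partial>N) = (\<integral>\<^sup>+l. g l \<partial>N)"
    using f g Suc.prems by (simp add: ennreal_add_left_cancel)
  have le: "AE l in N. f l \<le> g l"
    using N.pos
  proof eventually_elim
    fix l :: real assume l: "0 < l"
    have y: "0 \<le> (c + x) * l" "(c + x) * l \<le> (c' + x') * l"
      using l Suc.prems c by (auto intro!: mult_right_mono)
    then have "mean_time c' A N ((c' + x') * l) \<le> mean_time c A N ((c + x) * l)"
      using c by (intro N.mean_time_le) auto
    then show "f l \<le> g l" using y by (auto simp: f_def g_def indicator_def)
  qed
  have "AE l in N. f l = g l" by (rule nn_integral_eq_imp_AE[OF mf le fg gfin])
  moreover have "AE l in N. g l \<noteq> \<top>"
    using nn_integral_noteq_infinite[OF mf(2)] gfin by simp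
  ultimately have "AE l in N. f l = g l \<and> g l \<noteq> \<top>" by eventually_elim auto
  then have "emeasure N {l \<in> space N. \<not> (f l = g l \<and> g l \<noteq> \<top>)} = 0"
    by (subst (asm) AE_iff_measurable[OF _ refl]) auto
  then have "emeasure M {l. \<not> (f l = g l \<and> g l \<noteq> \<top>)} = 0"
    by (intro null) (auto simp: N.space_M)
  then have eqM: "AE l in M. f l = g l \<and> g l \<noteq> \<top>"
    by (intro AE_I[of _ _ "{l. \<not> (f l = g l \<and> g l \<noteq> \<top>)}"]) auto
  have ge1: "1 \<le> mean_time c A N y" for y using N.mean_time_rec[of c A y] by simp
  have cx: "0 < c + x" "0 < c' + x'" using Suc.prems c by auto
  have "AE l in M. l \<notin> {A / (c' + x')..<A / (c + x)}"
    using eqM pos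
  proof eventually_elim
    fix l assume l: "f l = g l \<and> g l \<noteq> \<top>" "0 < l"
    show "l \<notin> {A / (c' + x')..<A / (c + x)}"
    proof
      assume "l \<in> {A / (c' + x')..<A / (c + x)}"
      then have "A \<le> (c' + x') * l" "(c + x) * l < A" using cx by (auto simp: field_simps)
      then have "f l = 0" "1 \<le> g l" using ge1 by (auto simp: f_def g_def)
      then show False using l by auto
    qed
  qed
  then have "emeasure M {A / (c' + x')..<A / (c + x)} = 0"
    by (subst (asm) AE_iff_measurable[where N = "{A / (c' + x')..<A / (c + x)}"])
      (simp_all add: space_M sets_M set_eq_iff)
  then have "cdf_less (A / (c + x)) = 0 \<or> cdf_less (A / (c' + x')) = 1"
    using Suc.prems cx A by (intro null_interval) (auto simp: divide_strict_left_mono)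
  moreover have "cdf_less (A / (c + x)) \<noteq> 0"
    using Suc.prems cx by (intro cdf_less_pos) (simp add: field_simps)
  ultimately have c1: "cdf_less (A / (c' + x')) = 1" by simp
  have "AE l in M. l < A / (c' + x')"
  proof -
    have "emeasure M (UNIV - {..<A / (c' + x')}) = 0"
      using c1 emeasure_compl[of "{..<A / (c' + x')}" M] by (simp add: cdf_less_def sets_M space_M total_1)
    then show ?thesis by (intro AE_I[of _ _ "UNIV - {..<A / (c' + x')}"]) (auto simp: sets_M)
  qed
  with eqM pos have "AE l in M. of_nat j \<le> mean_time c' A M ((c' + x') * l) * indicator {..<A} ((c' + x') * l)"
  proof eventually_elim
    fix l assume l: "f l = g l \<and> g l \<noteq> \<top>" "0 < l" "l < A / (c' + x')"
    have y': "(c' + x') * l < A" using l cx by (simp add: field_simps)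
    have yy': "(c + x) * l < (c' + x') * l" using l Suc.prems by (intro mult_strict_right_mono) auto
    have y: "0 \<le> (c + x) * l" "(c + x) * l < A"
      using l cx less_trans[OF yy' y'] by auto
    have "(c + (c + x) * l) * lo \<le> (1 + (c + x) * l) * lo" using c lo_nonneg by (intro mult_right_mono) auto
    also have "\<dots> < A" using y by (intro next_lt_threshold A)
    finally have dom: "(c + (c + x) * l) * lo < A" .
    have z: "0 \<le> (c' + x') * l" "c + (c + x) * l < c' + (c' + x') * l"
      by (rule order_trans[OF y(1) less_imp_le[OF yy']]) (rule add_le_less_mono[OF c(2) yy'])
    have "of_nat j \<le> mean_time c' A M ((c' + x') * l)"
      using l y y' z dom c by (intro Suc.IH[of "(c + x) * l"]) (auto simp: f_def g_def less_top)
    then show "of_nat j \<le> mean_time c' A M ((c' + x') * l) * indicator {..<A} ((c' + x') * l)"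
      using y' by simp
  qed
  then have "(\<integral>\<^sup>+l. of_nat j \<partial>M) \<le> step c' A M (mean_time c' A M) x'"
    unfolding step_def by (rule nn_integral_mono_AE)
  then have "of_nat j \<le> step c' A M (mean_time c' A M) x'" by (simp add: space_M total_1)
  then show ?case using mean_time_rec[of c' A x'] by (simp add: add_left_mono)
qed simp

lemma mean_time_strict:
  assumes N: "pos_subprob N" and null: "\<And>B. B \<in> sets borel \<Longrightarrow> emeasure N B = 0 \<Longrightarrow> emeasure M B = 0"
    and A: "0 < A" "(1 + A) * lo \<le> A" and c: "0 < c" "c \<le> c'" "c' \<le> 1"
    and x: "0 \<le> x" "0 \<le> x'" "c + x < c' + x'" "(c + x) * lo < A"
    and fin: "mean_time c A N x < \<top>" "mean_time c' A M x' < \<top>"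
  shows "mean_time c' A N x' < mean_time c A N x"
proof -
  interpret N: pos_subprob N by fact
  have "mean_time c' A N x' \<noteq> mean_time c A N x"
  proof
    assume eq: "mean_time c' A N x' = mean_time c A N x"
    have "of_nat j \<le> mean_time c' A M x'" for j
      using mean_time_equal_imp_infinite[OF N null A c x fin(1) eq] .
    moreover obtain r where "mean_time c' A M x' = ennreal r" "0 \<le> r"
      using fin(2) by (cases "mean_time c' A M x'") auto
    ultimately have "real j \<le> r" for j by (simp flip: ennreal_of_nat_eq_real_of_nat)
    then show False using reals_Archimedean2[of r] by (meson linorder_not_less)
  qed
  moreover have "mean_time c' A N x' \<le> mean_time c A N x"
    using x c by (intro N.mean_time_le) auto
  ultimately show ?thesis by simp
qed

text \<open>
  The gap between the means for drift \<open>\<kappa>\<close> and drift \<open>1\<close> is bounded below. On an interval of length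
  \<open>\<eta> < 1 - \<kappa>\<close> it is at least the mean for drift \<open>\<kappa>\<close> at the right end minus the mean for drift \<open>1\<close> at the left
  end, which is positive because the chain with drift \<open>1\<close> is still ahead; finitely many such intervals
  cover the range of the state.
\<close>
lemma uniform_gap:
  assumes N: "pos_subprob N" and null: "\<And>B. B \<in> sets borel \<Longrightarrow> emeasure N B = 0 \<Longrightarrow> emeasure M B = 0"
    and A: "0 < A" "(1 + A) * lo \<le> A" and \<kappa>: "0 < \<kappa>" "\<kappa> < 1"
    and fin: "mean_time \<kappa> A N 0 < \<top>" "mean_time 1 A M 0 < \<top>"
  shows "\<exists>\<delta>>0. \<forall>x. 0 \<le> x \<longrightarrow> x \<le> A \<longrightarrow> mean_time 1 A N x + ennreal \<delta> \<le> mean_time \<kappa> A N x"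
proof -
  interpret N: pos_subprob N by fact
  define \<eta> where "\<eta> = (1 - \<kappa>) / 2"
  have \<eta>: "0 < \<eta>" "2 * \<eta> = 1 - \<kappa>" using \<kappa> by (auto simp: \<eta>_def)
  have fin_\<kappa>: "mean_time \<kappa> A N x < \<top>" if "0 \<le> x" for x
    using fin(1) N.mean_time_le[of \<kappa> \<kappa> 0 x A] that \<kappa> by (auto intro: le_less_trans)
  have fin_1: "mean_time 1 A N x < \<top>" if "0 \<le> x" for x
    using fin_\<kappa>[OF that] N.mean_time_le[of \<kappa> 1 x x A] that \<kappa> by (auto intro: le_less_trans)
  have fin_M: "mean_time 1 A M x < \<top>" if "0 \<le> x" for x
    using fin(2) mean_time_le[of 1 1 0 x A] that by (auto intro: le_less_trans)
  define g where "g i = enn2real (mean_time \<kappa> A N ((real i + 1) * \<eta>)) - enn2real (mean_time 1 A N (real i * \<eta>))" for i :: nat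
  define I where "I = {i. real i * \<eta> \<le> A}"
  have "I \<subseteq> {..nat \<lceil>A / \<eta>\<rceil>}"
  proof
    fix i assume "i \<in> I"
    then have "real i \<le> A / \<eta>" using \<eta> by (simp add: I_def pos_le_divide_eq)
    then show "i \<in> {..nat \<lceil>A / \<eta>\<rceil>}" by (simp add: le_nat_iff) linarith
  qed
  then have finI: "finite I" by (rule finite_subset) simp
  have neI: "I \<noteq> {}" using A by (auto simp: I_def intro: exI[of _ 0])
  have g_pos: "0 < g i" if "i \<in> I" for i
  proof -
    have z: "0 \<le> real i * \<eta>" "0 \<le> (real i + 1) * \<eta>" using \<eta> by auto
    have lt: "\<kappa> + (real i + 1) * \<eta> < 1 + real i * \<eta>" using \<eta> by (simp add: algebra_simps)
    also have "\<dots> \<le> 1 + A" using that by (simp add: I_def)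
    finally have "(\<kappa> + (real i + 1) * \<eta>) * lo < A"
    proof (cases "lo = 0")
      case False
      assume "\<kappa> + (real i + 1) * \<eta> < 1 + A"
      then have "(\<kappa> + (real i + 1) * \<eta>) * lo < (1 + A) * lo"
        using False lo_nonneg by (intro mult_strict_right_mono) auto
      then show ?thesis using A by simp
    qed (use A in simp)
    then have "mean_time 1 A N (real i * \<eta>) < mean_time \<kappa> A N ((real i + 1) * \<eta>)"
      using \<kappa> z lt by (intro mean_time_strict[OF N null A]) (auto intro: fin_\<kappa> fin_M)
    then have "ennreal (enn2real (mean_time 1 A N (real i * \<eta>))) < ennreal (enn2real (mean_time \<kappa> A N ((real i + 1) * \<eta>)))"
      using fin_\<kappa>[OF z(2)] fin_1[OF z(1)] by (simp add: less_top)
    then show ?thesis by (simp add: g_def ennreal_less_iff)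
  qed
  define \<delta> where "\<delta> = Min (g ` I)"
  have "0 < \<delta>" using finI neI g_pos by (simp add: \<delta>_def)
  moreover have "mean_time 1 A N x + ennreal \<delta> \<le> mean_time \<kappa> A N x" if x: "0 \<le> x" "x \<le> A" for x
  proof -
    define i where "i = nat \<lfloor>x / \<eta>\<rfloor>"
    have "real i \<le> x / \<eta>" "x / \<eta> \<le> real i + 1"
      using x \<eta> by (auto simp: i_def)
    then have i: "real i * \<eta> \<le> x" "x \<le> (real i + 1) * \<eta>"
      using \<eta> by (auto simp: field_simps)
    have z: "0 \<le> real i * \<eta>" "0 \<le> (real i + 1) * \<eta>" using \<eta> by auto
    have "i \<in> I" using i x by (simp add: I_def)
    then have "\<delta> \<le> g i" using finI by (simp add: \<delta>_def)
    have "mean_time 1 A N x + ennreal \<delta> \<le> mean_time 1 A N (real i * \<eta>) + ennreal (g i)"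
      using i z \<open>\<delta> \<le> g i\<close> by (intro add_mono N.mean_time_le ennreal_leI) auto
    also have "\<dots> = ennreal (enn2real (mean_time 1 A N (real i * \<eta>)) + g i)"
      using fin_1[OF z(1)] g_pos[OF \<open>i \<in> I\<close>] by (simp add: ennreal_plus less_top)
    also have "\<dots> = mean_time \<kappa> A N ((real i + 1) * \<eta>)"
      using fin_\<kappa>[OF z(2)] by (simp add: g_def less_top)
    also have "\<dots> \<le> mean_time \<kappa> A N x"
      using i x \<kappa> by (intro N.mean_time_le) auto
    finally show ?thesis .
  qed
  ultimately show ?thesis by blast
qed

text \<open>
  The asymptotic delay increases strictly with the threshold. After rescaling, the larger threshold \<open>A'\<close>
  becomes the threshold \<open>A\<close> with drift \<open>\<kappa> = A / A'\<close>. The smaller drift makes the surviving state smaller,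
  and it prolongs the mean delay from each state by at least \<open>\<delta>\<close>.
\<close>
lemma limit_strict_mono:
  assumes N: "pos_subprob N" and null: "\<And>B. B \<in> sets borel \<Longrightarrow> emeasure N B = 0 \<Longrightarrow> emeasure M B = 0"
    and N1: "emeasure N {..<1} < 1"
    and A: "0 < A" "(1 + A) * lo \<le> A" "A < A'"
    and fin: "mean_time 1 A M 0 < \<top>"
    and H: "(\<lambda>n. (step 1 A M ^^ n) (mean_time 1 A N) 0 / S A n 0) \<longlonglongrightarrow> ennreal H"
    and H': "(\<lambda>n. (step 1 A' M ^^ n) (mean_time 1 A' N) 0 / S A' n 0) \<longlonglongrightarrow> ennreal H'"
    and nonneg: "0 \<le> H" "0 \<le> H'"
  shows "H < H'"
proof -
  interpret N: pos_subprob N by fact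
  define \<kappa> where "\<kappa> = A / A'"
  have \<kappa>: "0 < \<kappa>" "\<kappa> < 1" "\<kappa> * A' = A" using A by (auto simp: \<kappa>_def)
  have scale: "mean_time \<kappa> A N (\<kappa> * y) = mean_time 1 A' N y" for y
    using N.mean_time_scale[OF \<kappa>(1), of A' y] \<kappa> by simp
  have Spos: "S A n 0 \<noteq> 0" for n
    using next_lt_threshold[OF A(2,1), of 0] A by (intro surv_pos) auto
  have fin_\<kappa>: "mean_time \<kappa> A N 0 < \<top>" using scale[of 0] N.mean_time_finite[OF N1, of 0 A'] by simp
  obtain \<delta> where \<delta>: "0 < \<delta>" "\<And>x. 0 \<le> x \<Longrightarrow> x \<le> A \<Longrightarrow> mean_time 1 A N x + ennreal \<delta> \<le> mean_time \<kappa> A N x"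
    using uniform_gap[OF N null A(1,2) \<kappa>(1,2) fin_\<kappa> fin] by blast
  have S_fin: "surv c A M n 0 \<noteq> \<top>" if "0 < c" for c n using surv_fin[OF that, of 0 A n] by simp
  have "(step 1 A M ^^ n) (mean_time 1 A N) 0 / S A n 0 + ennreal \<delta>
      \<le> (step 1 A' M ^^ n) (mean_time 1 A' N) 0 / S A' n 0" for n
  proof -
    have "((step 1 A M ^^ n) (mean_time 1 A N) 0 / S A n 0 + ennreal \<delta>) * S A n 0
      = (step 1 A M ^^ n) (mean_time 1 A N) 0 + ennreal \<delta> * S A n 0"
      using Spos[of n] S_fin[of 1 n] by (simp add: distrib_right ennreal_divide_times ennreal_mult_divide_eq)
    also have "\<dots> = (step 1 A M ^^ n) (\<lambda>y. mean_time 1 A N y + ennreal \<delta> * 1) 0"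
      unfolding surv_def by (simp only: steps_add steps_cmult N.mean_time_measurable borel_measurable_const borel_measurable_times)
    also have "\<dots> \<le> (step 1 A M ^^ n) (mean_time \<kappa> A N) 0"
    proof (cases "n = 0")
      case True
      then show ?thesis using \<delta>(2)[of 0] A by simp
    next
      case False
      then show ?thesis using \<delta> by (intro steps_mono_below) auto
    qed
    finally have 1: "((step 1 A M ^^ n) (mean_time 1 A N) 0 / S A n 0 + ennreal \<delta>) * S A n 0
      \<le> (step 1 A M ^^ n) (mean_time \<kappa> A N) 0" .
    have 2: "(step 1 A M ^^ n) (mean_time \<kappa> A N) 0 * surv \<kappa> A M n 0
      \<le> (step \<kappa> A M ^^ n) (mean_time \<kappa> A N) 0 * S A n 0"
      using \<kappa> Spos by (intro steps_ratio_drift lc N.mean_time_antimono) auto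
    have sk: "surv \<kappa> A M n 0 = S A' n 0" using surv_scale[OF \<kappa>(1), where A = A' and n = n and x = 0] \<kappa> by simp
    have wk: "(step \<kappa> A M ^^ n) (mean_time \<kappa> A N) 0 = (step 1 A' M ^^ n) (mean_time 1 A' N) 0"
      using steps_scale[OF \<kappa>(1), where A = A' and n = n and u = "mean_time \<kappa> A N" and x = 0] \<kappa> by (simp add: scale)
    have S'pos: "S A' n 0 \<noteq> 0"
      using surv_le_threshold[of 1 A A' 0 n] Spos[of n] A by auto
    have S'fin: "S A' n 0 \<noteq> \<top>" by (rule less_imp_neq[OF surv_fin]) auto
    have "S A n 0 * (((step 1 A M ^^ n) (mean_time 1 A N) 0 / S A n 0 + ennreal \<delta>) * S A' n 0)
      \<le> S A n 0 * (step 1 A' M ^^ n) (mean_time 1 A' N) 0"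
      using mult_right_mono[OF 1, of "S A' n 0"] 2 unfolding sk wk
      by (simp add: mult_ac order_trans)
    then have "((step 1 A M ^^ n) (mean_time 1 A N) 0 / S A n 0 + ennreal \<delta>) * S A' n 0
      \<le> (step 1 A' M ^^ n) (mean_time 1 A' N) 0"
      using Spos S_fin[of 1 n] by (simp add: ennreal_mult_le_mult_iff)
    then have "((step 1 A M ^^ n) (mean_time 1 A N) 0 / S A n 0 + ennreal \<delta>) * S A' n 0 / S A' n 0
      \<le> (step 1 A' M ^^ n) (mean_time 1 A' N) 0 / S A' n 0"
      by (rule divide_right_mono_ennreal)
    then show ?thesis using S'pos S'fin by (simp add: ennreal_mult_divide_eq)
  qed
  then have "ennreal H + ennreal \<delta> \<le> ennreal H'"
    by (intro LIMSEQ_le[OF tendsto_add[OF H tendsto_const] H']) auto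
  then show ?thesis using nonneg \<delta>(1) by (simp flip: ennreal_plus)
qed

end

section \<open>From the observations to the kernel\<close>
text \<open>
  Prepending an independent first coordinate, for factors that need not be identically distributed.
\<close>
lemma distr_case_nat_PiM:
  fixes N :: "nat \<Rightarrow> 'a measure"
  assumes N: "\<And>i. prob_space (N i)" and sets: "\<And>i. sets (N i) = sets K"
  shows "distr (N 0 \<Otimes>\<^sub>M PiM UNIV (\<lambda>i. N (Suc i))) (PiM UNIV N) (\<lambda>z. case_nat (fst z) (snd z)) = PiM UNIV N"
    (is "?D = _")
proof -
  interpret N: prob_space "N i" for i by (rule N)
  interpret P: product_prob_space N UNIV by unfold_locales
  interpret Q: product_prob_space "\<lambda>i. N (Suc i)" UNIV by unfold_locales
  have setsP: "sets (PiM UNIV N) = sets (PiM UNIV (\<lambda>_. K))"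
    by (rule sets_PiM_cong) (simp_all add: sets)
  have setsQ: "sets (PiM UNIV (\<lambda>i. N (Suc i))) = sets (PiM UNIV (\<lambda>_. K))"
    by (rule sets_PiM_cong) (simp_all add: sets)
  have meas: "(\<lambda>z. case_nat (fst z) (snd z)) \<in> measurable (N 0 \<Otimes>\<^sub>M PiM UNIV (\<lambda>i. N (Suc i))) (PiM UNIV N)"
  proof -
    have "(\<lambda>z. case_nat (fst z) (snd z)) \<in> measurable (K \<Otimes>\<^sub>M PiM UNIV (\<lambda>_. K)) (PiM UNIV (\<lambda>_. K))"
      by measurable
    moreover have "sets (N 0 \<Otimes>\<^sub>M PiM UNIV (\<lambda>i. N (Suc i))) = sets (K \<Otimes>\<^sub>M PiM UNIV (\<lambda>_. K))"
      by (intro sets_pair_measure_cong sets setsQ)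
    ultimately show ?thesis using setsP by (subst measurable_cong_sets) auto
  qed
  show ?thesis
  proof (rule P.PiM_eq)
    fix J E assume J: "finite J" "J \<subseteq> UNIV" "\<And>j. j \<in> J \<Longrightarrow> E j \<in> sets (N j)"
    let ?X = "prod_emb UNIV N J (\<Pi>\<^sub>E j\<in>J. E j)"
    have "\<And>j x. j \<in> J \<Longrightarrow> x \<in> E j \<Longrightarrow> x \<in> space (N j)"
      using J(3)[THEN sets.sets_into_space] by (auto simp: space_PiM Pi_iff subset_eq)
    with J have "(\<lambda>z. case_nat (fst z) (snd z)) -` ?X \<inter> space (N 0 \<Otimes>\<^sub>M PiM UNIV (\<lambda>i. N (Suc i)))
      = (if 0 \<in> J then E 0 else space (N 0)) \<times>
        (prod_emb UNIV (\<lambda>i. N (Suc i)) (Suc -` J) (\<Pi>\<^sub>E j\<in>Suc -` J. E (Suc j)))" (is "_ = ?E \<times> ?F")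
      by (auto simp: space_pair_measure space_PiM PiE_iff prod_emb_def all_conj_distrib
        split: nat.split nat.split_asm)
    moreover have "?X \<in> sets (PiM UNIV N)" using J by (auto intro!: sets_PiM_I)
    ultimately have "emeasure ?D ?X = emeasure (N 0 \<Otimes>\<^sub>M PiM UNIV (\<lambda>i. N (Suc i))) (?E \<times> ?F)"
      using meas by (subst emeasure_distr) auto
    also have "\<dots> = emeasure (N 0) ?E * emeasure (PiM UNIV (\<lambda>i. N (Suc i))) ?F"
      using J by (intro Q.P.emeasure_pair_measure_Times) (auto intro!: sets_PiM_I finite_vimageI)
    also have "emeasure (PiM UNIV (\<lambda>i. N (Suc i))) ?F = (\<Prod>j\<in>Suc -` J. emeasure (N (Suc j)) (E (Suc j)))"
      using J by (intro Q.emeasure_PiM_emb) (simp_all add: finite_vimageI)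
    also have "\<dots> = (\<Prod>j\<in>J - {0}. emeasure (N j) (E j))"
    proof (rule prod.reindex_bij_betw)
      show "bij_betw Suc (Suc -` J) (J - {0})"
        by (auto simp: bij_betw_def image_iff gr0_conv_Suc)
    qed
    also have "emeasure (N 0) ?E * (\<Prod>j\<in>J - {0}. emeasure (N j) (E j)) = (\<Prod>j\<in>J. emeasure (N j) (E j))"
      using J by (auto simp: N.emeasure_space_1 prod.remove)
    finally show "emeasure ?D ?X = (\<Prod>j\<in>J. emeasure (N j) (E j))" .
  qed simp
qed

lemma less_SR_time_iff:
  "enat n < SR_time f g A r \<omega> \<longleftrightarrow> (\<forall>k. 1 \<le> k \<longrightarrow> k \<le> n \<longrightarrow> SR_stat f g r \<omega> k < ereal A)"
proof -
  define X where "X = {enat n | n. 1 \<le> n \<and> ereal A \<le> SR_stat f g r \<omega> n}"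
  have "enat n < Inf X \<longleftrightarrow> (\<forall>x\<in>X. enat n < x)"
  proof
    assume "\<forall>x\<in>X. enat n < x"
    then have "eSuc (enat n) \<le> Inf X" by (intro Inf_greatest) (auto intro: ileI1)
    then show "enat n < Inf X" by (simp add: eSuc_enat Suc_ile_eq)
  qed (auto dest: Inf_lower intro: less_le_trans)
  also have "\<dots> \<longleftrightarrow> (\<forall>k. 1 \<le> k \<longrightarrow> k \<le> n \<longrightarrow> SR_stat f g r \<omega> k < ereal A)"
    unfolding X_def by (auto simp: not_le[symmetric])
  finally show ?thesis by (simp add: SR_time_def X_def)
qed

lemma SR_stat_case_nat:
  assumes "likelihood_ratio f g y = ereal l"
  shows "SR_stat f g r (case_nat y \<omega>) (Suc n) = SR_stat f g ((1 + r) * l) \<omega> n"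
  by (induction n) (simp_all add: assms one_ereal_def)

lemma mult_infinite: "0 \<le> r \<Longrightarrow> (1 + ereal r) * \<infinity> = \<infinity>"
  by (simp add: one_ereal_def)

lemma nn_integral_residual:
  fixes T :: "'w \<Rightarrow> enat"
  assumes T[measurable]: "T \<in> measurable M (count_space UNIV)"
  shows "(\<integral>\<^sup>+\<omega>. ennreal_of_enat (T \<omega> - enat \<nu>) \<partial>uniform_measure M {\<omega> \<in> space M. enat \<nu> < T \<omega>})
    = (\<Sum>j. emeasure M {\<omega> \<in> space M. enat (\<nu> + j) < T \<omega>}) / emeasure M {\<omega> \<in> space M. enat \<nu> < T \<omega>}"
proof -
  have [measurable]: "(\<lambda>\<omega>. T \<omega> - enat \<nu>) \<in> measurable M (count_space UNIV)"
    by (rule measurable_compose[OF T]) simp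
  have "(\<integral>\<^sup>+\<omega>. ennreal_of_enat (T \<omega> - enat \<nu>) \<partial>uniform_measure M {\<omega> \<in> space M. enat \<nu> < T \<omega>})
    = (\<integral>\<^sup>+\<omega>. ennreal_of_enat (T \<omega> - enat \<nu>) * indicator {\<omega> \<in> space M. enat \<nu> < T \<omega>} \<omega> \<partial>M)
      / emeasure M {\<omega> \<in> space M. enat \<nu> < T \<omega>}"
    by (rule nn_integral_uniform_measure) measurable
  also have "(\<integral>\<^sup>+\<omega>. ennreal_of_enat (T \<omega> - enat \<nu>) * indicator {\<omega> \<in> space M. enat \<nu> < T \<omega>} \<omega> \<partial>M)
    = (\<integral>\<^sup>+\<omega>. ennreal_of_enat (T \<omega> - enat \<nu>) \<partial>M)"
  proof (rule nn_integral_cong)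
    fix \<omega> assume "\<omega> \<in> space M"
    then show "ennreal_of_enat (T \<omega> - enat \<nu>) * indicator {\<omega> \<in> space M. enat \<nu> < T \<omega>} \<omega> = ennreal_of_enat (T \<omega> - enat \<nu>)"
      by (cases "T \<omega>") (auto simp: indicator_def zero_enat_def[symmetric])
  qed
  also have "\<dots> = (\<Sum>j. emeasure M {\<omega> \<in> space M. enat j < T \<omega> - enat \<nu>})"
    by (rule nn_integral_enat_function) measurable
  also have "(\<lambda>j. {\<omega> \<in> space M. enat j < T \<omega> - enat \<nu>}) = (\<lambda>j. {\<omega> \<in> space M. enat (\<nu> + j) < T \<omega>})"
  proof -
    have "enat j < t - enat \<nu> \<longleftrightarrow> enat (\<nu> + j) < t" for j and t :: enat
      by (cases t) auto
    then show ?thesis by simp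
  qed
  finally show ?thesis .
qed

locale change_model =
  fixes \<mu> :: "'x measure" and f g :: "'x \<Rightarrow> real"
  assumes f: "prob_density \<mu> f" and g: "prob_density \<mu> g"
begin

lemma f_meas[measurable]: "f \<in> borel_measurable \<mu>" and g_meas[measurable]: "g \<in> borel_measurable \<mu>"
  and f_nonneg: "y \<in> space \<mu> \<Longrightarrow> 0 \<le> f y" and g_nonneg: "y \<in> space \<mu> \<Longrightarrow> 0 \<le> g y"
  using f g by (auto simp: prob_density_def)

abbreviation LR :: "'x \<Rightarrow> ereal" where "LR \<equiv> likelihood_ratio f g"

definition \<rho> :: "'x \<Rightarrow> real" where "\<rho> y = real_of_ereal (LR y)"

lemma LR_measurable[measurable]: "LR \<in> borel_measurable \<mu>"
  unfolding likelihood_ratio_def by measurable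

lemma \<rho>_measurable[measurable]: "\<rho> \<in> borel_measurable \<mu>"
  unfolding \<rho>_def by measurable

lemma LR_nonneg: "y \<in> space \<mu> \<Longrightarrow> 0 \<le> LR y"
  unfolding likelihood_ratio_def divide_ereal_def
  using f_nonneg g_nonneg by (intro ereal_0_le_mult inverse_ereal_ge0I) auto

lemma \<rho>_nonneg: "y \<in> space \<mu> \<Longrightarrow> 0 \<le> \<rho> y"
  using LR_nonneg by (simp add: \<rho>_def real_of_ereal_pos)

lemma LR_eq: "0 < f y \<Longrightarrow> LR y = ereal (g y / f y)" and \<rho>_eq: "0 < f y \<Longrightarrow> \<rho> y = g y / f y"
  by (simp_all add: likelihood_ratio_def \<rho>_def)

lemma LR_infinite: "y \<in> space \<mu> \<Longrightarrow> \<not> 0 < f y \<Longrightarrow> 0 < g y \<Longrightarrow> LR y = \<infinity>"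
  using f_nonneg[of y] by (simp add: likelihood_ratio_def divide_ereal_def)

definition dens :: "enat \<Rightarrow> nat \<Rightarrow> 'x measure" where
  "dens \<nu> i = density \<mu> (\<lambda>x. ennreal (if enat i < \<nu> then f x else g x))"

lemma sets_dens[measurable_cong, simp]: "sets (dens \<nu> i) = sets \<mu>"
  by (simp add: dens_def)

lemma space_dens[simp]: "space (dens \<nu> i) = space \<mu>"
  by (simp add: dens_def)

lemma prob_space_density: "prob_density \<mu> h \<Longrightarrow> prob_space (density \<mu> (\<lambda>x. ennreal (h x)))"
proof (rule prob_spaceI)
  assume h: "prob_density \<mu> h"
  then have [measurable]: "h \<in> borel_measurable \<mu>" by (simp add: prob_density_def)
  have "emeasure (density \<mu> (\<lambda>x. ennreal (h x))) (space \<mu>) = (\<integral>\<^sup>+x. ennreal (h x) * indicator (space \<mu>) x \<partial>\<mu>)"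
    by (rule emeasure_density) auto
  also have "\<dots> = (\<integral>\<^sup>+x. ennreal (h x) \<partial>\<mu>)" by (rule nn_integral_cong) simp
  finally show "emeasure (density \<mu> (\<lambda>x. ennreal (h x))) (space (density \<mu> (\<lambda>x. ennreal (h x)))) = 1"
    using h by (simp add: prob_density_def)
qed

lemma prob_space_dens: "prob_space (dens \<nu> i)"
  using prob_space_density[OF f] prob_space_density[OF g] by (cases "enat i < \<nu>") (simp_all add: dens_def)

abbreviation obs_space :: "(nat \<Rightarrow> 'x) measure" where "obs_space \<equiv> PiM UNIV (\<lambda>_. \<mu>)"

abbreviation P :: "enat \<Rightarrow> (nat \<Rightarrow> 'x) measure" where "P \<equiv> obs_law \<mu> f g"

lemma P_eq: "P \<nu> = PiM UNIV (dens \<nu>)"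
  by (simp add: obs_law_def dens_def[abs_def])

lemma sets_P[measurable_cong, simp]: "sets (P \<nu>) = sets obs_space"
  unfolding P_eq by (rule sets_PiM_cong) simp_all

lemma space_P: "space (P \<nu>) = space obs_space"
  using sets_eq_imp_space_eq[OF sets_P] .

lemma prob_space_P: "prob_space (P \<nu>)"
  unfolding P_eq by (intro prob_space_PiM prob_space_dens)

text \<open>
  Conditioning on the first observation moves the changepoint back by one.
\<close>
lemma nn_integral_P:
  assumes shift: "\<And>i. dens \<nu> (Suc i) = dens \<nu>' i" and h: "h \<in> borel_measurable obs_space"
  shows "(\<integral>\<^sup>+\<omega>. h \<omega> \<partial>P \<nu>) = (\<integral>\<^sup>+y. (\<integral>\<^sup>+\<omega>. h (case_nat y \<omega>) \<partial>P \<nu>') \<partial>dens \<nu> 0)"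
proof -
  interpret P': prob_space "P \<nu>'" by (rule prob_space_P)
  have P': "PiM UNIV (\<lambda>i. dens \<nu> (Suc i)) = P \<nu>'" by (simp add: P_eq shift)
  note [measurable] = h
  have "P \<nu> = distr (dens \<nu> 0 \<Otimes>\<^sub>M P \<nu>') (P \<nu>) (\<lambda>z. case_nat (fst z) (snd z))"
    using distr_case_nat_PiM[of "dens \<nu>" \<mu>, OF prob_space_dens sets_dens] by (simp add: P' P_eq[symmetric])
  then have "(\<integral>\<^sup>+\<omega>. h \<omega> \<partial>P \<nu>) = (\<integral>\<^sup>+\<omega>. h \<omega> \<partial>distr (dens \<nu> 0 \<Otimes>\<^sub>M P \<nu>') (P \<nu>) (\<lambda>z. case_nat (fst z) (snd z)))"
    by simp
  also have "\<dots> = (\<integral>\<^sup>+z. h (case_nat (fst z) (snd z)) \<partial>(dens \<nu> 0 \<Otimes>\<^sub>M P \<nu>'))"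
    by (rule nn_integral_distr) measurable
  also have "\<dots> = (\<integral>\<^sup>+y. (\<integral>\<^sup>+\<omega>. h (case_nat y \<omega>) \<partial>P \<nu>') \<partial>dens \<nu> 0)"
  proof -
    have "(\<lambda>z. case_nat (fst z) (snd z)) \<in> measurable (dens \<nu> 0 \<Otimes>\<^sub>M P \<nu>') obs_space"
      by measurable
    from measurable_compose[OF this h] show ?thesis
      by (subst P'.nn_integral_fst[symmetric]) simp_all
  qed
  finally show ?thesis .
qed

lemma SR_stat_measurable[measurable]:
  "(\<lambda>z. SR_stat f g (fst z) (snd z) n) \<in> borel_measurable (borel \<Otimes>\<^sub>M obs_space)"
  by (induction n) (simp_all, measurable)

lemma SR_time_gt_sets:
  "{z \<in> space (borel \<Otimes>\<^sub>M obs_space). enat n < SR_time f g A (fst z) (snd z)} \<in> sets (borel \<Otimes>\<^sub>M obs_space)"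
  unfolding less_SR_time_iff by measurable

lemma SR_time_measurable[measurable]:
  "(\<lambda>z. SR_time f g A (fst z) (snd z)) \<in> measurable (borel \<Otimes>\<^sub>M obs_space) (count_space UNIV)"
proof (subst measurable_count_space_eq2_countable, safe)
  fix t :: enat
  let ?T = "\<lambda>z. SR_time f g A (fst z) (snd z)" and ?S = "space (borel \<Otimes>\<^sub>M obs_space)"
  have gt[measurable]: "Measurable.pred (borel \<Otimes>\<^sub>M obs_space) (\<lambda>z. enat n < ?T z)" for n
    using SR_time_gt_sets by (simp add: pred_def)
  show "?T -` {t} \<inter> ?S \<in> sets (borel \<Otimes>\<^sub>M obs_space)"
  proof (cases t)
    case (enat n)
    have "?T z = enat n \<longleftrightarrow> \<not> enat n < ?T z \<and> (\<forall>m<n. enat m < ?T z)" for z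
      by (cases "?T z") (simp_all, metis linorder_neqE_nat order_less_irrefl)
    then have "?T -` {t} \<inter> ?S = {z \<in> ?S. \<not> enat n < ?T z \<and> (\<forall>m<n. enat m < ?T z)}"
      using enat by auto
    also have "\<dots> \<in> sets (borel \<Otimes>\<^sub>M obs_space)" by measurable
    finally show ?thesis .
  next
    case infinity
    have "?T z = \<infinity> \<longleftrightarrow> (\<forall>m. enat m < ?T z)" for z
      by (cases "?T z") auto
    then have "?T -` {t} \<inter> ?S = {z \<in> ?S. \<forall>m. enat m < ?T z}"
      using infinity by auto
    also have "\<dots> \<in> sets (borel \<Otimes>\<^sub>M obs_space)" by measurable
    finally show ?thesis .
  qed
qed auto

definition survival :: "real \<Rightarrow> enat \<Rightarrow> nat \<Rightarrow> real \<Rightarrow> ennreal" where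
  "survival A \<nu> n r = emeasure (P \<nu>) {\<omega> \<in> space obs_space. enat n < SR_time f g A r \<omega>}"

lemma SR_time_section[measurable]: "SR_time f g A r \<in> measurable obs_space (count_space UNIV)"
proof -
  have "(\<lambda>\<omega>. SR_time f g A (fst (r, \<omega>)) (snd (r, \<omega>))) \<in> measurable obs_space (count_space UNIV)"
    by measurable
  then show ?thesis by simp
qed

lemma survival_measurable[measurable]: "survival A \<nu> n \<in> borel_measurable borel"
proof -
  interpret P: prob_space "P \<nu>" by (rule prob_space_P)
  have "{z \<in> space (borel \<Otimes>\<^sub>M obs_space). enat n < SR_time f g A (fst z) (snd z)} \<in> sets (borel \<Otimes>\<^sub>M P \<nu>)"
    using SR_time_gt_sets[of n A] by (subst sets_pair_measure_cong[OF refl sets_P])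
  from P.measurable_emeasure_Pair[OF this] show ?thesis
    by (simp add: survival_def[abs_def] space_pair_measure vimage_def)
qed

lemma survival_0[simp]: "survival A \<nu> 0 r = 1"
proof -
  interpret P: prob_space "P \<nu>" by (rule prob_space_P)
  have "{\<omega> \<in> space obs_space. enat 0 < SR_time f g A r \<omega>} = space (P \<nu>)"
    unfolding less_SR_time_iff by (auto simp: space_P)
  then show ?thesis by (simp add: survival_def P.emeasure_space_1)
qed

text \<open>
  The procedure started at \<open>r\<close> continues, after the first observation, as the procedure started at the
  new value of the statistic. Survival of that observation makes the likelihood ratio finite.
\<close>
lemma less_SR_time_Suc:
  assumes y: "y \<in> space \<mu>" and r: "0 \<le> r"
  shows "enat (Suc n) < SR_time f g A r (case_nat y \<omega>) \<longleftrightarrow>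
    (1 + ereal r) * LR y < ereal A \<and> enat n < SR_time f g A ((1 + r) * \<rho> y) \<omega>"
proof (cases "(1 + ereal r) * LR y < ereal A")
  case True
  have "LR y \<noteq> \<infinity>"
  proof
    assume "LR y = \<infinity>"
    then show False using True unfolding \<open>LR y = \<infinity>\<close> mult_infinite[OF r] by simp
  qed
  then have LR: "LR y = ereal (\<rho> y)"
    using LR_nonneg[OF y] unfolding \<rho>_def by (cases "LR y") auto
  have "(\<forall>k. 1 \<le> k \<longrightarrow> k \<le> Suc n \<longrightarrow> SR_stat f g r (case_nat y \<omega>) k < ereal A) \<longleftrightarrow>
    (\<forall>k\<le>n. SR_stat f g r (case_nat y \<omega>) (Suc k) < ereal A)"
  proof (intro iffI allI impI)
    fix k assume all: "\<forall>k\<le>n. SR_stat f g r (case_nat y \<omega>) (Suc k) < ereal A" and k: "1 \<le> k" "k \<le> Suc n"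
    then show "SR_stat f g r (case_nat y \<omega>) k < ereal A" by (cases k) (auto simp del: SR_stat.simps)
  qed (simp del: SR_stat.simps)
  also have "\<dots> \<longleftrightarrow> (\<forall>k\<le>n. SR_stat f g ((1 + r) * \<rho> y) \<omega> k < ereal A)"
    by (simp only: SR_stat_case_nat[OF LR])
  also have "\<dots> \<longleftrightarrow> (\<forall>k. 1 \<le> k \<longrightarrow> k \<le> n \<longrightarrow> SR_stat f g ((1 + r) * \<rho> y) \<omega> k < ereal A)"
  proof -
    have "SR_stat f g ((1 + r) * \<rho> y) \<omega> 0 < ereal A" using True LR by (simp add: one_ereal_def)
    then have "SR_stat f g ((1 + r) * \<rho> y) \<omega> k < ereal A" if "1 \<le> k \<longrightarrow> SR_stat f g ((1 + r) * \<rho> y) \<omega> k < ereal A" for k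
      using that by (cases k) (auto simp del: SR_stat.simps)
    then show ?thesis by blast
  qed
  finally show ?thesis using True by (simp add: less_SR_time_iff)
next
  case False
  then have "\<not> SR_stat f g r (case_nat y \<omega>) 1 < ereal A" by simp
  then have "\<not> enat (Suc n) < SR_time f g A r (case_nat y \<omega>)" unfolding less_SR_time_iff by force
  then show ?thesis using False by simp
qed

lemma survival_Suc:
  assumes shift: "\<And>i. dens \<nu> (Suc i) = dens \<nu>' i" and r: "0 \<le> r"
  shows "survival A \<nu> (Suc n) r
    = (\<integral>\<^sup>+y. indicator {..<ereal A} ((1 + ereal r) * LR y) * survival A \<nu>' n ((1 + r) * \<rho> y) \<partial>dens \<nu> 0)"
proof -
  have set[measurable]: "{\<omega> \<in> space obs_space. enat k < SR_time f g A x \<omega>} \<in> sets obs_space" for k x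
    by measurable
  have "survival A \<nu> (Suc n) r = (\<integral>\<^sup>+\<omega>. indicator {\<omega> \<in> space obs_space. enat (Suc n) < SR_time f g A r \<omega>} \<omega> \<partial>P \<nu>)"
    by (simp add: survival_def)
  also have "\<dots> = (\<integral>\<^sup>+y. (\<integral>\<^sup>+\<omega>. indicator {\<omega> \<in> space obs_space. enat (Suc n) < SR_time f g A r \<omega>} (case_nat y \<omega>) \<partial>P \<nu>') \<partial>dens \<nu> 0)"
    by (rule nn_integral_P[OF shift]) measurable
  also have "\<dots> = (\<integral>\<^sup>+y. indicator {..<ereal A} ((1 + ereal r) * LR y) * survival A \<nu>' n ((1 + r) * \<rho> y) \<partial>dens \<nu> 0)"
  proof (rule nn_integral_cong)
    fix y assume "y \<in> space (dens \<nu> 0)"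
    then have y: "y \<in> space \<mu>" by simp
    have "(\<integral>\<^sup>+\<omega>. indicator {\<omega> \<in> space obs_space. enat (Suc n) < SR_time f g A r \<omega>} (case_nat y \<omega>) \<partial>P \<nu>')
      = (\<integral>\<^sup>+\<omega>. indicator {..<ereal A} ((1 + ereal r) * LR y) *
          indicator {\<omega> \<in> space obs_space. enat n < SR_time f g A ((1 + r) * \<rho> y) \<omega>} \<omega> \<partial>P \<nu>')"
    proof (rule nn_integral_cong)
      fix \<omega> assume "\<omega> \<in> space (P \<nu>')"
      then have \<omega>: "\<omega> \<in> space obs_space" by (simp add: space_P)
      then have "case_nat y \<omega> \<in> space obs_space"
        using y by (auto simp: space_PiM PiE_iff split: nat.split)
      then show "indicator {\<omega> \<in> space obs_space. enat (Suc n) < SR_time f g A r \<omega>} (case_nat y \<omega>)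
        = (indicator {..<ereal A} ((1 + ereal r) * LR y) *
          indicator {\<omega> \<in> space obs_space. enat n < SR_time f g A ((1 + r) * \<rho> y) \<omega>} \<omega> :: ennreal)"
        using less_SR_time_Suc[OF y r, of n A \<omega>] \<omega> by (simp add: indicator_def)
    qed
    also have "\<dots> = indicator {..<ereal A} ((1 + ereal r) * LR y) * survival A \<nu>' n ((1 + r) * \<rho> y)"
      unfolding survival_def by (subst nn_integral_cmult_indicator) auto
    finally show "(\<integral>\<^sup>+\<omega>. indicator {\<omega> \<in> space obs_space. enat (Suc n) < SR_time f g A r \<omega>} (case_nat y \<omega>) \<partial>P \<nu>')
      = indicator {..<ereal A} ((1 + ereal r) * LR y) * survival A \<nu>' n ((1 + r) * \<rho> y)" .
  qed
  finally show ?thesis .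
qed

definition pre :: "real measure" where
  "pre = distr (density \<mu> (\<lambda>x. ennreal (f x))) borel \<rho>"

text \<open>
  The part of the post-change law of the likelihood ratio on which the ratio is finite.
\<close>
definition post :: "real measure" where
  "post = distr (density \<mu> (\<lambda>x. ennreal (if 0 < f x then g x else 0))) borel \<rho>"

lemma sets_pre[measurable_cong, simp]: "sets pre = sets borel" and sets_post[measurable_cong, simp]: "sets post = sets borel"
  by (simp_all add: pre_def post_def)

lemma nn_integral_pre:
  assumes [measurable]: "h \<in> borel_measurable borel"
  shows "(\<integral>\<^sup>+l. h l \<partial>pre) = (\<integral>\<^sup>+y. ennreal (f y) * h (\<rho> y) \<partial>\<mu>)"
  unfolding pre_def by (subst nn_integral_distr, measurable, subst nn_integral_density, measurable)

lemma nn_integral_post: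
  assumes [measurable]: "h \<in> borel_measurable borel"
  shows "(\<integral>\<^sup>+l. h l \<partial>post) = (\<integral>\<^sup>+y. ennreal (if 0 < f y then g y else 0) * h (\<rho> y) \<partial>\<mu>)"
  unfolding post_def by (subst nn_integral_distr, measurable, subst nn_integral_density, measurable)

lemma post_density: "post = density pre (\<lambda>l. ennreal l)"
proof (rule measure_eqI)
  fix B assume "B \<in> sets post"
  then have [measurable]: "B \<in> sets borel" by simp
  have "emeasure post B = (\<integral>\<^sup>+l. indicator B l \<partial>post)" by simp
  also have "\<dots> = (\<integral>\<^sup>+y. ennreal (if 0 < f y then g y else 0) * indicator B (\<rho> y) \<partial>\<mu>)"
    by (rule nn_integral_post) simp
  also have "\<dots> = (\<integral>\<^sup>+y. ennreal (f y) * (ennreal (\<rho> y) * indicator B (\<rho> y)) \<partial>\<mu>)"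
  proof (rule nn_integral_cong)
    fix y assume y: "y \<in> space \<mu>"
    show "ennreal (if 0 < f y then g y else 0) * indicator B (\<rho> y) = ennreal (f y) * (ennreal (\<rho> y) * indicator B (\<rho> y))"
    proof (cases "0 < f y")
      case True
      then have "ennreal (g y) = ennreal (f y) * ennreal (\<rho> y)"
        using g_nonneg[OF y] by (simp add: \<rho>_eq flip: ennreal_mult)
      then show ?thesis using True by (simp add: mult.assoc)
    next
      case False
      then show ?thesis by (simp add: ennreal_neg)
    qed
  qed
  also have "\<dots> = (\<integral>\<^sup>+l. ennreal l * indicator B l \<partial>pre)"
    by (rule nn_integral_pre[symmetric]) simp
  also have "\<dots> = emeasure (density pre (\<lambda>l. ennreal l)) B"
    by (rule emeasure_density[symmetric]) auto
  finally show "emeasure post B = emeasure (density pre (\<lambda>l. ennreal l)) B" .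
qed simp

lemma step_pre:
  assumes [measurable]: "h \<in> borel_measurable borel"
  shows "(\<integral>\<^sup>+y. indicator {..<ereal A} ((1 + ereal r) * LR y) * h ((1 + r) * \<rho> y) \<partial>density \<mu> (\<lambda>x. ennreal (f x)))
    = step 1 A pre h r"
proof -
  have "step 1 A pre h r = (\<integral>\<^sup>+y. ennreal (f y) * (h ((1 + r) * \<rho> y) * indicator {..<A} ((1 + r) * \<rho> y)) \<partial>\<mu>)"
    unfolding step_def by (rule nn_integral_pre) measurable
  also have "\<dots> = (\<integral>\<^sup>+y. ennreal (f y) * (indicator {..<ereal A} ((1 + ereal r) * LR y) * h ((1 + r) * \<rho> y)) \<partial>\<mu>)"
  proof (rule nn_integral_cong)
    fix y assume y: "y \<in> space \<mu>"
    show "ennreal (f y) * (h ((1 + r) * \<rho> y) * indicator {..<A} ((1 + r) * \<rho> y))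
      = ennreal (f y) * (indicator {..<ereal A} ((1 + ereal r) * LR y) * h ((1 + r) * \<rho> y))"
    proof (cases "0 < f y")
      case True
      then show ?thesis by (simp add: LR_eq \<rho>_eq one_ereal_def indicator_def)
    qed (simp add: ennreal_neg)
  qed
  also have "\<dots> = (\<integral>\<^sup>+y. indicator {..<ereal A} ((1 + ereal r) * LR y) * h ((1 + r) * \<rho> y) \<partial>density \<mu> (\<lambda>x. ennreal (f x)))"
    by (rule nn_integral_density[symmetric]) measurable
  finally show ?thesis ..
qed

lemma step_post:
  assumes [measurable]: "h \<in> borel_measurable borel" and r: "0 \<le> r"
  shows "(\<integral>\<^sup>+y. indicator {..<ereal A} ((1 + ereal r) * LR y) * h ((1 + r) * \<rho> y) \<partial>density \<mu> (\<lambda>x. ennreal (g x)))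
    = step 1 A post h r"
proof -
  have "step 1 A post h r = (\<integral>\<^sup>+y. ennreal (if 0 < f y then g y else 0) * (h ((1 + r) * \<rho> y) * indicator {..<A} ((1 + r) * \<rho> y)) \<partial>\<mu>)"
    unfolding step_def by (rule nn_integral_post) measurable
  also have "\<dots> = (\<integral>\<^sup>+y. ennreal (g y) * (indicator {..<ereal A} ((1 + ereal r) * LR y) * h ((1 + r) * \<rho> y)) \<partial>\<mu>)"
  proof (rule nn_integral_cong)
    fix y assume y: "y \<in> space \<mu>"
    show "ennreal (if 0 < f y then g y else 0) * (h ((1 + r) * \<rho> y) * indicator {..<A} ((1 + r) * \<rho> y))
      = ennreal (g y) * (indicator {..<ereal A} ((1 + ereal r) * LR y) * h ((1 + r) * \<rho> y))"
    proof (cases "0 < f y")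
      case True
      then show ?thesis by (simp add: LR_eq \<rho>_eq one_ereal_def indicator_def)
    next
      case False
      show ?thesis
      proof (cases "0 < g y")
        case True
        show ?thesis unfolding LR_infinite[OF y False True] mult_infinite[OF r] using False by simp
      qed (use False in \<open>simp add: ennreal_neg\<close>)
    qed
  qed
  also have "\<dots> = (\<integral>\<^sup>+y. indicator {..<ereal A} ((1 + ereal r) * LR y) * h ((1 + r) * \<rho> y) \<partial>density \<mu> (\<lambda>x. ennreal (g x)))"
    by (rule nn_integral_density[symmetric]) measurable
  finally show ?thesis ..
qed

lemma AE_pre_nonneg: "AE l in pre. 0 \<le> l" and AE_post_nonneg: "AE l in post. 0 \<le> l"
proof -
  have "AE y in density \<mu> h. 0 \<le> \<rho> y" for h
    by (rule AE_I2) (simp add: \<rho>_nonneg)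
  then show "AE l in pre. 0 \<le> l" "AE l in post. 0 \<le> l"
    unfolding pre_def post_def
    by (auto intro!: AE_distr_iff[where P = "\<lambda>l. 0 \<le> l", THEN iffD2])
qed

lemma survival_post: "0 \<le> r \<Longrightarrow> survival A 0 n r = surv 1 A post n r"
proof (induction n arbitrary: r)
  case 0
  then show ?case by (simp add: surv_def)
next
  case (Suc n)
  have d: "dens 0 i = density \<mu> (\<lambda>x. ennreal (g x))" for i by (simp add: dens_def)
  have "survival A 0 (Suc n) r = step 1 A post (survival A 0 n) r"
    using survival_Suc[of 0 0 r A n] step_post[OF survival_measurable Suc.prems] Suc.prems by (simp add: d)
  also have "\<dots> = step 1 A post (surv 1 A post n) r"
    using Suc by (intro step_cong AE_post_nonneg) auto
  finally show ?case by (simp add: surv_def)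
qed

lemma survival_pre: "0 \<le> r \<Longrightarrow> survival A \<infinity> n r = surv 1 A pre n r"
proof (induction n arbitrary: r)
  case 0
  then show ?case by (simp add: surv_def)
next
  case (Suc n)
  have d: "dens \<infinity> i = density \<mu> (\<lambda>x. ennreal (f x))" for i by (simp add: dens_def)
  have "survival A \<infinity> (Suc n) r = step 1 A pre (survival A \<infinity> n) r"
    using survival_Suc[of \<infinity> \<infinity> r A n] step_pre[OF survival_measurable] Suc.prems by (simp add: d)
  also have "\<dots> = step 1 A pre (surv 1 A pre n) r"
    using Suc by (intro step_cong AE_pre_nonneg) auto
  finally show ?case by (simp add: surv_def)
qed

text \<open>
  The first \<open>\<nu>\<close> steps use the pre-change kernel, the remaining ones the post-change kernel.
\<close>
lemma survival_change: "0 \<le> r \<Longrightarrow> survival A (enat \<nu>) (\<nu> + n) r = (step 1 A pre ^^ \<nu>) (surv 1 A post n) r"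
proof (induction \<nu> arbitrary: r)
  case 0
  then show ?case using survival_post by (simp add: zero_enat_def[symmetric])
next
  case (Suc \<nu>)
  have d: "dens (enat (Suc \<nu>)) 0 = density \<mu> (\<lambda>x. ennreal (f x))" by (simp add: dens_def)
  have shift: "dens (enat (Suc \<nu>)) (Suc i) = dens (enat \<nu>) i" for i by (simp add: dens_def)
  have "survival A (enat (Suc \<nu>)) (Suc (\<nu> + n)) r = step 1 A pre (survival A (enat \<nu>) (\<nu> + n)) r"
    using survival_Suc[OF shift Suc.prems, of A "\<nu> + n"] step_pre[OF survival_measurable] by (simp add: d)
  also have "\<dots> = step 1 A pre ((step 1 A pre ^^ \<nu>) (surv 1 A post n)) r"
    using Suc by (intro step_cong AE_pre_nonneg) auto
  finally show ?case by simp
qed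

lemma survival_before: "0 \<le> r \<Longrightarrow> survival A (enat \<nu>) \<nu> r = surv 1 A pre \<nu> r"
  using survival_change[of r A \<nu> 0] by (simp add: surv_def)

lemma prob_space_pre: "prob_space pre"
  unfolding pre_def by (intro prob_space.prob_space_distr prob_space_density f) simp

lemma emeasure_post_le_1: "emeasure post UNIV \<le> 1"
proof -
  have "emeasure post UNIV = (\<integral>\<^sup>+l. 1 \<partial>post)" by (simp add: post_def)
  also have "\<dots> = (\<integral>\<^sup>+y. ennreal (if 0 < f y then g y else 0) * 1 \<partial>\<mu>)" by (rule nn_integral_post) simp
  also have "\<dots> \<le> (\<integral>\<^sup>+y. ennreal (g y) \<partial>\<mu>)" by (intro nn_integral_mono) simp
  finally show ?thesis using g by (simp add: prob_density_def)
qed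

lemma finite_measure_post: "finite_measure post"
  using emeasure_post_le_1 by (intro finite_measureI) (auto simp: post_def top_unique)

lemma sigma_finite_pre: "sigma_finite_measure pre" and sigma_finite_post: "sigma_finite_measure post"
proof -
  interpret pre: prob_space pre by (rule prob_space_pre)
  interpret post: finite_measure post by (rule finite_measure_post)
  show "sigma_finite_measure pre" "sigma_finite_measure post" by unfold_locales
qed

lemma surv_post_measurable[measurable]: "surv 1 A post n \<in> borel_measurable borel"
  unfolding surv_def by (rule steps_borel[OF sigma_finite_post]) simp_all

lemma delay_sum: "0 \<le> r \<Longrightarrow> (\<Sum>j. survival A (enat \<nu>) (\<nu> + j) r) = (step 1 A pre ^^ \<nu>) (mean_time 1 A post) r"
  unfolding mean_time_def[abs_def] by (subst steps_suminf[OF sigma_finite_pre]) (simp_all add: survival_change)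

lemma ARL_SR: "0 \<le> r \<Longrightarrow> ARL P (SR_time f g A r) = mean_time 1 A pre r"
  unfolding ARL_def mean_time_def
  by (subst nn_integral_enat_function, measurable)
    (simp add: space_P survival_def[symmetric] survival_pre)

lemma ADD_inf_SR:
  assumes "0 \<le> r"
  shows "ADD_inf P (SR_time f g A r) = lim (\<lambda>\<nu>. (step 1 A pre ^^ \<nu>) (mean_time 1 A post) r / surv 1 A pre \<nu> r)"
proof -
  have "(\<integral>\<^sup>+\<omega>. ennreal_of_enat (SR_time f g A r \<omega> - enat \<nu>)
      \<partial>uniform_measure (P (enat \<nu>)) {\<omega> \<in> space (P (enat \<nu>)). enat \<nu> < SR_time f g A r \<omega>})
    = (step 1 A pre ^^ \<nu>) (mean_time 1 A post) r / surv 1 A pre \<nu> r" for \<nu>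
    by (subst nn_integral_residual, measurable)
      (simp add: space_P survival_def[symmetric] survival_before delay_sum assms)
  then show ?thesis by (simp add: ADD_inf_def)
qed

lemma emeasure_SRP:
  assumes Q: "real_distribution Q"
  shows "emeasure (Q \<Otimes>\<^sub>M P \<nu>) {z \<in> space (Q \<Otimes>\<^sub>M P \<nu>). enat n < SRP_time f g A z} = (\<integral>\<^sup>+r. survival A \<nu> n r \<partial>Q)"
proof -
  interpret Q: real_distribution Q by fact
  interpret P: prob_space "P \<nu>" by (rule prob_space_P)
  note [measurable_cong] = Q.events_eq_borel
  have sets: "sets (Q \<Otimes>\<^sub>M P \<nu>) = sets (borel \<Otimes>\<^sub>M obs_space)"
    by (intro sets_pair_measure_cong) (simp_all add: Q.events_eq_borel)
  have space: "space (Q \<Otimes>\<^sub>M P \<nu>) = space (borel \<Otimes>\<^sub>M obs_space)"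
    using sets_eq_imp_space_eq[OF sets] .
  have eq: "{z \<in> space (Q \<Otimes>\<^sub>M P \<nu>). enat n < SRP_time f g A z}
      = {z \<in> space (borel \<Otimes>\<^sub>M obs_space). enat n < SR_time f g A (fst z) (snd z)}"
    by (auto simp: SRP_time_def space case_prod_beta)
  have "emeasure (Q \<Otimes>\<^sub>M P \<nu>) {z \<in> space (Q \<Otimes>\<^sub>M P \<nu>). enat n < SRP_time f g A z}
      = (\<integral>\<^sup>+r. emeasure (P \<nu>) (Pair r -` {z \<in> space (borel \<Otimes>\<^sub>M obs_space). enat n < SR_time f g A (fst z) (snd z)}) \<partial>Q)"
    unfolding eq using SR_time_gt_sets sets by (intro P.emeasure_pair_measure_alt) simp
  then show ?thesis by (simp add: survival_def space_pair_measure vimage_def)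
qed

lemma SRP_time_measurable:
  assumes Q: "real_distribution Q"
  shows "SRP_time f g A \<in> measurable (Q \<Otimes>\<^sub>M P \<nu>) (count_space UNIV)"
proof -
  interpret Q: real_distribution Q by fact
  have sets: "sets (Q \<Otimes>\<^sub>M P \<nu>) = sets (borel \<Otimes>\<^sub>M obs_space)"
    by (intro sets_pair_measure_cong) (simp_all add: Q.events_eq_borel)
  show ?thesis
    unfolding measurable_cong_sets[OF sets refl]
    using SR_time_measurable by (simp add: SRP_time_def case_prod_beta')
qed

lemma ARL_SRP:
  assumes Q: "real_distribution Q" and nonneg: "AE r in Q. 0 \<le> r"
  shows "ARL (\<lambda>\<nu>. Q \<Otimes>\<^sub>M P \<nu>) (SRP_time f g A) = (\<integral>\<^sup>+r. mean_time 1 A pre r \<partial>Q)"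
proof -
  interpret Q: real_distribution Q by fact
  have "ARL (\<lambda>\<nu>. Q \<Otimes>\<^sub>M P \<nu>) (SRP_time f g A) = (\<Sum>n. \<integral>\<^sup>+r. survival A \<infinity> n r \<partial>Q)"
    unfolding ARL_def
    by (subst nn_integral_enat_function[OF SRP_time_measurable[OF Q]]) (simp add: emeasure_SRP[OF Q])
  also have "\<dots> = (\<integral>\<^sup>+r. (\<Sum>n. survival A \<infinity> n r) \<partial>Q)"
    by (rule nn_integral_suminf[symmetric]) (simp add: measurable_cong_sets[OF Q.events_eq_borel refl])
  also have "\<dots> = (\<integral>\<^sup>+r. mean_time 1 A pre r \<partial>Q)"
    using nonneg by (intro nn_integral_cong_AE, eventually_elim) (simp add: mean_time_def survival_pre)
  finally show ?thesis .
qed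

lemma ADD_inf_SRP:
  assumes Q: "real_distribution Q" and nonneg: "AE r in Q. 0 \<le> r"
  shows "ADD_inf (\<lambda>\<nu>. Q \<Otimes>\<^sub>M P \<nu>) (SRP_time f g A)
    = lim (\<lambda>\<nu>. (\<integral>\<^sup>+r. (step 1 A pre ^^ \<nu>) (mean_time 1 A post) r \<partial>Q) / (\<integral>\<^sup>+r. surv 1 A pre \<nu> r \<partial>Q))"
proof -
  interpret Q: real_distribution Q by fact
  have "(\<integral>\<^sup>+z. ennreal_of_enat (SRP_time f g A z - enat \<nu>)
      \<partial>uniform_measure (Q \<Otimes>\<^sub>M P (enat \<nu>)) {z \<in> space (Q \<Otimes>\<^sub>M P (enat \<nu>)). enat \<nu> < SRP_time f g A z})
    = (\<integral>\<^sup>+r. (step 1 A pre ^^ \<nu>) (mean_time 1 A post) r \<partial>Q) / (\<integral>\<^sup>+r. surv 1 A pre \<nu> r \<partial>Q)" for \<nu>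
  proof -
    have "(\<Sum>j. \<integral>\<^sup>+r. survival A (enat \<nu>) (\<nu> + j) r \<partial>Q) = (\<integral>\<^sup>+r. (\<Sum>j. survival A (enat \<nu>) (\<nu> + j) r) \<partial>Q)"
      by (rule nn_integral_suminf[symmetric]) (simp add: measurable_cong_sets[OF Q.events_eq_borel refl])
    also have "\<dots> = (\<integral>\<^sup>+r. (step 1 A pre ^^ \<nu>) (mean_time 1 A post) r \<partial>Q)"
      using nonneg by (intro nn_integral_cong_AE, eventually_elim) (simp add: delay_sum)
    finally have 1: "(\<Sum>j. \<integral>\<^sup>+r. survival A (enat \<nu>) (\<nu> + j) r \<partial>Q) = (\<integral>\<^sup>+r. (step 1 A pre ^^ \<nu>) (mean_time 1 A post) r \<partial>Q)" .
    have 2: "(\<integral>\<^sup>+r. survival A (enat \<nu>) \<nu> r \<partial>Q) = (\<integral>\<^sup>+r. surv 1 A pre \<nu> r \<partial>Q)"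
      using nonneg by (intro nn_integral_cong_AE, eventually_elim) (simp add: survival_before)
    show ?thesis
      by (subst nn_integral_residual[OF SRP_time_measurable[OF Q]]) (simp add: emeasure_SRP[OF Q] 1 2)
  qed
  then show ?thesis by (simp add: ADD_inf_def)
qed

end

section \<open>Consequences of the assumptions on the model\<close>
lemma tendsto_ennreal_band:
  fixes X :: "nat \<Rightarrow> ennreal"
  assumes H: "0 \<le> H"
    and band: "\<And>e. 0 < e \<Longrightarrow> \<forall>\<^sub>F n in sequentially. ennreal (H - e) \<le> X n \<and> X n \<le> ennreal (H + e)"
  shows "X \<longlonglongrightarrow> ennreal H"
proof (rule order_tendstoI)
  fix a assume a: "a < ennreal H"
  then obtain \<alpha> where \<alpha>: "a = ennreal \<alpha>" "0 \<le> \<alpha>" by (cases a) auto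
  then have lt: "\<alpha> < H" using a by (simp add: ennreal_less_iff)
  show "\<forall>\<^sub>F n in sequentially. a < X n"
  proof (rule eventually_mono[OF band[of "(H - \<alpha>) / 2"]])
    fix n assume "ennreal (H - (H - \<alpha>) / 2) \<le> X n \<and> X n \<le> ennreal (H + (H - \<alpha>) / 2)"
    moreover have "ennreal \<alpha> < ennreal (H - (H - \<alpha>) / 2)"
      using lt \<alpha> by (subst ennreal_less_iff) (auto simp: field_simps)
    ultimately show "a < X n" using \<alpha> by (auto intro: less_le_trans)
  qed (use lt in simp)
next
  fix a assume a: "ennreal H < a"
  obtain \<beta> where \<beta>: "H < \<beta>" "ennreal \<beta> \<le> a"
  proof (cases a)
    case (real \<beta>)
    then show ?thesis using a H that[of \<beta>] by (simp add: ennreal_less_iff)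
  next
    case top
    then show ?thesis using that[of "H + 1"] by simp
  qed
  show "\<forall>\<^sub>F n in sequentially. X n < a"
  proof (rule eventually_mono[OF band[of "(\<beta> - H) / 2"]])
    fix n assume "ennreal (H - (\<beta> - H) / 2) \<le> X n \<and> X n \<le> ennreal (H + (\<beta> - H) / 2)"
    moreover have "ennreal (H + (\<beta> - H) / 2) < ennreal \<beta>"
      using \<beta> H by (subst ennreal_less_iff) (auto simp: field_simps)
    ultimately show "X n < a" using \<beta>(2) by (auto intro: le_less_trans less_le_trans)
  qed (use \<beta> in simp)
qed

lemma divide_band:
  fixes a b s w :: ennreal
  assumes "a * s \<le> w" "w \<le> b * s" "s \<noteq> 0" "s \<noteq> \<top>"
  shows "a \<le> w / s \<and> w / s \<le> b"
proof -
  have "c * s / s = c" for c using assms by (simp add: ennreal_mult_divide_eq)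
  then show ?thesis
    using divide_right_mono_ennreal[OF assms(1), of s] divide_right_mono_ennreal[OF assms(2), of s]
    by simp
qed

context lr_law
begin

text \<open>
  Both cases together: the limit of the conditional means is the same for all starting values from
  which survival is possible.
\<close>
lemma ratio_limit_exists:
  assumes A: "0 < A" "(1 + A) * lo \<le> A" and nd: "\<exists>e. cdf_less e \<noteq> 0 \<and> cdf_less e \<noteq> 1"
    and u: "antimono_on {0..} u" "u \<in> borel_measurable borel" "u 0 < \<top>"
  shows "\<exists>H\<ge>0. \<forall>r\<ge>0. (1 + r) * lo < A \<longrightarrow> (\<lambda>n. (step 1 A M ^^ n) u r / S A n r) \<longlonglongrightarrow> ennreal H"
proof -
  interpret R: ratio M A u by unfold_locales (use A u in auto)
  show ?thesis
  proof (cases "(1 + A) * lo = A")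
    case True
    then show ?thesis by (rule R.limit_critical)
  next
    case False
    interpret R: noncritical_ratio M A u by unfold_locales (use A nd False in auto)
    obtain H where H: "0 \<le> H" "\<And>e. 0 < e \<Longrightarrow> \<forall>\<^sub>F n in sequentially. \<forall>r\<ge>0.
      ennreal (H - e) * S A n r \<le> (step 1 A M ^^ n) u r \<and> (step 1 A M ^^ n) u r \<le> ennreal (H + e) * S A n r"
      using R.limit_uniform by blast
    have "(\<lambda>n. (step 1 A M ^^ n) u r / S A n r) \<longlonglongrightarrow> ennreal H" if r: "0 \<le> r" "(1 + r) * lo < A" for r
    proof (rule tendsto_ennreal_band[OF H(1)])
      fix e :: real assume "0 < e"
      from H(2)[OF this]
      show "\<forall>\<^sub>F n in sequentially. ennreal (H - e) \<le> (step 1 A M ^^ n) u r / S A n r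
        \<and> (step 1 A M ^^ n) u r / S A n r \<le> ennreal (H + e)"
      proof eventually_elim
        fix n assume "\<forall>r\<ge>0. ennreal (H - e) * S A n r \<le> (step 1 A M ^^ n) u r \<and> (step 1 A M ^^ n) u r \<le> ennreal (H + e) * S A n r"
        then show "ennreal (H - e) \<le> (step 1 A M ^^ n) u r / S A n r \<and> (step 1 A M ^^ n) u r / S A n r \<le> ennreal (H + e)"
          using r surv_pos[OF A(2,1) r] less_imp_neq[OF surv_fin[of 1 r A n]] by (intro divide_band) auto
      qed
    qed
    then show ?thesis using H(1) by blast
  qed
qed

lemma step_eq_0:
  assumes "A \<le> (1 + r) * lo" "0 \<le> r"
  shows "step 1 A M u r = 0"
proof -
  have "step 1 A M u r = (\<integral>\<^sup>+l. 0 \<partial>M)"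
    unfolding step_def
  proof (rule nn_integral_cong_AE, use AE_lo_le in \<open>rule eventually_mono\<close>)
    fix l assume "lo \<le> l"
    then have "(1 + r) * lo \<le> (1 + r) * l" using assms by (intro mult_left_mono) auto
    then have "A \<le> (1 + r) * l" by (rule order_trans[OF assms(1)])
    then show "u ((1 + r) * l) * indicator {..<A} ((1 + r) * l) = 0" by simp
  qed
  then show ?thesis by simp
qed

lemma mean_time_eq_1: "A \<le> (1 + r) * lo \<Longrightarrow> 0 \<le> r \<Longrightarrow> mean_time 1 A M r = 1"
  using mean_time_rec[of 1 A r] step_eq_0 by simp

text \<open>
  Survival probabilities from zero are comparable with those from \<open>r\<close>, so one mean is finite if the
  other is.
\<close>
lemma mean_time_start_finite:
  assumes A: "0 < A" "(1 + A) * lo \<le> A" and nd: "\<exists>e. cdf_less e \<noteq> 0 \<and> cdf_less e \<noteq> 1"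
    and r: "0 \<le> r" "(1 + r) * lo < A" and fin: "mean_time 1 A M r < \<top>"
  shows "mean_time 1 A M 0 < \<top>"
proof (cases "(1 + A) * lo = A")
  case True
  obtain k where k: "r < path lo k 0" using critical_path[OF True A(1) r] by blast
  have "S A (n + k) 0 \<le> S A n r" for n
  proof -
    have "(step 1 A M ^^ k) (S A n) 0 \<le> S A n (path lo k 0)"
      by (intro steps_le_lo surv_antimono) auto
    also have "\<dots> \<le> S A n r" using k r by (intro surv_le_start) auto
    finally show ?thesis by (simp add: add.commute[of n] surv_add)
  qed
  then have "(\<Sum>n. S A (n + k) 0) \<le> mean_time 1 A M r"
    unfolding mean_time_def by (intro suminf_le) auto
  moreover have "(\<Sum>n<k. S A n 0) < \<top>" by simp
  moreover have "mean_time 1 A M 0 = (\<Sum>n. S A (n + k) 0) + (\<Sum>n<k. S A n 0)"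
    unfolding mean_time_def by (rule suminf_offset) auto
  ultimately show ?thesis using fin by (auto intro: le_less_trans)
next
  case False
  interpret R: noncritical M A by unfold_locales (use A nd False in auto)
  obtain C where C: "C < \<top>" "\<And>n. S A n 0 \<le> C * S A n A" using R.survival_comparison by blast
  have "mean_time 1 A M 0 \<le> (\<Sum>n. C * S A n A)"
    unfolding mean_time_def using C by (intro suminf_le) auto
  also have "\<dots> = C * mean_time 1 A M A" by (simp add: mean_time_def)
  finally have 1: "mean_time 1 A M 0 \<le> C * mean_time 1 A M A" .
  have "mean_time 1 A M A * step 1 A M (\<lambda>_. 1) r = step 1 A M (\<lambda>_. mean_time 1 A M A * 1) r"
    by (rule step_cmult[symmetric]) simp
  also have "\<dots> \<le> step 1 A M (mean_time 1 A M) r"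
    using r by (intro step_mono) (auto intro: mean_time_le)
  also have "\<dots> \<le> mean_time 1 A M r" using mean_time_rec[of 1 A r] by simp
  finally have 2: "mean_time 1 A M A * step 1 A M (\<lambda>_. 1) r < \<top>" using fin by (auto intro: le_less_trans)
  have "step 1 A M (\<lambda>_. 1) r \<noteq> 0" using surv_pos[OF A(2,1) r, of 1] by (simp add: surv_def)
  then have "mean_time 1 A M A < \<top>" using 2 by (auto simp: ennreal_mult_less_top less_top[symmetric] ennreal_mult_eq_top_iff)
  then have "C * mean_time 1 A M A < \<top>" using C(1) by (simp add: ennreal_mult_less_top)
  then show ?thesis using 1 by (rule le_less_trans[rotated])
qed

end

lemma log_concave_ln:
  assumes lc: "log_concave F" and pos: "0 < F x" "0 < F y" and t: "0 \<le> t" "t \<le> 1"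
  shows "0 < F ((1 - t) * x + t * y)" "(1 - t) * ln (F x) + t * ln (F y) \<le> ln (F ((1 - t) * x + t * y))"
proof -
  have ln: "ereal_ln (ereal (F x)) = ereal (ln (F x))" "ereal_ln (ereal (F y)) = ereal (ln (F y))"
    using pos by (simp_all add: ereal_ln_def)
  have "ereal (1 - t) * ereal_ln (ereal (F x)) + ereal t * ereal_ln (ereal (F y))
      \<le> ereal_ln (ereal (F ((1 - t) * x + t * y)))"
    using lc t unfolding log_concave_def by blast
  then have e: "ereal ((1 - t) * ln (F x) + t * ln (F y)) \<le> ereal_ln (ereal (F ((1 - t) * x + t * y)))"
    by (simp add: ln)
  show "0 < F ((1 - t) * x + t * y)"
    using e by (rule contrapos_pp) (simp add: ereal_ln_def)
  then show "(1 - t) * ln (F x) + t * ln (F y) \<le> ln (F ((1 - t) * x + t * y))"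
    using e by (simp add: ereal_ln_def)
qed

lemma log_concave_cross:
  assumes lc: "log_concave F" and nonneg: "\<And>x. 0 \<le> F x" and ab: "a \<le> b" and h: "0 \<le> h"
  shows "F a * F (b + h) \<le> F (a + h) * F b"
proof (cases "F a = 0 \<or> F (b + h) = 0")
  case True
  then show ?thesis using nonneg by auto
next
  case False
  then have pos: "0 < F a" "0 < F (b + h)" using nonneg by (auto simp: less_le)
  show ?thesis
  proof (cases "a = b + h")
    case True
    then have "h = 0" "a = b" using ab h by auto
    then show ?thesis by simp
  next
    case False
    then have d: "0 < b + h - a" using ab h by simp
    define t where "t = h / (b + h - a)"
    have t: "0 \<le> t" "t \<le> 1" using d ab h by (auto simp: t_def)
    have td: "t * (b + h - a) = h" using d by (simp add: t_def)
    have e1: "(1 - t) * a + t * (b + h) = a + h" using td by (simp add: algebra_simps)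
    have e2: "(1 - (1 - t)) * a + (1 - t) * (b + h) = b" using td by (simp add: algebra_simps)
    note l1 = log_concave_ln[OF lc pos t, unfolded e1]
    have t': "0 \<le> 1 - t" "1 - t \<le> 1" using t by auto
    note l2 = log_concave_ln[OF lc pos t', unfolded e2]
    have "ln (F a) + ln (F (b + h)) \<le> ln (F (a + h)) + ln (F b)"
      using l1(2) l2(2) by (simp add: algebra_simps)
    then have "ln (F a * F (b + h)) \<le> ln (F (a + h) * F b)"
      using pos l1(1) l2(1) by (simp add: ln_mult)
    then show ?thesis using pos l1(1) l2(1) by (subst (asm) ln_le_cancel_iff) auto
  qed
qed

text \<open>
  If a log-concave function grew by a factor \<open>q > 1\<close> over a step of length \<open>h\<close>, it would decay at least
  geometrically to the left of that step, contradicting the lower bound.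
\<close>
lemma log_concave_bounded_below_imp_const:
  assumes lc: "log_concave F" and low: "0 < p" "\<And>x. p \<le> F x" and up: "\<And>x. F x \<le> 1" and h: "0 \<le> h"
  shows "F (b + h) \<le> F b"
proof (rule ccontr)
  assume gt: "\<not> ?thesis"
  have pos: "0 < F x" for x using low(1) low(2)[of x] by simp
  define q where "q = F (b + h) / F b"
  have q: "1 < q" using gt pos[of b] by (simp add: q_def)
  have step: "q * F (b - real (Suc n) * h) \<le> F (b - real n * h)" for n
  proof -
    have "F (b - real (Suc n) * h) * F (b + h) \<le> F (b - real (Suc n) * h + h) * F b"
      using pos h by (intro log_concave_cross[OF lc]) (auto intro: less_imp_le)
    moreover have "b - real (Suc n) * h + h = b - real n * h" by (simp add: algebra_simps)
    ultimately have "F (b - real (Suc n) * h) * F (b + h) \<le> F (b - real n * h) * F b" by (simp only:)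
    then show ?thesis using pos[of b] by (simp add: q_def pos_divide_le_eq mult.commute)
  qed
  have iter: "q ^ n * F (b - real n * h) \<le> F b" for n
  proof (induction n)
    case (Suc n)
    have "q ^ Suc n * F (b - real (Suc n) * h) = q ^ n * (q * F (b - real (Suc n) * h))" by simp
    also have "\<dots> \<le> q ^ n * F (b - real n * h)" using step[of n] q by (intro mult_left_mono) auto
    finally show ?case using Suc by simp
  qed simp
  obtain n where n: "1 / p < q ^ n" using real_arch_pow[OF q] by blast
  have "1 < q ^ n * p" using n low(1) by (simp add: field_simps)
  also have "\<dots> \<le> q ^ n * F (b - real n * h)" using low(2) q by (intro mult_left_mono) auto
  also have "\<dots> \<le> 1" using iter[of n] up[of b] by simp
  finally show False by simp
qed

lemma ereal_ln_le_iff: "ereal_ln L \<le> ereal x \<longleftrightarrow> L \<le> ereal (exp x)"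
proof (cases L)
  case (real l)
  then show ?thesis
    by (auto simp: ereal_ln_def ln_le_cancel_iff[of _ "exp x", simplified, symmetric] not_le[symmetric]
      intro: order_trans[of _ 0] dest: order_trans[of _ 0])
qed (auto simp: ereal_ln_def)

context change_model
begin

lemma log_LR_cdf_pre: "log_LR_cdf \<mu> f g \<infinity> x = measure pre {..exp x}"
proof -
  have comp: "distr (P \<infinity>) (dens \<infinity> 0) (\<lambda>\<omega>. \<omega> 0) = dens \<infinity> 0"
    unfolding P_eq by (rule distr_PiM_component) (auto intro: prob_space_dens)
  have [measurable]: "{y \<in> space \<mu>. LR y \<le> ereal (exp x)} \<in> sets \<mu>" by measurable
  have "emeasure (dens \<infinity> 0) {y \<in> space \<mu>. LR y \<le> ereal (exp x)}
    = emeasure (P \<infinity>) ((\<lambda>\<omega>. \<omega> 0) -` {y \<in> space \<mu>. LR y \<le> ereal (exp x)} \<inter> space (P \<infinity>))"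
    by (subst comp[symmetric], subst emeasure_distr) auto
  also have "(\<lambda>\<omega>. \<omega> 0) -` {y \<in> space \<mu>. LR y \<le> ereal (exp x)} \<inter> space (P \<infinity>)
    = {\<omega> \<in> space (P \<infinity>). ereal_ln (LR (\<omega> 0)) \<le> ereal x}"
    by (auto simp: ereal_ln_le_iff space_P space_PiM PiE_iff)
  finally have "emeasure (P \<infinity>) {\<omega> \<in> space (P \<infinity>). ereal_ln (LR (\<omega> 0)) \<le> ereal x}
    = emeasure (density \<mu> (\<lambda>x. ennreal (f x))) {y \<in> space \<mu>. LR y \<le> ereal (exp x)}"
    by (simp add: dens_def)
  also have "\<dots> = (\<integral>\<^sup>+y. ennreal (f y) * indicator {y \<in> space \<mu>. LR y \<le> ereal (exp x)} y \<partial>\<mu>)"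
    by (rule emeasure_density) measurable
  also have "\<dots> = (\<integral>\<^sup>+y. ennreal (f y) * indicator {..exp x} (\<rho> y) \<partial>\<mu>)"
  proof (rule nn_integral_cong)
    fix y assume y: "y \<in> space \<mu>"
    show "ennreal (f y) * indicator {y \<in> space \<mu>. LR y \<le> ereal (exp x)} y = ennreal (f y) * indicator {..exp x} (\<rho> y)"
      by (cases "0 < f y") (use y in \<open>auto simp: LR_eq \<rho>_eq indicator_def ennreal_neg\<close>)
  qed
  also have "\<dots> = (\<integral>\<^sup>+l. indicator {..exp x} l \<partial>pre)" by (rule nn_integral_pre[symmetric]) simp
  also have "\<dots> = emeasure pre {..exp x}" by simp
  finally show ?thesis by (simp add: log_LR_cdf_def measure_def)
qed

lemma space_pre: "space pre = UNIV"
  by (simp add: pre_def)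

text \<open>
  A positive mass at zero would bound the distribution function of the log-likelihood ratio from
  below and hence make it constant, so the likelihood ratio would vanish almost surely. The statistic
  would then never leave zero after the first step and no alarm would ever be raised.
\<close>
lemma AE_pre_pos:
  assumes lc: "log_concave (log_LR_cdf \<mu> f g \<infinity>)" and A: "0 < A" and fin: "mean_time 1 A pre r < \<top>"
  shows "AE l in pre. 0 < l"
proof -
  interpret pre: prob_space pre by (rule prob_space_pre)
  define p where "p = measure pre {..0}"
  have "p = 0"
  proof (rule ccontr)
    assume "p \<noteq> 0"
    then have p: "0 < p" by (simp add: p_def less_le)
    have const: "log_LR_cdf \<mu> f g \<infinity> (b + h) \<le> log_LR_cdf \<mu> f g \<infinity> b" if "0 \<le> h" for b h
    proof (rule log_concave_bounded_below_imp_const[OF lc p _ _ that])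
      fix x
      show "p \<le> log_LR_cdf \<mu> f g \<infinity> x" unfolding log_LR_cdf_pre p_def
        by (intro pre.finite_measure_mono) (auto intro: order_trans)
    qed (simp add: log_LR_cdf_pre)
    have le: "measure pre {..exp y} \<le> measure pre {..exp x}" for x y
    proof (cases "x \<le> y")
      case True
      then show ?thesis using const[of "y - x" x] by (simp add: log_LR_cdf_pre)
    next
      case False
      then show ?thesis by (intro pre.finite_measure_mono) (auto intro: order_trans)
    qed
    have one: "measure pre {..exp x} = 1" for x
    proof -
      have inc: "incseq (\<lambda>n. {..exp (real n)})" by (auto simp: incseq_def intro: order_trans)
      have "\<exists>n. l \<le> exp (real n)" for l
      proof -
        obtain n where "l \<le> real n" using real_arch_simple by blast
        then have "l \<le> exp (real n)" using exp_ge_add_one_self[of "real n"] by linarith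
        then show ?thesis ..
      qed
      then have "(\<Union>n. {..exp (real n)}) = UNIV" by auto
      then have "(\<lambda>n. measure pre {..exp (real n)}) \<longlonglongrightarrow> 1"
        using pre.finite_Lim_measure_incseq[OF _ inc] pre.prob_space by (simp add: image_subset_iff space_pre)
      then have "1 \<le> measure pre {..exp x}" using le by (intro LIMSEQ_le_const2) auto
      then show ?thesis using pre.prob_le_1[of "{..exp x}"] by simp
    qed
    have "AE l in pre. l = 0"
    proof -
      have "AE l in pre. \<forall>n. l \<le> exp (- real n)"
      proof (subst AE_all_countable, rule allI)
        fix n
        have "AE l in pre. l \<in> {..exp (- real n)}"
          using one[of "- real n"] by (subst pre.prob_eq_1[symmetric]) auto
        then show "AE l in pre. l \<le> exp (- real n)" by simp
      qed
      with AE_pre_nonneg show ?thesis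
      proof eventually_elim
        fix l :: real assume l: "0 \<le> l" "\<forall>n. l \<le> exp (- real n)"
        have "(\<lambda>n. exp (- real n)) \<longlonglongrightarrow> 0"
          by (intro filterlim_compose[OF exp_at_bot] filterlim_compose[OF filterlim_uminus_at_bot_at_top] filterlim_real_sequentially)
        then have "l \<le> 0" using l(2) by (intro LIMSEQ_le_const) auto
        then show "l = 0" using l(1) by simp
      qed
    qed
    then have "step 1 A pre (\<lambda>_. 1) x = (\<integral>\<^sup>+l. 1 \<partial>pre)" for x
      unfolding step_def using A by (intro nn_integral_cong_AE) (auto elim!: eventually_mono)
    then have "step 1 A pre (\<lambda>_. 1) = (\<lambda>_. 1)" by (intro ext) (simp add: pre.emeasure_space_1)
    then have "surv 1 A pre n = (\<lambda>_. 1)" for n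
      by (induction n) (simp_all add: surv_def)
    then have "mean_time 1 A pre r = (\<Sum>n. 1)" by (simp add: mean_time_def)
    also have "\<dots> = \<top>" by (rule suminf_one_ennreal)
    finally show False using fin by simp
  qed
  then have "emeasure pre {..0} = 0" by (simp add: p_def pre.emeasure_eq_measure)
  then show ?thesis by (intro AE_I[of _ _ "{..0}"]) auto
qed

text \<open>
  Log-concavity for closed half-lines passes to open ones by approximating all four points from below
  with the same factor \<open>q n < 1\<close>.
\<close>
lemma log_conc_pre:
  assumes lc: "log_concave (log_LR_cdf \<mu> f g \<infinity>)"
  shows "log_conc pre"
  unfolding log_conc_def
proof (intro allI impI)
  interpret pre: prob_space pre by (rule prob_space_pre)
  fix \<sigma> s t :: real assume st: "1 \<le> \<sigma>" "0 < s" "s \<le> t"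
  define G where "G u = measure pre {..u}" for u
  have cross: "G u * G (\<sigma> * v) \<le> G (\<sigma> * u) * G v" if "0 < u" "u \<le> v" for u v
  proof -
    have "log_LR_cdf \<mu> f g \<infinity> (ln u) * log_LR_cdf \<mu> f g \<infinity> (ln v + ln \<sigma>)
      \<le> log_LR_cdf \<mu> f g \<infinity> (ln u + ln \<sigma>) * log_LR_cdf \<mu> f g \<infinity> (ln v)"
      using that st by (intro log_concave_cross[OF lc]) (auto simp: log_LR_cdf_pre)
    then show ?thesis using that st by (simp add: log_LR_cdf_pre G_def exp_add mult.commute)
  qed
  define q where "q n = 1 - 1 / real (n + 2)" for n
  have q: "0 < q n" "q n < 1" "q n \<le> q (Suc n)" for n by (auto simp: q_def field_simps)
  have qlim: "q \<longlonglongrightarrow> 1"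
  proof -
    have "(\<lambda>n. 1 - 1 / real (n + 2)) \<longlonglongrightarrow> 1 - 0"
      by (intro tendsto_intros LIMSEQ_ignore_initial_segment[OF lim_1_over_n])
    then show ?thesis by (simp add: q_def[abs_def])
  qed
  have lim: "(\<lambda>n. G (q n * u)) \<longlonglongrightarrow> measure pre {..<u}" if u: "0 < u" for u
  proof -
    have "incseq q" using q by (intro incseq_SucI)
    then have inc: "incseq (\<lambda>n. {..q n * u})"
      using u by (auto simp: incseq_def intro: order_trans mult_right_mono)
    have "(\<Union>n. {..q n * u}) = {..<u}"
    proof (intro equalityI subsetI)
      fix x assume "x \<in> {..<u}"
      then have "x / u < 1" using u by simp
      then have "eventually (\<lambda>n. x / u < q n) sequentially" using qlim by (intro order_tendstoD)
      then obtain n where "x / u < q n" by (auto simp: eventually_sequentially)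
      then have "x \<le> q n * u" using u by (simp add: field_simps)
      then show "x \<in> (\<Union>n. {..q n * u})" by auto
    next
      fix x assume "x \<in> (\<Union>n. {..q n * u})"
      then obtain n where "x \<le> q n * u" by auto
      also have "\<dots> < 1 * u" using q[of n] u by (intro mult_strict_right_mono) auto
      finally show "x \<in> {..<u}" by simp
    qed
    then show ?thesis
      using pre.finite_Lim_measure_incseq[OF _ inc] by (simp add: G_def image_subset_iff)
  qed
  have pos: "0 < t" "0 < \<sigma> * s" "0 < \<sigma> * t" using st by auto
  have "measure pre {..<s} * measure pre {..<\<sigma> * t} \<le> measure pre {..<\<sigma> * s} * measure pre {..<t}"
  proof (rule LIMSEQ_le)
    show "(\<lambda>n. G (q n * s) * G (q n * (\<sigma> * t))) \<longlonglongrightarrow> measure pre {..<s} * measure pre {..<\<sigma> * t}"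
      using st pos by (intro tendsto_mult lim) auto
    show "(\<lambda>n. G (q n * (\<sigma> * s)) * G (q n * t)) \<longlonglongrightarrow> measure pre {..<\<sigma> * s} * measure pre {..<t}"
      using st pos by (intro tendsto_mult lim) auto
    show "\<exists>N. \<forall>n\<ge>N. G (q n * s) * G (q n * (\<sigma> * t)) \<le> G (q n * (\<sigma> * s)) * G (q n * t)"
      using cross[of "q n * s" "q n * t" for n] q st
      by (auto simp: mult.left_commute[of \<sigma>] less_imp_le)
  qed
  then show "emeasure pre {..<s} * emeasure pre {..<\<sigma> * t} \<le> emeasure pre {..<\<sigma> * s} * emeasure pre {..<t}"
    by (simp add: pre.emeasure_eq_measure flip: ennreal_mult)
qed

text \<open>
  Otherwise the conditional distribution functions, being quotients by zero, would all vanish from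
  some time on, and their limit could not be a distribution function.
\<close>
lemma surv_0_pos:
  assumes lim: "has_limit_law (quasi_stationary_cdf_seq \<mu> f g A)" and pos: "AE l in pre. 0 < l"
  shows "surv 1 A pre n 0 \<noteq> 0"
proof
  assume n: "surv 1 A pre n 0 = 0"
  interpret pre: prob_space pre by (rule prob_space_pre)
  interpret K: pos_subprob pre
    by unfold_locales (use pos pre.emeasure_space_1 in \<open>auto simp: space_pre\<close>)
  obtain Q where Q: "real_distribution Q" "\<And>x. (\<lambda>n. quasi_stationary_cdf_seq \<mu> f g A n x) \<longlonglongrightarrow> cdf Q x"
    using lim by (auto simp: has_limit_law_def)
  interpret Q: real_distribution Q by (rule Q(1))
  have "quasi_stationary_cdf_seq \<mu> f g A m x = 0" if "n \<le> m" for m x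
  proof -
    have "surv 1 A pre m 0 = 0" using K.surv_mono_n[of 1 0 n m A] that n by simp
    then have "survival A \<infinity> m 0 = 0" by (simp add: survival_pre)
    then have "measure (P \<infinity>) {\<omega> \<in> space (P \<infinity>). enat m < SR_time f g A 0 \<omega>} = 0"
      by (simp add: survival_def space_P measure_def)
    then show ?thesis by (simp add: quasi_stationary_cdf_seq_def cond_prob_def)
  qed
  then have "(\<lambda>m. quasi_stationary_cdf_seq \<mu> f g A m x) \<longlonglongrightarrow> 0" for x
    by (intro tendsto_eventually eventually_sequentiallyI[of n])
  then have "cdf Q x = 0" for x using LIMSEQ_unique[OF Q(2)] by blast
  then have "(cdf Q \<longlongrightarrow> 0) at_top" by (simp add: fun_eq_iff[symmetric] tendsto_eventually)
  then show False using tendsto_unique[OF _ _ Q.cdf_lim_at_top_prob] by force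
qed

text \<open>
  After the first observation the statistic is positive, so the quasi-stationary distribution function
  vanishes at zero.
\<close>
lemma quasi_stationary_law:
  assumes lim: "has_limit_law (quasi_stationary_cdf_seq \<mu> f g A)" and pos: "AE l in pre. 0 < l"
  shows "real_distribution (quasi_stationary_law \<mu> f g A)" "AE r in quasi_stationary_law \<mu> f g A. 0 < r"
proof -
  obtain Q where Q: "real_distribution Q" "\<And>x. (\<lambda>n. quasi_stationary_cdf_seq \<mu> f g A n x) \<longlonglongrightarrow> cdf Q x"
    using lim by (auto simp: has_limit_law_def)
  interpret Q: real_distribution Q by (rule Q(1))
  interpret P: prob_space "P \<infinity>" by (rule prob_space_P)
  have "(\<lambda>x. lim (\<lambda>n. quasi_stationary_cdf_seq \<mu> f g A n x)) = cdf Q"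
    using Q(2) by (auto intro!: limI)
  then have eq: "quasi_stationary_law \<mu> f g A = interval_measure (cdf Q)"
    by (simp add: quasi_stationary_law_def limit_law_def)
  show "real_distribution (quasi_stationary_law \<mu> f g A)"
    unfolding eq by (intro real_distribution_interval_measure Q.cdf_nondecreasing Q.cdf_is_right_cont
      Q.cdf_lim_at_bot Q.cdf_lim_at_top_prob)
  have "AE y in dens \<infinity> i. 0 < LR y" for i
  proof -
    have "AE y in density \<mu> (\<lambda>x. ennreal (f x)). 0 < \<rho> y"
      using pos unfolding pre_def by (subst (asm) AE_distr_iff) auto
    then have "AE y in density \<mu> (\<lambda>x. ennreal (f x)). 0 < LR y"
    proof (rule eventually_mono)
      fix y assume "0 < \<rho> y" then show "0 < LR y" unfolding \<rho>_def by (cases "LR y") auto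
    qed
    moreover have "dens \<infinity> i = density \<mu> (\<lambda>x. ennreal (f x))" by (simp add: dens_def)
    ultimately show ?thesis by (simp only:)
  qed
  then have LR_pos: "AE \<omega> in P \<infinity>. 0 < LR (\<omega> i)" for i
    unfolding P_eq by (intro AE_PiM_component prob_space_dens) auto
  have nonneg: "0 \<le> SR_stat f g 0 \<omega> n" if "\<omega> \<in> space obs_space" for \<omega> n
    using that LR_nonneg by (induction n) (auto simp: space_PiM PiE_iff)
  have zero: "quasi_stationary_cdf_seq \<mu> f g A (Suc n) 0 = 0" for n
  proof -
    have "AE \<omega> in P \<infinity>. \<not> (SR_stat f g 0 \<omega> (Suc n) \<le> ereal 0 \<and> enat (Suc n) < SR_time f g A 0 \<omega>)"
      using LR_pos[of n] AE_space
    proof eventually_elim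
      fix \<omega> assume \<omega>: "0 < LR (\<omega> n)" "\<omega> \<in> space (P \<infinity>)"
      have "0 \<le> SR_stat f g 0 \<omega> n" using \<omega> nonneg by (simp add: space_P)
      then have "0 < 1 + SR_stat f g 0 \<omega> n" by (cases "SR_stat f g 0 \<omega> n") (auto simp: one_ereal_def)
      then have "0 < SR_stat f g 0 \<omega> (Suc n)" using \<omega> by (simp add: ereal_zero_less_0_iff)
      then show "\<not> (SR_stat f g 0 \<omega> (Suc n) \<le> ereal 0 \<and> enat (Suc n) < SR_time f g A 0 \<omega>)"
        by (auto simp: zero_ereal_def[symmetric] dest: leD simp del: SR_stat.simps)
    qed
    then have "emeasure (P \<infinity>) {\<omega> \<in> space (P \<infinity>). SR_stat f g 0 \<omega> (Suc n) \<le> ereal 0 \<and> enat (Suc n) < SR_time f g A 0 \<omega>} = 0"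
      by (rule emeasure_eq_0_AE)
    then show ?thesis
      by (simp add: quasi_stationary_cdf_seq_def cond_prob_def measure_def del: SR_stat.simps)
  qed
  have "(\<lambda>n. quasi_stationary_cdf_seq \<mu> f g A n 0) \<longlonglongrightarrow> 0"
    using zero by (subst filterlim_sequentially_Suc[symmetric]) simp
  then have "cdf Q 0 = 0" using LIMSEQ_unique[OF Q(2)] by blast
  then have "emeasure (quasi_stationary_law \<mu> f g A) {..0} = 0"
    unfolding eq by (subst emeasure_interval_measure_Iic)
      (auto intro: Q.cdf_nondecreasing Q.cdf_is_right_cont Q.cdf_lim_at_bot)
  then show "AE r in quasi_stationary_law \<mu> f g A. 0 < r"
    by (intro AE_I[of _ _ "{..0}"]) (auto simp: eq)
qed

text \<open>
  On the finite values, the post-change law has density \<open>l\<close> with respect to the pre-change law. This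
  density is positive, so both have the same null sets, and it is smaller than one on \<open>{..<1}\<close>.
\<close>
lemma post_law_properties:
  assumes pos: "AE l in pre. 0 < l"
  shows "pos_subprob post" "\<And>B. B \<in> sets borel \<Longrightarrow> emeasure post B = 0 \<Longrightarrow> emeasure pre B = 0"
    "emeasure post {..<1} < 1"
proof -
  interpret pre: prob_space pre by (rule prob_space_pre)
  show "pos_subprob post"
  proof
    show "AE l in post. 0 < l"
      unfolding post_density by (subst AE_density) auto
  qed (simp_all add: emeasure_post_le_1)
  show null: "emeasure pre B = 0" if [measurable]: "B \<in> sets borel" and B0: "emeasure post B = 0" for B
  proof -
    have "emeasure post B = (\<integral>\<^sup>+l. ennreal l * indicator B l \<partial>pre)"
      unfolding post_density by (rule emeasure_density) auto
    then have "(\<integral>\<^sup>+l. ennreal l * indicator B l \<partial>pre) = 0" using B0 by simp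
    then have "AE l in pre. ennreal l * indicator B l = 0"
      by (subst (asm) nn_integral_0_iff_AE) auto
    then have "AE l in pre. l \<notin> B"
      using pos by eventually_elim (auto simp: indicator_def ennreal_eq_0_iff)
    then show ?thesis
      by (subst (asm) AE_iff_measurable[where N = B]) (auto simp: space_pre)
  qed
  have post1: "emeasure post {..<1} = (\<integral>\<^sup>+l. ennreal l * indicator {..<1} l \<partial>pre)"
    unfolding post_density by (rule emeasure_density) auto
  have le: "ennreal l * indicator {..<1} l \<le> indicator {..<1} l" for l :: real
    by (auto simp: indicator_def ennreal_le_1)
  have "emeasure post {..<1} \<noteq> 1"
  proof
    assume one: "emeasure post {..<1} = 1"
    have "(\<integral>\<^sup>+l. ennreal l * indicator {..<1} l \<partial>pre) \<le> (\<integral>\<^sup>+l. indicator {..<1::real} l \<partial>pre)"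
      using le by (intro nn_integral_mono)
    then have "1 \<le> emeasure pre {..<1}" using one post1 by simp
    then have pre1: "emeasure pre {..<1} = 1" using pre.emeasure_le_1[of "{..<1}"] by simp
    have "AE l in pre. ennreal l * indicator {..<1} l = (indicator {..<1} l :: ennreal)"
      using le one post1 pre1 by (intro nn_integral_eq_imp_AE) auto
    then have "AE l in pre. l \<notin> {..<1}"
      by (rule eventually_mono) (auto simp: indicator_def ennreal_eq_1)
    then have "emeasure pre {..<1} = 0"
      by (subst (asm) AE_iff_measurable[where N = "{..<1}"]) (auto simp: space_pre)
    then show False using pre1 by simp
  qed
  moreover have "emeasure post {..<1} \<le> 1"
    using emeasure_mono[of "{..<1}" UNIV post] emeasure_post_le_1 by simp
  ultimately show "emeasure post {..<1} < 1" by simp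
qed

lemma lr_law_pre:
  assumes "log_concave (log_LR_cdf \<mu> f g \<infinity>)" "AE l in pre. 0 < l"
  shows "lr_law pre"
proof -
  interpret pre: prob_space pre by (rule prob_space_pre)
  show ?thesis
    by unfold_locales (use assms pre.emeasure_space_1 log_conc_pre in \<open>auto simp: space_pre\<close>)
qed

end

section \<open>The asymptotic delay of the SR--r and SRP procedures\<close>
theorem theorem3p9:
  fixes \<mu> :: "'x measure" and f g :: "'x \<Rightarrow> real"
    and \<gamma> A_Q :: real and A :: "real \<Rightarrow> real"
  assumes "prob_density \<mu> f" and "prob_density \<mu> g"
    and "has_limit_law (stationary_cdf_seq \<mu> f g)"
    and "\<And>r. 0 \<le> r \<Longrightarrow> has_limit_law (quasi_stationary_cdf_seq \<mu> f g (A r))"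
    and "has_limit_law (quasi_stationary_cdf_seq \<mu> f g A_Q)"
    and "log_concave (log_LR_cdf \<mu> f g \<infinity>)"
    and "log_concave (log_LR_cdf \<mu> f g 0)"
    and "1 < \<gamma>"
    and "\<And>r. 0 \<le> r \<Longrightarrow> 0 < A r"
    and "\<And>r. 0 \<le> r \<Longrightarrow> ARL (obs_law \<mu> f g) (SR_time f g (A r) r) = ennreal \<gamma>"
    and "0 < A_Q"
    and "ARL (SRP_law \<mu> f g A_Q) (SRP_time f g A_Q) = ennreal \<gamma>"
  shows "strict_mono_on {0..} (\<lambda>r. ADD_inf (obs_law \<mu> f g) (SR_time f g (A r) r))
    \<and> (INF r\<in>{0..}. ADD_inf (obs_law \<mu> f g) (SR_time f g (A r) r))
        = ADD_inf (obs_law \<mu> f g) (SR_time f g (A 0) 0)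
    \<and> ADD_inf (obs_law \<mu> f g) (SR_time f g (A 0) 0)
        < ADD_inf (SRP_law \<mu> f g A_Q) (SRP_time f g A_Q)"
proof -
  interpret change_model \<mu> f g by unfold_locales fact+
  let ?w = "\<lambda>A n x. (step 1 A pre ^^ n) (mean_time 1 A post) x / surv 1 A pre n x"
    and ?W = "\<lambda>n. (step 1 A_Q pre ^^ n) (mean_time 1 A_Q post)"
    and ?S = "surv 1 A_Q pre"
  note limit = assms(4) and \<gamma> = \<open>1 < \<gamma>\<close> and A_pos = assms(9)
  have ARL: "mean_time 1 (A r) pre r = ennreal \<gamma>" if "0 \<le> r" for r
    using assms(10)[OF that] ARL_SR[OF that] by simp
  have pos: "AE l in pre. 0 < l"
    by (rule AE_pre_pos[OF assms(6) A_pos[of 0], of 0]) (simp_all add: ARL)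
  interpret pre: lr_law pre by (rule lr_law_pre[OF assms(6) pos])
  note post = post_law_properties[OF pos]
  interpret post: pos_subprob post by (rule post(1))
  have crit: "(1 + A r) * pre.lo \<le> A r" if "0 \<le> r" for r
    using that by (intro pre.threshold_ge surv_0_pos limit pos A_pos)
  have nondeg: "\<exists>e. pre.cdf_less e \<noteq> 0 \<and> pre.cdf_less e \<noteq> 1"
    by (rule pre.nondegenerate[OF surv_0_pos[OF limit[OF order_refl] pos]]) (simp add: ARL)
  have dom: "(1 + r) * pre.lo < A r" if r: "0 \<le> r" for r
  proof (rule ccontr)
    assume "\<not> ?thesis"
    then have "ennreal \<gamma> = 1" using pre.mean_time_eq_1[of "A r" r] ARL[OF r] r by simp
    then show False using \<gamma> by (simp add: ennreal_eq_1)
  qed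
  have fin0: "mean_time 1 (A r) pre 0 < \<top>" if "0 \<le> r" for r
    using that by (intro pre.mean_time_start_finite[OF A_pos crit nondeg _ dom]) (simp_all add: ARL)
  have fin_pre: "mean_time 1 (A r) pre x < \<top>" if "0 \<le> r" "0 \<le> x" for r x
    using fin0[OF that(1)] pre.mean_time_le[of 1 1 0 x "A r"] that by (auto intro: le_less_trans)
  have "\<forall>r. \<exists>h. 0 \<le> r \<longrightarrow> 0 \<le> h \<and> (\<forall>x\<ge>0. (1 + x) * pre.lo < A r \<longrightarrow>
      (\<lambda>n. ?w (A r) n x) \<longlonglongrightarrow> ennreal h)"
  proof
    fix r
    show "\<exists>h. 0 \<le> r \<longrightarrow> 0 \<le> h \<and> (\<forall>x\<ge>0. (1 + x) * pre.lo < A r \<longrightarrow>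
      (\<lambda>n. ?w (A r) n x) \<longlonglongrightarrow> ennreal h)"
    proof (cases "0 \<le> r")
      case True
      have "\<exists>h\<ge>0. \<forall>x\<ge>0. (1 + x) * pre.lo < A r \<longrightarrow>
        (\<lambda>n. ?w (A r) n x) \<longlonglongrightarrow> ennreal h"
        using True by (intro pre.ratio_limit_exists A_pos crit nondeg post.mean_time_antimono
          post.mean_time_finite post) auto
      then show ?thesis by blast
    qed simp
  qed
  from choice[OF this] obtain H where H_spec: "\<forall>r. 0 \<le> r \<longrightarrow> 0 \<le> H r \<and> (\<forall>x\<ge>0. (1 + x) * pre.lo < A r \<longrightarrow>
      (\<lambda>n. ?w (A r) n x) \<longlonglongrightarrow> ennreal (H r))" ..
  have H: "\<And>r. 0 \<le> r \<Longrightarrow> 0 \<le> H r"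
    "\<And>r x. 0 \<le> r \<Longrightarrow> 0 \<le> x \<Longrightarrow> (1 + x) * pre.lo < A r \<Longrightarrow>
      (\<lambda>n. ?w (A r) n x) \<longlonglongrightarrow> ennreal (H r)"
    using H_spec by blast+
  \<comment> \<open>The delay depends on \<open>r\<close> only through the threshold: \<open>H r\<close> is the common limit for all starting values.\<close>
  have ADD: "ADD_inf P (SR_time f g (A r) r) = ennreal (H r)" if "0 \<le> r" for r
    unfolding ADD_inf_SR[OF that] using that by (intro limI H dom)
  have zero_dom: "(1 + 0) * pre.lo < A r" if "0 \<le> r" for r
    using that by (intro pre.next_lt_threshold[OF crit]) (simp_all add: A_pos)
  \<comment> \<open>A larger head start shortens the time to a false alarm, so it needs a larger threshold.\<close>
  have A_mono: "A r < A r'" if rr: "0 \<le> r" "r < r'" for r r'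
  proof (rule ccontr)
    assume "\<not> ?thesis"
    then have "mean_time 1 (A r') pre r' \<le> mean_time 1 (A r) pre r'"
      using rr by (intro pre.mean_time_le_threshold) auto
    also have "\<dots> < mean_time 1 (A r) pre r"
      using rr by (intro pre.mean_time_strict[OF pre.pos_subprob_axioms _ A_pos crit] fin_pre dom) auto
    finally show False using rr by (simp add: ARL)
  qed
  have H_mono: "H r < H r'" if rr: "0 \<le> r" "r < r'" for r r'
    using rr by (intro pre.limit_strict_mono[OF post(1,2,3) A_pos crit A_mono fin0 H(2) H(2) H(1) H(1)] zero_dom) auto
  have strict: "ennreal (H r) < ennreal (H r')" if "0 \<le> r" "r < r'" for r r'
    using H_mono[OF that] H(1)[of r] that by (simp add: ennreal_less_iff)
  have mono: "strict_mono_on {0..} (\<lambda>r. ADD_inf P (SR_time f g (A r) r))"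
    by (rule strict_mono_onI) (simp add: ADD strict)
  have inf: "(INF r\<in>{0..}. ADD_inf P (SR_time f g (A r) r)) = ADD_inf P (SR_time f g (A 0) 0)"
  proof (rule antisym)
    show "(INF r\<in>{0..}. ADD_inf P (SR_time f g (A r) r)) \<le> ADD_inf P (SR_time f g (A 0) 0)"
      by (rule INF_lower) simp
    show "ADD_inf P (SR_time f g (A 0) 0) \<le> (INF r\<in>{0..}. ADD_inf P (SR_time f g (A r) r))"
    proof (rule INF_greatest)
      fix r :: real assume "r \<in> {0..}"
      then show "ADD_inf P (SR_time f g (A 0) 0) \<le> ADD_inf P (SR_time f g (A r) r)"
        using strict[of 0 r] by (cases "r = 0") (auto simp: ADD less_imp_le)
    qed
  qed
  define Q where "Q = quasi_stationary_law \<mu> f g A_Q"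
  have Q: "real_distribution Q" "AE r in Q. 0 < r"
    unfolding Q_def by (intro quasi_stationary_law assms(5) pos)+
  interpret Q: real_distribution Q by (rule Q(1))
  note [measurable_cong] = Q.events_eq_borel
  have Q_UNIV: "emeasure Q UNIV = 1" using Q.emeasure_space_1 by simp
  have Q0: "AE r in Q. 0 \<le> r" using Q(2) by (rule eventually_mono) simp
  have SRP: "SRP_law \<mu> f g A_Q = (\<lambda>\<nu>. Q \<Otimes>\<^sub>M P \<nu>)"
    by (simp add: SRP_law_def[abs_def] Q_def)
  have ARL_Q: "(\<integral>\<^sup>+r. mean_time 1 A_Q pre r \<partial>Q) = ennreal \<gamma>"
    using assms(12) ARL_SRP[OF Q(1) Q0, of A_Q] by (simp add: SRP)
  have A0: "0 < A 0" "(1 + A 0) * pre.lo \<le> A 0" using A_pos crit by auto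
  \<comment> \<open>The SRP procedure starts above zero almost surely, so at the threshold \<open>A 0\<close> it would raise false alarms too early.\<close>
  have AQ: "A 0 < A_Q"
  proof (rule ccontr)
    assume "\<not> ?thesis"
    then have le: "mean_time 1 A_Q pre r \<le> mean_time 1 (A 0) pre r" if "0 \<le> r" for r
      using that by (intro pre.mean_time_le_threshold) auto
    have le0: "mean_time 1 (A 0) pre r \<le> ennreal \<gamma>" if "0 \<le> r" for r
      using pre.mean_time_le[of 1 1 0 r "A 0"] that by (simp add: ARL)
    have le_\<gamma>: "AE r in Q. mean_time 1 A_Q pre r \<le> ennreal \<gamma>"
      using Q0 by eventually_elim (use le le0 in \<open>blast intro: order_trans\<close>)
    have "AE r in Q. mean_time 1 A_Q pre r = ennreal \<gamma>"
      by (rule nn_integral_eq_imp_AE[OF _ _ le_\<gamma>]) (simp_all add: ARL_Q Q_UNIV)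
    with Q(2) have "AE r in Q. False"
    proof eventually_elim
      fix r :: real assume r: "0 < r" "mean_time 1 A_Q pre r = ennreal \<gamma>"
      have "mean_time 1 (A 0) pre r < mean_time 1 (A 0) pre 0"
        using r by (intro pre.mean_time_strict[OF pre.pos_subprob_axioms _ A0] fin_pre dom) auto
      then show False using le[of r] r by (simp add: ARL)
    qed
    then show False by simp
  qed
  \<comment> \<open>A threshold above \<open>A 0\<close> cannot be critical, so the convergence is uniform in the starting value and survives integration over \<open>Q\<close>.\<close>
  have AQ_noncrit: "(1 + A_Q) * pre.lo < A_Q"
  proof -
    have "pre.lo < 1"
    proof (rule ccontr)
      assume "\<not> ?thesis"
      then have "(1 + A 0) * 1 \<le> (1 + A 0) * pre.lo" using A0 by (intro mult_left_mono) auto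
      then have "(1 + A 0) * 1 \<le> A 0" using A0(2) by (rule order_trans)
      then show False by simp
    qed
    then have "A 0 * (1 - pre.lo) < A_Q * (1 - pre.lo)" using AQ by (intro mult_strict_right_mono) auto
    then show ?thesis using A0(2) by (simp add: algebra_simps)
  qed
  interpret R: noncritical_ratio pre A_Q "mean_time 1 A_Q post"
    by unfold_locales
      (use assms(11) AQ_noncrit nondeg in \<open>auto intro: post.mean_time_antimono post.mean_time_finite post\<close>)
  obtain K where K: "0 \<le> K" "\<And>e. 0 < e \<Longrightarrow> \<forall>\<^sub>F n in sequentially. \<forall>r\<ge>0.
      ennreal (K - e) * ?S n r \<le> ?W n r \<and>
      ?W n r \<le> ennreal (K + e) * ?S n r"
    using R.limit_uniform by blast
  have lim0: "(\<lambda>n. ?w A_Q n 0) \<longlonglongrightarrow> ennreal K"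
  proof (rule tendsto_ennreal_band[OF K(1)])
    fix e :: real assume "0 < e"
    from K(2)[OF this]
    show "\<forall>\<^sub>F n in sequentially. ennreal (K - e) \<le> ?w A_Q n 0
      \<and> ?w A_Q n 0 \<le> ennreal (K + e)"
    proof (rule eventually_mono, intro divide_band)
      fix n
      show "?S n 0 \<noteq> 0" by (rule surv_0_pos[OF assms(5) pos])
      show "?S n 0 \<noteq> \<top>" by (rule less_imp_neq[OF pre.surv_fin]) auto
    qed auto
  qed
  have "H 0 < K"
    using zero_dom[of 0] by (intro pre.limit_strict_mono[OF post(1,2,3) A0 AQ fin0 H(2) lim0 H(1) K(1)]) auto
  have limQ: "(\<lambda>n. (\<integral>\<^sup>+r. ?W n r \<partial>Q) / (\<integral>\<^sup>+r. ?S n r \<partial>Q)) \<longlonglongrightarrow> ennreal K"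
  proof (rule tendsto_ennreal_band[OF K(1)])
    fix e :: real assume "0 < e"
    have meas[measurable]: "surv 1 A_Q pre n \<in> borel_measurable Q" for n
      by (simp add: measurable_cong_sets[OF Q.events_eq_borel refl])
    from K(2)[OF \<open>0 < e\<close>]
    show "\<forall>\<^sub>F n in sequentially. ennreal (K - e)
        \<le> (\<integral>\<^sup>+r. ?W n r \<partial>Q) / (\<integral>\<^sup>+r. ?S n r \<partial>Q)
      \<and> (\<integral>\<^sup>+r. ?W n r \<partial>Q) / (\<integral>\<^sup>+r. ?S n r \<partial>Q) \<le> ennreal (K + e)"
    proof (rule eventually_mono, intro divide_band)
      fix n
      assume b: "\<forall>r\<ge>0. ennreal (K - e) * ?S n r \<le> ?W n r \<and>
        ?W n r \<le> ennreal (K + e) * ?S n r"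
      show "ennreal (K - e) * (\<integral>\<^sup>+r. ?S n r \<partial>Q) \<le> (\<integral>\<^sup>+r. ?W n r \<partial>Q)"
        unfolding nn_integral_cmult[OF meas, symmetric]
        by (intro nn_integral_mono_AE eventually_mono[OF Q0]) (use b in auto)
      show "(\<integral>\<^sup>+r. ?W n r \<partial>Q) \<le> ennreal (K + e) * (\<integral>\<^sup>+r. ?S n r \<partial>Q)"
        unfolding nn_integral_cmult[OF meas, symmetric]
        by (intro nn_integral_mono_AE eventually_mono[OF Q0]) (use b in auto)
      have "(\<integral>\<^sup>+r. ?S n r \<partial>Q) \<le> (\<integral>\<^sup>+r. 1 \<partial>Q)"
        by (intro nn_integral_mono_AE eventually_mono[OF Q0]) (simp add: pre.surv_le_1)
      then show "(\<integral>\<^sup>+r. ?S n r \<partial>Q) \<noteq> \<top>" by (auto simp: Q_UNIV top_unique)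
      show "(\<integral>\<^sup>+r. ?S n r \<partial>Q) \<noteq> 0"
      proof
        assume "(\<integral>\<^sup>+r. ?S n r \<partial>Q) = 0"
        then have "AE r in Q. ?S n r = 0"
          by (subst (asm) nn_integral_0_iff_AE) auto
        \<comment> \<open>Starting values without a chance of survival stop at time one, but the mean time to a false alarm exceeds one.\<close>
        with Q0 have "AE r in Q. mean_time 1 A_Q pre r = 1"
        proof eventually_elim
          fix r :: real assume "0 \<le> r" "?S n r = 0"
          then show "mean_time 1 A_Q pre r = 1"
            using pre.surv_pos[OF R.crit assms(11), of r n] by (intro pre.mean_time_eq_1) (auto simp: not_less[symmetric])
        qed
        then have "(\<integral>\<^sup>+r. mean_time 1 A_Q pre r \<partial>Q) = (\<integral>\<^sup>+r. 1 \<partial>Q)" by (rule nn_integral_cong_AE)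
        then show False using ARL_Q \<gamma> by (simp add: Q_UNIV ennreal_eq_1)
      qed
    qed
  qed
  have "ADD_inf (SRP_law \<mu> f g A_Q) (SRP_time f g A_Q) = ennreal K"
    unfolding SRP ADD_inf_SRP[OF Q(1) Q0] by (rule limI[OF limQ])
  then have "ADD_inf P (SR_time f g (A 0) 0) < ADD_inf (SRP_law \<mu> f g A_Q) (SRP_time f g A_Q)"
    using \<open>H 0 < K\<close> H(1)[of 0] by (simp add: ADD ennreal_less_iff)
  then show ?thesis using mono inf by blast
qed

end
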